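(* A curve $(b_t)_{t\ge0}$ valued in $\mathcal B$ is a Sinkhorn potential flow starting from $\bar b_0\in\mathcal B$ if and only if $(b_t)\in\mathscr H^1_{loc}([0,\infty);\mathcal H_c)$, $b_0=\bar b_0$, and for a.e. $t$ the inclusion $\dot b_t+Wb_t+\tilde P b_t\ni 0$ holds in $C(\mathcal X)$, i.e. there is $p_t\in\tilde Pb_t$ with $\dot b_t+Wb_t+p_t=0$.
   Context: Standing setting: $(\mathcal X,\mathsf d)$ compact metric space; $\varepsilon>0$; $c\in C(\mathcal X\times\mathcal X)$ symmetric, nonnegative, with $k_c:=\exp(-c/\varepsilon)$ a positive definite universal kernel; $V\in C(\mathcal X)$, $E(\mu)=\int Vd\mu$. $\mathcal M(\mathcal X)$, $\mathcal M_+(\mathcal X)$, $\mathcal P(\mathcal X)$: signed, nonnegative, probability Radon measures. Schrödinger potentials: $T_\varepsilon(f,\mu)(y):=-\varepsilon\log\int\exp((f(x)-c(x,y))/\varepsilon)d\mu(x)$; $(f_{\mu,\nu},f_{\nu,\mu})$ the unique continuous pair with $f_{\mu,\nu}=T_\varepsilon(f_{\nu,\mu},\nu)$, $f_{\nu,\mu}=T_\varepsilon(f_{\mu,\nu},\mu)$, $\int f_{\mu,\nu}d\mu=\int f_{\nu,\mu}d\nu$; $f_\mu:=f_{\mu,\mu}$. $k_\mu(x,y):=\exp((f_\mu(x)+f_\mu(y)-c(x,y))/\varepsilon)$; $\mathcal H_c,\mathcal H_\mu$ the RKHSs of $k_c,k_\mu$; $H_c:\mathcal H_c^*\to\mathcal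 H_c$, $H_\mu:\mathcal H_\mu^*\to\mathcal H_\mu$ Riesz isomorphisms (on measures $H_c[\sigma](y)=\int k_c(x,y)d\sigma(x)$, likewise for $H_\mu$); $K_\mu[\phi]:=H_\mu[\phi\mu]$; $\mathrm{Id}-K_\mu^2$ invertible on $C(\mathcal X)/\mathbb R$. $B(\mu):=\exp(-f_\mu/\varepsilon)$, homeomorphism $\mathcal P(\mathcal X)\to\mathcal B:=H_c[\mathcal M_+(\mathcal X)]\cap\{\|b\|_{\mathcal H_c}=1\}$, $B^{-1}(b)=bH_c^{-1}[b]$. $T_\mu:=\{\sigma\in\mathcal H_\mu^*:\langle\sigma,1\rangle=0\}$. A curve $(\mu_t)$ is admissible if $t\mapsto B(\mu_t)\in\mathscr H^1_{loc}([0,\infty);\mathcal H_c)$; then for a.e. $t$, $\dot\mu_t\in T_{\mu_t}$ exists as weak-* derivative in $\mathcal H_{\mu_t}^*$. $P\mu:=\{p\in C(\mathcal X):p\le0,\ p=0\text{ on }\operatorname{supp}\mu\}$. A Sinkhorn potential flow starting at $\bar\mu_0$ is an admissible curve with $\mu_0=\bar\mu_0$ and, for a.e. $t$, $\frac\varepsilon2(\mathrm{Id}-K_{\mu_t}^2)^{-1}H_{\mu_t}[\dot\mu_t]+V+P\mu_t\ni0$ in $C(\mathcal X)/\mathbb R$; a curve $(b_t)$ in $\mathcal B$ is a Sinkhorn potential flow from $\bar b_0$ if $(B^{-1}(b_t))$ is one from $B^{-1}(\bar b_0)$. Operators in $b$: for $b\in H_c[\mathcal M(\mathcal X)]$, $Vb$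 is the pointwise product, $V^*b:=H_c[V\,H_c^{-1}[b]]$, and $W:=\frac2\varepsilon(V-V^* ):H_c[\mathcal M(\mathcal X)]\to C(\mathcal X)$. For $b\in H_c[\mathcal M_+(\mathcal X)]$, $\tilde Pb:=\{p\in C(\mathcal X):p\le0,\ p=0\text{ on }\operatorname{supp}H_c^{-1}[b]\}$. *)

theory Defs
  imports "HOL-Analysis.Analysis" "HOL-Probability.Probability"
begin

definition kquad :: "('a \<Rightarrow> 'a \<Rightarrow> real) \<Rightarrow> 'a set \<Rightarrow> ('a \<Rightarrow> real) \<Rightarrow> real" where
  "kquad k S a = (\<Sum>x\<in>S. \<Sum>y\<in>S. a x * a y * k x y)"

definition pos_def_kernel :: "('a \<Rightarrow> 'a \<Rightarrow> real) \<Rightarrow> bool" where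
  "pos_def_kernel k \<longleftrightarrow> (\<forall>x y. k x y = k y x) \<and> (\<forall>S a. finite S \<longrightarrow> kquad k S a \<ge> 0)"

text \<open>RKHS norm (Aronszajn): sup of evaluations against the unit ball of the span of the
  kernel sections; the RKHS is the set of functions for which this sup is finite.\<close>
definition rkhs_evals :: "('a \<Rightarrow> 'a \<Rightarrow> real) \<Rightarrow> ('a \<Rightarrow> real) \<Rightarrow> real set" where
  "rkhs_evals k g = {\<bar>\<Sum>x\<in>S. a x * g x\<bar> | S a. finite S \<and> kquad k S a \<le> 1}"

definition rkhs :: "('a \<Rightarrow> 'a \<Rightarrow> real) \<Rightarrow> ('a \<Rightarrow> real) set" where
  "rkhs k = {g. bdd_above (rkhs_evals k g)}"

definition rkhs_norm :: "('a \<Rightarrow> 'a \<Rightarrow> real) \<Rightarrow> ('a \<Rightarrow> real) \<Rightarrow> real" where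
  "rkhs_norm k g = Sup (rkhs_evals k g)"

definition rkhs_inner :: "('a \<Rightarrow> 'a \<Rightarrow> real) \<Rightarrow> ('a \<Rightarrow> real) \<Rightarrow> ('a \<Rightarrow> real) \<Rightarrow> real" where
  "rkhs_inner k g h = ((rkhs_norm k (\<lambda>x. g x + h x))\<^sup>2 - (rkhs_norm k (\<lambda>x. g x - h x))\<^sup>2) / 4"

definition universal_kernel :: "('a::metric_space \<Rightarrow> 'a \<Rightarrow> real) \<Rightarrow> bool" where
  "universal_kernel k \<longleftrightarrow> (\<forall>f. continuous_on UNIV f \<longrightarrow>
     (\<forall>e>0. \<exists>g\<in>rkhs k. \<forall>x. \<bar>f x - g x\<bar> < e))"

text \<open>Nonnegative (finite) Radon measures on the compact metric space UNIV.\<close>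
definition pos_radon :: "'a::metric_space measure \<Rightarrow> bool" where
  "pos_radon M \<longleftrightarrow> sets M = sets borel \<and> finite_measure M"

definition prob_radon :: "'a::metric_space measure \<Rightarrow> bool" where
  "prob_radon M \<longleftrightarrow> sets M = sets borel \<and> prob_space M"

definition msupp :: "'a::metric_space measure \<Rightarrow> 'a set" where
  "msupp M = {x. \<forall>U. open U \<longrightarrow> x \<in> U \<longrightarrow> emeasure M U > 0}"

definition kembed :: "('a \<Rightarrow> 'a \<Rightarrow> real) \<Rightarrow> 'a measure \<Rightarrow> 'a \<Rightarrow> real" where
  "kembed k M y = (\<integral>x. k x y \<partial>M)"

definition kc :: "real \<Rightarrow> ('a \<Rightarrow> 'a \<Rightarrow> real) \<Rightarrow> 'a \<Rightarrow> 'a \<Rightarrow> real" where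
  "kc \<epsilon> c x y = exp (- c x y / \<epsilon>)"

definition Hc_inv :: "real \<Rightarrow> ('a::metric_space \<Rightarrow> 'a \<Rightarrow> real) \<Rightarrow> ('a \<Rightarrow> real) \<Rightarrow> 'a measure" where
  "Hc_inv \<epsilon> c b = (THE M. pos_radon M \<and> b = kembed (kc \<epsilon> c) M)"

definition calB :: "real \<Rightarrow> ('a::metric_space \<Rightarrow> 'a \<Rightarrow> real) \<Rightarrow> ('a \<Rightarrow> real) set" where
  "calB \<epsilon> c = {b. (\<exists>M. pos_radon M \<and> b = kembed (kc \<epsilon> c) M) \<and> rkhs_norm (kc \<epsilon> c) b = 1}"

definition T_eps :: "real \<Rightarrow> ('a \<Rightarrow> 'a \<Rightarrow> real) \<Rightarrow> ('a \<Rightarrow> real) \<Rightarrow> 'a measure \<Rightarrow> 'a \<Rightarrow> real" where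
  "T_eps \<epsilon> c f M y = - \<epsilon> * ln (\<integral>x. exp ((f x - c x y) / \<epsilon>) \<partial>M)"

definition schr_pair :: "real \<Rightarrow> ('a::topological_space \<Rightarrow> 'a \<Rightarrow> real) \<Rightarrow> 'a measure \<Rightarrow> 'a measure
    \<Rightarrow> ('a \<Rightarrow> real) \<times> ('a \<Rightarrow> real)" where
  "schr_pair \<epsilon> c \<mu> \<nu> = (THE (f, g). continuous_on UNIV f \<and> continuous_on UNIV g \<and>
      (\<forall>y. f y = T_eps \<epsilon> c g \<nu> y) \<and> (\<forall>y. g y = T_eps \<epsilon> c f \<mu> y) \<and>
      (\<integral>x. f x \<partial>\<mu>) = (\<integral>x. g x \<partial>\<nu>))"

definition f_self :: "real \<Rightarrow> ('a::topological_space \<Rightarrow> 'a \<Rightarrow> real) \<Rightarrow> 'a measure \<Rightarrow> 'a \<Rightarrow> real" where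
  "f_self \<epsilon> c \<mu> = fst (schr_pair \<epsilon> c \<mu> \<mu>)"

definition k_mu :: "real \<Rightarrow> ('a::topological_space \<Rightarrow> 'a \<Rightarrow> real) \<Rightarrow> 'a measure \<Rightarrow> 'a \<Rightarrow> 'a \<Rightarrow> real" where
  "k_mu \<epsilon> c \<mu> x y = exp ((f_self \<epsilon> c \<mu> x + f_self \<epsilon> c \<mu> y - c x y) / \<epsilon>)"

definition K_mu :: "real \<Rightarrow> ('a::topological_space \<Rightarrow> 'a \<Rightarrow> real) \<Rightarrow> 'a measure \<Rightarrow> ('a \<Rightarrow> real) \<Rightarrow> 'a \<Rightarrow> real" where
  "K_mu \<epsilon> c \<mu> \<phi> y = (\<integral>x. k_mu \<epsilon> c \<mu> x y * \<phi> x \<partial>\<mu>)"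

definition Bmap :: "real \<Rightarrow> ('a::topological_space \<Rightarrow> 'a \<Rightarrow> real) \<Rightarrow> 'a measure \<Rightarrow> 'a \<Rightarrow> real" where
  "Bmap \<epsilon> c \<mu> x = exp (- f_self \<epsilon> c \<mu> x / \<epsilon>)"

definition Binv :: "real \<Rightarrow> ('a::metric_space \<Rightarrow> 'a \<Rightarrow> real) \<Rightarrow> ('a \<Rightarrow> real) \<Rightarrow> 'a measure" where
  "Binv \<epsilon> c b = density (Hc_inv \<epsilon> c b) (\<lambda>x. ennreal (b x))"

text \<open>bd is an (a.e.-defined) weak derivative of the H_k-valued curve b on [0,oo), with
  b in H^1_loc: b t in H_k, bd t in H_k, t |-> ||bd t||^2 locally integrable,
  and b t = b 0 + int_0^t bd s ds (tested pointwise, i.e. against the kernel sections).\<close>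
definition H1loc_with :: "('a \<Rightarrow> 'a \<Rightarrow> real) \<Rightarrow> (real \<Rightarrow> 'a \<Rightarrow> real) \<Rightarrow> (real \<Rightarrow> 'a \<Rightarrow> real) \<Rightarrow> bool" where
  "H1loc_with k b bd \<longleftrightarrow>
     (\<forall>t\<ge>0. b t \<in> rkhs k \<and> bd t \<in> rkhs k) \<and>
     (\<forall>x. (\<lambda>s. bd s x) \<in> borel_measurable lborel) \<and>
     (\<forall>T\<ge>0. set_integrable lborel {0..T} (\<lambda>s. (rkhs_norm k (bd s))\<^sup>2)) \<and>
     (\<forall>t\<ge>0. \<forall>x. set_integrable lborel {0..t} (\<lambda>s. bd s x) \<and>
        b t x = b 0 x + (\<integral>s\<in>{0..t}. bd s x \<partial>lborel))"

definition H1loc :: "('a \<Rightarrow> 'a \<Rightarrow> real) \<Rightarrow> (real \<Rightarrow> 'a \<Rightarrow> real) \<Rightarrow> bool" where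
  "H1loc k b \<longleftrightarrow> (\<exists>bd. H1loc_with k b bd)"

definition admissible :: "real \<Rightarrow> ('a::metric_space \<Rightarrow> 'a \<Rightarrow> real) \<Rightarrow> (real \<Rightarrow> 'a measure) \<Rightarrow> bool" where
  "admissible \<epsilon> c \<mu> \<longleftrightarrow> (\<forall>t\<ge>0. prob_radon (\<mu> t)) \<and> H1loc (kc \<epsilon> c) (\<lambda>t. Bmap \<epsilon> c (\<mu> t))"

text \<open>g = H_{mu_t}[dot mu_t], where dot mu_t in T_{mu_t} is the weak-* derivative of the curve
  in H_{mu_t}^* (identified with H_{mu_t} via the Riesz isomorphism).\<close>
definition weak_star_deriv :: "real \<Rightarrow> ('a::metric_space \<Rightarrow> 'a \<Rightarrow> real) \<Rightarrow> (real \<Rightarrow> 'a measure) \<Rightarrow> real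
    \<Rightarrow> ('a \<Rightarrow> real) \<Rightarrow> bool" where
  "weak_star_deriv \<epsilon> c \<mu> t g \<longleftrightarrow> g \<in> rkhs (k_mu \<epsilon> c (\<mu> t)) \<and>
     rkhs_inner (k_mu \<epsilon> c (\<mu> t)) g (\<lambda>_. 1) = 0 \<and>
     (\<forall>h\<in>rkhs (k_mu \<epsilon> c (\<mu> t)).
        ((\<lambda>s. ((\<integral>x. h x \<partial>\<mu> s) - (\<integral>x. h x \<partial>\<mu> t)) / (s - t))
           \<longlongrightarrow> rkhs_inner (k_mu \<epsilon> c (\<mu> t)) g h) (at t within {0..}))"

definition Pset :: "'a::metric_space measure \<Rightarrow> ('a \<Rightarrow> real) set" where
  "Pset \<mu> = {p. continuous_on UNIV p \<and> (\<forall>x. p x \<le> 0) \<and> (\<forall>x\<in>msupp \<mu>. p x = 0)}"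

text \<open>The inclusion  (eps/2)(Id - K_mu^2)^{-1} H_mu[dot mu] + V + P mu \<ni> 0  in C(X)/R:
  u is a representative of (Id - K_mu^2)^{-1}[g] in C(X)/R.\<close>
definition sinkhorn_flow :: "real \<Rightarrow> ('a::metric_space \<Rightarrow> 'a \<Rightarrow> real) \<Rightarrow> ('a \<Rightarrow> real) \<Rightarrow> (real \<Rightarrow> 'a measure)
    \<Rightarrow> 'a measure \<Rightarrow> bool" where
  "sinkhorn_flow \<epsilon> c V \<mu> \<mu>0 \<longleftrightarrow> admissible \<epsilon> c \<mu> \<and> \<mu> 0 = \<mu>0 \<and>
     (AE t in lborel. t \<ge> 0 \<longrightarrow>
        (\<exists>g u p. weak_star_deriv \<epsilon> c \<mu> t g \<and> continuous_on UNIV u \<and> p \<in> Pset (\<mu> t) \<and>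
           (\<exists>a. \<forall>x. u x - K_mu \<epsilon> c (\<mu> t) (K_mu \<epsilon> c (\<mu> t) u) x = g x + a) \<and>
           (\<exists>a. \<forall>x. \<epsilon> / 2 * u x + V x + p x = a)))"

definition sinkhorn_flow_B :: "real \<Rightarrow> ('a::metric_space \<Rightarrow> 'a \<Rightarrow> real) \<Rightarrow> ('a \<Rightarrow> real) \<Rightarrow> (real \<Rightarrow> 'a \<Rightarrow> real)
    \<Rightarrow> ('a \<Rightarrow> real) \<Rightarrow> bool" where
  "sinkhorn_flow_B \<epsilon> c V b b0 \<longleftrightarrow> (\<forall>t\<ge>0. b t \<in> calB \<epsilon> c) \<and>
     sinkhorn_flow \<epsilon> c V (\<lambda>t. Binv \<epsilon> c (b t)) (Binv \<epsilon> c b0)"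

definition Vstar :: "real \<Rightarrow> ('a::metric_space \<Rightarrow> 'a \<Rightarrow> real) \<Rightarrow> ('a \<Rightarrow> real) \<Rightarrow> ('a \<Rightarrow> real) \<Rightarrow> 'a \<Rightarrow> real" where
  "Vstar \<epsilon> c V b y = (\<integral>x. kc \<epsilon> c x y * V x \<partial>(Hc_inv \<epsilon> c b))"

definition Wop :: "real \<Rightarrow> ('a::metric_space \<Rightarrow> 'a \<Rightarrow> real) \<Rightarrow> ('a \<Rightarrow> real) \<Rightarrow> ('a \<Rightarrow> real) \<Rightarrow> 'a \<Rightarrow> real" where
  "Wop \<epsilon> c V b y = 2 / \<epsilon> * (V y * b y - Vstar \<epsilon> c V b y)"

definition Ptilde :: "real \<Rightarrow> ('a::metric_space \<Rightarrow> 'a \<Rightarrow> real) \<Rightarrow> ('a \<Rightarrow> real) \<Rightarrow> ('a \<Rightarrow> real) set" where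
  "Ptilde \<epsilon> c b = {p. continuous_on UNIV p \<and> (\<forall>x. p x \<le> 0) \<and> (\<forall>x\<in>msupp (Hc_inv \<epsilon> c b). p x = 0)}"

end

theory Submission
  imports Defs
begin

text \<open>
  Write \<open>b\<close> for a point of \<open>\<B>\<close>, \<open>M = H\<^sub>c\<^sup>-\<^sup>1[b]\<close> and \<open>\<mu> = b M\<close>.  Then \<open>b = exp (- f\<^sub>\<mu> / \<epsilon>)\<close>, because
  solutions of the Schrodinger system are unique (maximum principle), so \<open>k\<^sub>\<mu>(x, y) = k\<^sub>c(x, y) / (b x b y)\<close>,
  multiplication by \<open>b\<close> is an isometry from \<open>H\<^sub>\<mu>\<close> onto \<open>H\<^sub>c\<close>, and \<open>K\<^sub>\<mu> \<phi> = H\<^sub>c[\<phi> M] / b\<close>.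

  At almost every time the difference quotients of the curve are bounded in \<open>H\<^sub>c\<close> and converge to the
  derivative \<open>d\<close> on a countable dense set, hence uniformly and weakly in \<open>H\<^sub>c\<close>.  Differentiating
  \<open>\<mu> = b M\<close> gives the weak-* derivative of \<open>\<mu>\<close>, whose Riesz representative is \<open>(Id + K\<^sub>\<mu>)(d / b)\<close>.
  The flow equation for \<open>\<mu>\<close> thus reads \<open>(Id - K\<^sub>\<mu>\<^sup>2) u = (Id + K\<^sub>\<mu>)(d / b)\<close> modulo constants, where
  \<open>u = - 2 / \<epsilon> (V + p)\<close>.  The operator \<open>Id + K\<^sub>\<mu>\<close> is injective by positive definiteness, and the constant vanishes
  after integration against \<open>\<mu>\<close> since \<open>norm b = 1\<close> forces \<open>d\<close> to be orthogonal to \<open>b\<close>.  Hence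
  \<open>d / b = (Id - K\<^sub>\<mu>) u\<close>, which is the equation for \<open>b\<close> because \<open>K\<^sub>\<mu> p = 0\<close> for \<open>p\<close> vanishing on the support.
\<close>

section \<open>Reproducing kernel Hilbert spaces\<close>

text \<open>The weak-* derivative of \<mu> has a unique Riesz representative, so at almost every
  time both inclusions speak about one and the same \<open>d\<close>. This separates a
  differentiation problem in time from an algebraic equivalence at a fixed time. In time, the curve
  is known only through the pointwise values of \<open>bd\<close> and the local integrability of its
  squared norm. No vector-valued integral is formed: a scalar primitive of
  \<open>1 + (nm (bd r))\<^sup>2\<close> dominates the increments of the curve, and wherever this
  primitive is differentiable the difference quotients stay bounded. The measure \<open>M\<close> is
  only known to be differentiable when tested on \<open>H\<^sub>c\<close>. This is enough for
  \<open>b M\<close>, since the increment of \<open>M\<close> can be paired with functions of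
  \<open>H\<^sub>c\<close> alone and the increment of \<open>b\<close> with measures of bounded
  mass. At a fixed time, \<open>K\<^sub>\<mu> 1 = 1\<close>: constants are annihilated by
  \<open>Id - K\<^sub>\<mu>\<close> and doubled by \<open>Id + K\<^sub>\<mu>\<close>, which decides
  how an equation modulo constants becomes an exact one. The two cones correspond through
  multiplication by \<open>2 / \<epsilon> * b\<close>, which keeps sign and zero set because
  \<open>b\<close> is positive.\<close>

definition kcomb :: "('a \<Rightarrow> 'a \<Rightarrow> real) \<Rightarrow> 'a set \<Rightarrow> ('a \<Rightarrow> real) \<Rightarrow> 'a \<Rightarrow> real" where
  "kcomb k S a y = (\<Sum>x\<in>S. a x * k x y)"

text \<open>Points serve as indices, so two combinations over different finite sets are added after
  extension by zero to the union of the sets.\<close>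

definition ext0 :: "'a set \<Rightarrow> ('a \<Rightarrow> real) \<Rightarrow> 'a \<Rightarrow> real" where
  "ext0 S a x = (if x \<in> S then a x else 0)"

lemma sum_ext0:
  assumes "finite U" "S \<subseteq> U"
  shows "(\<Sum>x\<in>U. ext0 S a x * g x) = (\<Sum>x\<in>S. a x * g x)"
proof -
  have "(\<Sum>x\<in>S. a x * g x) = (\<Sum>x\<in>S. ext0 S a x * g x)"
    by (simp add: ext0_def)
  also have "\<dots> = (\<Sum>x\<in>U. ext0 S a x * g x)"
    by (rule sum.mono_neutral_left) (use assms in \<open>auto simp: ext0_def\<close>)
  finally show ?thesis by simp
qed

lemma kcomb_ext0: "finite U \<Longrightarrow> S \<subseteq> U \<Longrightarrow> kcomb k U (ext0 S a) = kcomb k S a"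
  unfolding kcomb_def by (simp add: sum_ext0)

lemma rkhs_evalsI: "finite S \<Longrightarrow> kquad k S a \<le> 1 \<Longrightarrow> \<bar>\<Sum>x\<in>S. a x * g x\<bar> \<in> rkhs_evals k g"
  unfolding rkhs_evals_def by blast

lemma rkhs_evals_nonempty: "rkhs_evals k g \<noteq> {}"
  using rkhs_evalsI[of "{}" k "\<lambda>_. 0" g] by (auto simp: kquad_def)

lemma kquad_scale: "kquad k S (\<lambda>x. t * a x) = t\<^sup>2 * kquad k S a"
  unfolding kquad_def by (simp add: sum_distrib_left power2_eq_square algebra_simps)

locale pd_kernel =
  fixes k :: "'a \<Rightarrow> 'a \<Rightarrow> real"
  assumes pd: "pos_def_kernel k"
begin

abbreviation H :: "('a \<Rightarrow> real) set" where "H \<equiv> rkhs k"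
abbreviation nm :: "('a \<Rightarrow> real) \<Rightarrow> real" where "nm \<equiv> rkhs_norm k"
abbreviation ip :: "('a \<Rightarrow> real) \<Rightarrow> ('a \<Rightarrow> real) \<Rightarrow> real" where "ip \<equiv> rkhs_inner k"

lemma ksym: "k x y = k y x"
  using pd unfolding pos_def_kernel_def by blast

lemma kquad_nonneg: "finite S \<Longrightarrow> kquad k S a \<ge> 0"
  using pd unfolding pos_def_kernel_def by blast

lemma kquad_kcomb: "kquad k S a = (\<Sum>x\<in>S. a x * kcomb k S a x)"
  unfolding kquad_def kcomb_def
  by (simp add: sum_distrib_left ksym mult.assoc)

lemma kquad_ext0: "finite U \<Longrightarrow> S \<subseteq> U \<Longrightarrow> kquad k U (ext0 S a) = kquad k S a"
  by (simp add: kquad_kcomb kcomb_ext0 sum_ext0)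

lemma kquad_add:
  "kquad k U (\<lambda>x. a x + b x) = kquad k U a + 2 * (\<Sum>x\<in>U. b x * kcomb k U a x) + kquad k U b"
proof -
  have "(\<Sum>x\<in>U. b x * kcomb k U a x) = (\<Sum>x\<in>U. \<Sum>y\<in>U. b x * a y * k x y)"
    unfolding kcomb_def by (simp add: sum_distrib_left ksym mult.assoc)
  moreover have "\<dots> = (\<Sum>x\<in>U. \<Sum>y\<in>U. a x * b y * k x y)"
    by (subst sum.swap) (simp add: ksym mult.commute mult.left_commute)
  ultimately show ?thesis
    unfolding kquad_def by (simp add: algebra_simps sum.distrib)
qed

section \<open>Variational description of the norm\<close>

lemma rkhs_norm_nonneg: "g \<in> H \<Longrightarrow> nm g \<ge> 0"
proof -
  assume "g \<in> H"
  have "0 \<in> rkhs_evals k g" using rkhs_evalsI[of "{}" k "\<lambda>_. 0" g] by (simp add: kquad_def)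
  then show ?thesis using \<open>g \<in> H\<close>
    unfolding rkhs_norm_def rkhs_def by (simp add: cSup_upper)
qed

text \<open>Homogeneous form of the supremum over \<open>kquad k S a \<le> 1\<close>. The quadratic
  form may vanish on nonzero coefficients, and this case cannot be normalised.\<close>

lemma rkhs_eval_le:
  assumes "g \<in> H" "finite S"
  shows "\<bar>\<Sum>x\<in>S. a x * g x\<bar> \<le> nm g * sqrt (kquad k S a)"
proof -
  let ?Q = "kquad k S a" and ?e = "\<Sum>x\<in>S. a x * g x"
  have up: "\<bar>\<Sum>x\<in>S. d x * g x\<bar> \<le> nm g" if "kquad k S d \<le> 1" for d
    using assms rkhs_evalsI[OF assms(2) that, of g]
    unfolding rkhs_norm_def rkhs_def by (simp add: cSup_upper)
  have scal: "\<bar>t\<bar> * \<bar>?e\<bar> \<le> nm g" if "t\<^sup>2 * ?Q \<le> 1" for t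
    using up[of "\<lambda>x. t * a x"] that
    by (simp add: kquad_scale mult.assoc abs_mult flip: sum_distrib_left)
  show ?thesis
  proof (cases "?Q = 0")
    case True
    \<comment> \<open>Every multiple of \<open>a\<close> is admissible here, so a nonzero value
      could be scaled beyond \<open>nm g\<close>.\<close>
    have "?e = 0"
    proof (rule ccontr)
      assume "?e \<noteq> 0"
      then have "\<bar>(nm g + 1) / ?e\<bar> * \<bar>?e\<bar> = nm g + 1"
        using rkhs_norm_nonneg[OF assms(1)] by (simp add: abs_mult)
      then show False using scal[of "(nm g + 1) / ?e"] True by simp
    qed
    then show ?thesis using True by simp
  next
    case False
    then have Q: "?Q > 0" using kquad_nonneg[OF assms(2), of a] by simp
    have "\<bar>1 / sqrt ?Q\<bar> * \<bar>?e\<bar> \<le> nm g"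
      by (rule scal) (use Q in \<open>simp add: power_divide\<close>)
    then show ?thesis using Q by (simp add: field_simps)
  qed
qed

lemma rkhs_norm_bound:
  assumes "g \<in> H" "finite S"
  shows "2 * (\<Sum>x\<in>S. a x * g x) - kquad k S a \<le> (nm g)\<^sup>2"
proof -
  have Q: "(sqrt (kquad k S a))\<^sup>2 = kquad k S a"
    using kquad_nonneg[OF assms(2)] by simp
  have "2 * (\<Sum>x\<in>S. a x * g x) \<le> 2 * (nm g * sqrt (kquad k S a))"
    using rkhs_eval_le[OF assms, of a] by linarith
  also have "\<dots> \<le> (nm g)\<^sup>2 + (sqrt (kquad k S a))\<^sup>2"
    using sum_squares_bound[of "nm g" "sqrt (kquad k S a)"] by linarith
  finally show ?thesis using Q by simp
qed

text \<open>The squared norm is the supremum of \<open>2 g(a) - Q(a)\<close> over finite combinations \<open>a\<close>, with \<open>Q\<close> the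
  quadratic form of the kernel; density of the kernel sections and bilinearity of the inner product all
  come from completing the square in this expression.\<close>

lemma rkhs_norm_leI:
  assumes "\<And>S a. finite S \<Longrightarrow> 2 * (\<Sum>x\<in>S. a x * g x) - kquad k S a \<le> C"
  shows "g \<in> H \<and> (nm g)\<^sup>2 \<le> C"
proof -
  have C: "C \<ge> 0" using assms[of "{}" "\<lambda>_. 0"] by (simp add: kquad_def)
  have le: "v \<le> sqrt C" if "v \<in> rkhs_evals k g" for v
  proof -
    have "\<exists>S a. v = \<bar>\<Sum>x\<in>S. a x * g x\<bar> \<and> finite S \<and> kquad k S a \<le> 1"
      using that unfolding rkhs_evals_def by simp
    then obtain S a where S: "finite S" "kquad k S a \<le> 1" and v: "v = \<bar>\<Sum>x\<in>S. a x * g x\<bar>"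
      by (elim exE conjE)
    \<comment> \<open>The test family is \<open>a\<close> multiplied by its own value
      \<open>e\<close>: then \<open>2 * e\<^sup>2 - e\<^sup>2 * kquad k S a\<close> is at least
      \<open>e\<^sup>2\<close>.\<close>
    define e where "e = (\<Sum>x\<in>S. a x * g x)"
    have "(\<Sum>x\<in>S. e * a x * g x) = e * e"
      by (simp only: mult.assoc sum_distrib_left[symmetric]) (simp add: e_def)
    then have "2 * (e * e) - e\<^sup>2 * kquad k S a \<le> C"
      using assms[OF S(1), of "\<lambda>x. e * a x"] by (simp add: kquad_scale)
    moreover have "e\<^sup>2 * kquad k S a \<le> e\<^sup>2 * 1"
      by (rule mult_left_mono[OF S(2)]) simp
    ultimately have "e\<^sup>2 \<le> C" by (simp add: power2_eq_square)
    then have "\<bar>e\<bar> \<le> sqrt C" by (simp add: real_le_rsqrt)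
    then show ?thesis unfolding v e_def by simp
  qed
  then have bdd: "g \<in> H" unfolding rkhs_def bdd_above_def by blast
  have "nm g \<le> sqrt C" unfolding rkhs_norm_def
    by (rule cSup_least[OF rkhs_evals_nonempty le])
  then have "(nm g)\<^sup>2 \<le> (sqrt C)\<^sup>2"
    by (rule power_mono) (rule rkhs_norm_nonneg[OF bdd])
  then show ?thesis using C bdd by simp
qed

text \<open>Inserting the sum of the families \<open>a\<close> and \<open>b\<close> into the
  expression for \<open>g\<close> completes the square: the mixed term of \<open>kquad_add\<close>
  is the evaluation of \<open>kcomb k S a\<close> against \<open>b\<close>, and what remains depends
  on \<open>a\<close> alone.\<close>

lemma rkhs_norm_diff_kcomb_le:
  assumes "g \<in> H" "finite S"
  shows "(\<lambda>x. g x - kcomb k S a x) \<in> H \<and>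
    (nm (\<lambda>x. g x - kcomb k S a x))\<^sup>2 \<le> (nm g)\<^sup>2 - 2 * (\<Sum>x\<in>S. a x * g x) + kquad k S a"
proof (rule rkhs_norm_leI)
  fix T :: "'a set" and b assume T: "finite T"
  let ?U = "S \<union> T" and ?a = "ext0 S a" and ?b = "ext0 T b"
  have U: "finite ?U" "S \<subseteq> ?U" "T \<subseteq> ?U" using assms T by auto
  have "2 * (\<Sum>x\<in>?U. (?a x + ?b x) * g x) - kquad k ?U (\<lambda>x. ?a x + ?b x) \<le> (nm g)\<^sup>2"
    by (rule rkhs_norm_bound[OF assms(1) U(1)])
  then show "2 * (\<Sum>x\<in>T. b x * (g x - kcomb k S a x)) - kquad k T b
    \<le> (nm g)\<^sup>2 - 2 * (\<Sum>x\<in>S. a x * g x) + kquad k S a"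
    using U by (simp add: kquad_add kquad_ext0 kcomb_ext0 sum_ext0 distrib_right sum.distrib
        right_diff_distrib sum_subtractf)
qed

section \<open>Normed space structure\<close>

lemma rkhs_zero_mem: "(\<lambda>x. 0) \<in> H" and rkhs_norm_zero: "nm (\<lambda>x. 0) = 0"
proof -
  have *: "(\<lambda>x. 0) \<in> H \<and> (nm (\<lambda>x. 0))\<^sup>2 \<le> 0"
    by (rule rkhs_norm_leI) (simp add: kquad_nonneg)
  from * show "(\<lambda>x. 0) \<in> H" by simp
  from * show "nm (\<lambda>x. 0) = 0" by simp
qed

lemma rkhs_scale_mem_le:
  assumes "g \<in> H" shows "(\<lambda>x. t * g x) \<in> H \<and> (nm (\<lambda>x. t * g x))\<^sup>2 \<le> (t * nm g)\<^sup>2"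
proof (rule rkhs_norm_leI)
  fix S :: "'a set" and a assume S: "finite S"
  let ?Q = "kquad k S a"
  have "2 * (\<Sum>x\<in>S. a x * (t * g x)) = 2 * (t * (\<Sum>x\<in>S. a x * g x))"
    by (simp add: sum_distrib_left algebra_simps)
  also have "\<dots> \<le> 2 * (\<bar>t\<bar> * \<bar>\<Sum>x\<in>S. a x * g x\<bar>)"
    using abs_ge_self[of "t * (\<Sum>x\<in>S. a x * g x)"] by (simp add: abs_mult)
  also have "\<dots> \<le> 2 * (\<bar>t\<bar> * (nm g * sqrt ?Q))"
    by (intro mult_left_mono rkhs_eval_le assms S) auto
  also have "\<dots> \<le> (\<bar>t\<bar> * nm g)\<^sup>2 + (sqrt ?Q)\<^sup>2"
    using sum_squares_bound[of "\<bar>t\<bar> * nm g" "sqrt ?Q"] by (simp add: mult.assoc)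
  also have "\<dots> = (t * nm g)\<^sup>2 + ?Q"
    using kquad_nonneg[OF S] by (simp add: power_mult_distrib)
  finally show "2 * (\<Sum>x\<in>S. a x * (t * g x)) - ?Q \<le> (t * nm g)\<^sup>2" by simp
qed

lemma rkhs_scale_mem: "g \<in> H \<Longrightarrow> (\<lambda>x. t * g x) \<in> H"
  using rkhs_scale_mem_le by blast

lemma rkhs_norm_scale_le: assumes "g \<in> H" shows "nm (\<lambda>x. t * g x) \<le> \<bar>t\<bar> * nm g"
proof (rule power2_le_imp_le)
  show "(nm (\<lambda>x. t * g x))\<^sup>2 \<le> (\<bar>t\<bar> * nm g)\<^sup>2"
    using rkhs_scale_mem_le[OF assms, of t] by (simp add: power_mult_distrib)
qed (simp add: rkhs_norm_nonneg assms)

lemma rkhs_norm_scale: assumes "g \<in> H" shows "nm (\<lambda>x. t * g x) = \<bar>t\<bar> * nm g"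
proof (cases "t = 0")
  case True then show ?thesis by (simp add: rkhs_norm_zero)
next
  case False
  have "nm (\<lambda>x. (1/t) * (t * g x)) \<le> \<bar>1/t\<bar> * nm (\<lambda>x. t * g x)"
    by (rule rkhs_norm_scale_le[OF rkhs_scale_mem[OF assms]])
  then have "\<bar>t\<bar> * nm g \<le> nm (\<lambda>x. t * g x)" using False by (simp add: field_simps)
  then show ?thesis using rkhs_norm_scale_le[OF assms, of t] by simp
qed

lemma rkhs_add_mem_le:
  assumes "g \<in> H" "h \<in> H"
  shows "(\<lambda>x. g x + h x) \<in> H \<and> (nm (\<lambda>x. g x + h x))\<^sup>2 \<le> (nm g + nm h)\<^sup>2"
proof (rule rkhs_norm_leI)
  fix S :: "'a set" and a assume S: "finite S"
  let ?Q = "kquad k S a"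
  have "(\<Sum>x\<in>S. a x * (g x + h x)) = (\<Sum>x\<in>S. a x * g x) + (\<Sum>x\<in>S. a x * h x)"
    by (simp add: sum.distrib distrib_left)
  also have "\<dots> \<le> (nm g + nm h) * sqrt ?Q"
    using rkhs_eval_le[OF assms(1) S, of a] rkhs_eval_le[OF assms(2) S, of a] by (simp add: distrib_right)
  also have "2 * \<dots> \<le> (nm g + nm h)\<^sup>2 + (sqrt ?Q)\<^sup>2"
    using sum_squares_bound[of "nm g + nm h" "sqrt ?Q"] by linarith
  also have "\<dots> = (nm g + nm h)\<^sup>2 + ?Q"
    using kquad_nonneg[OF S] by simp
  finally show "2 * (\<Sum>x\<in>S. a x * (g x + h x)) - ?Q \<le> (nm g + nm h)\<^sup>2" by simp
qed

lemma rkhs_add_mem: "g \<in> H \<Longrightarrow> h \<in> H \<Longrightarrow> (\<lambda>x. g x + h x) \<in> H"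
  using rkhs_add_mem_le by blast

lemma rkhs_diff_mem: "g \<in> H \<Longrightarrow> h \<in> H \<Longrightarrow> (\<lambda>x. g x - h x) \<in> H"
  using rkhs_add_mem[of g "\<lambda>x. (-1) * h x"] rkhs_scale_mem[of h "-1"] by simp

lemma rkhs_norm_triangle: assumes "g \<in> H" "h \<in> H" shows "nm (\<lambda>x. g x + h x) \<le> nm g + nm h"
  by (rule power2_le_imp_le[OF rkhs_add_mem_le[OF assms, THEN conjunct2]])
     (simp add: assms rkhs_norm_nonneg)

lemma rkhs_norm_minus_commute: assumes "g \<in> H" "h \<in> H"
  shows "nm (\<lambda>x. g x - h x) = nm (\<lambda>x. h x - g x)"
  using rkhs_norm_scale[OF rkhs_diff_mem[OF assms], of "-1"] by simp

lemma rkhs_norm_triangle_diff: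
  assumes "g \<in> H" "h \<in> H" shows "\<bar>nm g - nm h\<bar> \<le> nm (\<lambda>x. g x - h x)"
proof -
  have "nm g \<le> nm (\<lambda>x. g x - h x) + nm h"
    using rkhs_norm_triangle[OF rkhs_diff_mem[OF assms] assms(2)] by simp
  moreover have "nm h \<le> nm (\<lambda>x. g x - h x) + nm g"
    using rkhs_norm_triangle[OF rkhs_diff_mem[OF assms(2,1)] assms(1)] rkhs_norm_minus_commute[OF assms] by simp
  ultimately show ?thesis by linarith
qed

section \<open>Reproducing property and density of the kernel sections\<close>

lemma rkhs_kcomb_mem: "finite S \<Longrightarrow> kcomb k S a \<in> H"
  using rkhs_scale_mem[OF rkhs_norm_diff_kcomb_le[OF rkhs_zero_mem, THEN conjunct1], of S "-1" a] by simp

text \<open>The reverse inequality is the same inequality applied to the difference, with the family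
  \<open>- a\<close> that restores \<open>g\<close>.\<close>

lemma rkhs_norm_diff_kcomb:
  assumes "g \<in> H" "finite S"
  shows "(nm (\<lambda>x. g x - kcomb k S a x))\<^sup>2 = (nm g)\<^sup>2 - 2 * (\<Sum>x\<in>S. a x * g x) + kquad k S a"
proof (rule antisym)
  let ?h = "\<lambda>x. g x - kcomb k S a x"
  have h: "?h \<in> H" using rkhs_norm_diff_kcomb_le[OF assms] by blast
  have m: "kcomb k S (\<lambda>x. - a x) x = - kcomb k S a x" for x
    by (simp add: kcomb_def sum_negf)
  have q: "kquad k S (\<lambda>x. - a x) = kquad k S a" by (simp add: kquad_def)
  have "(nm g)\<^sup>2 \<le> (nm ?h)\<^sup>2 + 2 * (\<Sum>x\<in>S. a x * ?h x) + kquad k S a"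
    using rkhs_norm_diff_kcomb_le[OF h assms(2), of "\<lambda>x. - a x"]
    by (simp add: m q sum_negf)
  also have "(\<Sum>x\<in>S. a x * ?h x) = (\<Sum>x\<in>S. a x * g x) - kquad k S a"
    by (simp add: kquad_kcomb right_diff_distrib sum_subtractf)
  finally show "(nm g)\<^sup>2 - 2 * (\<Sum>x\<in>S. a x * g x) + kquad k S a \<le> (nm ?h)\<^sup>2" by simp
qed (use rkhs_norm_diff_kcomb_le[OF assms] in blast)

lemma rkhs_norm_kcomb: "finite S \<Longrightarrow> (nm (kcomb k S a))\<^sup>2 = kquad k S a"
  using rkhs_norm_diff_kcomb[OF rkhs_zero_mem, of S a] rkhs_norm_scale[OF rkhs_kcomb_mem, of S "-1" a]
  by (simp add: rkhs_norm_zero)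

text \<open>The reproducing property: polarisation subtracts the square expansions for
  \<open>a\<close> and \<open>- a\<close>, and only the term linear in \<open>a\<close>
  survives.\<close>

lemma rkhs_inner_kcomb:
  assumes "g \<in> H" "finite S" shows "ip g (kcomb k S a) = (\<Sum>x\<in>S. a x * g x)"
proof -
  have m: "kcomb k S (\<lambda>x. - a x) x = - kcomb k S a x" for x
    by (simp add: kcomb_def sum_negf)
  have q: "kquad k S (\<lambda>x. - a x) = kquad k S a" by (simp add: kquad_def)
  show ?thesis
    using rkhs_norm_diff_kcomb[OF assms, of a] rkhs_norm_diff_kcomb[OF assms, of "\<lambda>x. - a x"]
    unfolding rkhs_inner_def by (simp add: m q sum_negf)
qed

text \<open>If all combinations stayed at distance at least \<open>e\<close>, the exact square
  expansion would push the supremum that defines \<open>(nm g)\<^sup>2\<close> down by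
  \<open>e\<^sup>2\<close>. No projection or completeness is involved.\<close>

lemma kcomb_dense:
  assumes "g \<in> H" "e > 0"
  shows "\<exists>S a. finite S \<and> nm (\<lambda>x. g x - kcomb k S a x) < e"
proof (rule ccontr)
  assume "\<nexists>S a. finite S \<and> nm (\<lambda>x. g x - kcomb k S a x) < e"
  then have far: "e \<le> nm (\<lambda>x. g x - kcomb k S a x)" if "finite S" for S a
    using that by (simp add: not_less)
  have "(nm g)\<^sup>2 \<le> (nm g)\<^sup>2 - e\<^sup>2"
  proof (rule rkhs_norm_leI[THEN conjunct2])
    fix S :: "'a set" and a assume S: "finite S"
    have "e\<^sup>2 \<le> (nm (\<lambda>x. g x - kcomb k S a x))\<^sup>2"
      by (rule power_mono[OF far[OF S]]) (use assms in simp)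
    then show "2 * (\<Sum>x\<in>S. a x * g x) - kquad k S a \<le> (nm g)\<^sup>2 - e\<^sup>2"
      using rkhs_norm_diff_kcomb[OF assms(1) S] by simp
  qed
  then show False using assms(2) by simp
qed

text \<open>Continuity in the second argument has to precede bilinearity, so it is read off the
  polarisation formula with a crude constant.\<close>

lemma rkhs_inner_diff_right_le:
  assumes "g \<in> H" "h \<in> H" "h' \<in> H"
  shows "\<bar>ip g h - ip g h'\<bar> \<le> nm (\<lambda>x. h x - h' x) * (nm g + nm h + nm h')"
proof -
  let ?d = "nm (\<lambda>x. h x - h' x)"
  have sq: "\<bar>(nm u)\<^sup>2 - (nm v)\<^sup>2\<bar> \<le> ?d * (2 * nm g + nm h + nm h')"
    if u: "u \<in> H" "v \<in> H" and uv: "nm (\<lambda>x. u x - v x) = ?d"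
      and le: "nm u \<le> nm g + nm h" "nm v \<le> nm g + nm h'" for u v
  proof -
    have "\<bar>(nm u)\<^sup>2 - (nm v)\<^sup>2\<bar> = \<bar>nm u - nm v\<bar> * (nm u + nm v)"
      using rkhs_norm_nonneg[OF u(1)] rkhs_norm_nonneg[OF u(2)]
      by (simp add: power2_eq_square square_diff_square_factored abs_mult mult.commute)
    also have "\<dots> \<le> ?d * (2 * nm g + nm h + nm h')"
      using rkhs_norm_triangle_diff[OF u] rkhs_norm_nonneg[OF u(1)] rkhs_norm_nonneg[OF u(2)] le
        rkhs_norm_nonneg[OF rkhs_diff_mem[OF assms(2,3)]]
      unfolding uv by (intro mult_mono) auto
    finally show ?thesis .
  qed
  have tm: "nm (\<lambda>x. g x - u x) \<le> nm g + nm u" if "u \<in> H" for u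
    using rkhs_norm_triangle[OF assms(1) rkhs_scale_mem[OF that, of "-1"]] rkhs_norm_scale[OF that, of "-1"] by simp
  have "\<bar>(nm (\<lambda>x. g x + h x))\<^sup>2 - (nm (\<lambda>x. g x + h' x))\<^sup>2\<bar> \<le> ?d * (2 * nm g + nm h + nm h')"
    by (rule sq) (simp_all add: assms rkhs_add_mem rkhs_norm_triangle)
  moreover have "\<bar>(nm (\<lambda>x. g x - h x))\<^sup>2 - (nm (\<lambda>x. g x - h' x))\<^sup>2\<bar> \<le> ?d * (2 * nm g + nm h + nm h')"
    by (rule sq) (simp_all add: assms rkhs_diff_mem tm rkhs_norm_minus_commute[of h h'])
  moreover have "\<bar>(p - q) / 4 - (p' - q') / 4\<bar> \<le> D / 2"
    if "\<bar>p - p'\<bar> \<le> D" "\<bar>q - q'\<bar> \<le> D" for p q p' q' D :: real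
    using that unfolding abs_le_iff by (auto simp: field_simps)
  ultimately have "\<bar>ip g h - ip g h'\<bar> \<le> ?d * (2 * nm g + nm h + nm h') / 2"
    unfolding rkhs_inner_def by blast
  also have "\<dots> \<le> ?d * (nm g + nm h + nm h')"
    using rkhs_norm_nonneg[OF assms(1)] rkhs_norm_nonneg[OF assms(2)] rkhs_norm_nonneg[OF assms(3)]
      rkhs_norm_nonneg[OF rkhs_diff_mem[OF assms(2,3)]]
    by (simp add: algebra_simps)
  finally show ?thesis .
qed

section \<open>Bilinearity and Cauchy-Schwarz by approximation\<close>

lemma rkhs_norm_tendsto:
  assumes "h \<in> H" "\<And>n. f n \<in> H" "(\<lambda>n. nm (\<lambda>x. h x - f n x)) \<longlonglongrightarrow> 0"
  shows "(\<lambda>n. nm (f n)) \<longlonglongrightarrow> nm h"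
proof (rule LIM_zero_cancel, rule Lim_null_comparison[OF _ assms(3)])
  show "\<forall>\<^sub>F n in sequentially. norm (nm (f n) - nm h) \<le> nm (\<lambda>x. h x - f n x)"
    using rkhs_norm_triangle_diff[OF assms(1,2)] by (simp add: abs_minus_commute)
qed

lemma rkhs_inner_tendsto_right:
  assumes "g \<in> H" "h \<in> H" "\<And>n. f n \<in> H" "(\<lambda>n. nm (\<lambda>x. h x - f n x)) \<longlonglongrightarrow> 0"
  shows "(\<lambda>n. ip g (f n)) \<longlonglongrightarrow> ip g h"
proof -
  have "(\<lambda>n. nm (\<lambda>x. h x - f n x) * (nm g + nm h + nm (f n))) \<longlonglongrightarrow> 0 * (nm g + nm h + nm h)"
    by (intro tendsto_intros assms rkhs_norm_tendsto)
  then have lim: "(\<lambda>n. nm (\<lambda>x. h x - f n x) * (nm g + nm h + nm (f n))) \<longlonglongrightarrow> 0" by simp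
  show ?thesis
  proof (rule LIM_zero_cancel, rule Lim_null_comparison[OF _ lim])
    show "\<forall>\<^sub>F n in sequentially. norm (ip g (f n) - ip g h) \<le> nm (\<lambda>x. h x - f n x) * (nm g + nm h + nm (f n))"
      using rkhs_inner_diff_right_le[OF assms(1,2,3)] by (simp add: abs_minus_commute)
  qed
qed

lemma kcomb_approx:
  assumes "h \<in> H"
  obtains S a where "\<And>n::nat. finite (S n)" "(\<lambda>n. nm (\<lambda>x. h x - kcomb k (S n) (a n) x)) \<longlonglongrightarrow> 0"
proof -
  have "\<exists>S a. finite S \<and> nm (\<lambda>x. h x - kcomb k S a x) < inverse (real (Suc n))" for n
    by (rule kcomb_dense[OF assms]) simp
  then obtain S a where *: "\<And>n. finite (S n) \<and> nm (\<lambda>x. h x - kcomb k (S n) (a n) x) < inverse (real (Suc n))"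
    by metis
  have "(\<lambda>n. nm (\<lambda>x. h x - kcomb k (S n) (a n) x)) \<longlonglongrightarrow> 0"
    by (rule Lim_null_comparison[OF _ LIMSEQ_inverse_real_of_nat])
       (use * rkhs_norm_nonneg[OF rkhs_diff_mem[OF assms rkhs_kcomb_mem]] in \<open>auto intro!: always_eventually less_imp_le\<close>)
  with * show ?thesis using that by blast
qed

text \<open>Polarisation alone does not make \<open>rkhs_inner\<close> additive. Against a kernel
  combination it is a finite sum of point values, hence additive, and \<open>kcomb_approx\<close>
  carries this to every \<open>h\<close>.\<close>

lemma rkhs_inner_add_left:
  assumes "g \<in> H" "g' \<in> H" "h \<in> H"
  shows "ip (\<lambda>x. g x + g' x) h = ip g h + ip g' h"
proof -
  obtain S a where S: "\<And>n::nat. finite (S n)" and lim: "(\<lambda>n. nm (\<lambda>x. h x - kcomb k (S n) (a n) x)) \<longlonglongrightarrow> 0"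
    using kcomb_approx[OF assms(3)] by blast
  have *: "(\<lambda>n. \<Sum>x\<in>S n. a n x * g x) \<longlonglongrightarrow> ip g h" if "g \<in> H" for g
    using rkhs_inner_tendsto_right[OF that assms(3) rkhs_kcomb_mem[OF S] lim] S by (simp add: rkhs_inner_kcomb that)
  have "(\<lambda>n. (\<Sum>x\<in>S n. a n x * g x) + (\<Sum>x\<in>S n. a n x * g' x)) \<longlonglongrightarrow> ip g h + ip g' h"
    by (intro tendsto_add * assms)
  then show ?thesis
    using *[OF rkhs_add_mem[OF assms(1,2)]]
    by (intro LIMSEQ_unique[of _ "ip (\<lambda>x. g x + g' x) h"]) (simp_all add: sum.distrib distrib_left)
qed

lemma rkhs_inner_scale_left:
  assumes "g \<in> H" "h \<in> H"
  shows "ip (\<lambda>x. t * g x) h = t * ip g h"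
proof -
  obtain S a where S: "\<And>n::nat. finite (S n)" and lim: "(\<lambda>n. nm (\<lambda>x. h x - kcomb k (S n) (a n) x)) \<longlonglongrightarrow> 0"
    using kcomb_approx[OF assms(2)] by blast
  have *: "(\<lambda>n. \<Sum>x\<in>S n. a n x * g x) \<longlonglongrightarrow> ip g h" if "g \<in> H" for g
    using rkhs_inner_tendsto_right[OF that assms(2) rkhs_kcomb_mem[OF S] lim] S by (simp add: rkhs_inner_kcomb that)
  have "(\<lambda>n. t * (\<Sum>x\<in>S n. a n x * g x)) \<longlonglongrightarrow> t * ip g h"
    by (intro tendsto_mult_left * assms)
  then show ?thesis
    using *[OF rkhs_scale_mem[OF assms(1), of t]]
    by (intro LIMSEQ_unique[of _ "ip (\<lambda>x. t * g x) h"])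
       (simp_all add: sum_distrib_left mult.left_commute)
qed

lemma rkhs_inner_commute: assumes "g \<in> H" "h \<in> H" shows "ip g h = ip h g"
  unfolding rkhs_inner_def using rkhs_norm_minus_commute[OF assms] by (simp add: add.commute)

lemma rkhs_inner_diff_left:
  assumes "g \<in> H" "g' \<in> H" "h \<in> H"
  shows "ip (\<lambda>x. g x - g' x) h = ip g h - ip g' h"
  using rkhs_inner_add_left[OF assms(1) rkhs_scale_mem[OF assms(2), of "-1"] assms(3)]
    rkhs_inner_scale_left[OF assms(2,3), of "-1"] by simp

lemma rkhs_inner_diff_right:
  assumes "g \<in> H" "h \<in> H" "h' \<in> H"
  shows "ip g (\<lambda>x. h x - h' x) = ip g h - ip g h'"
  using rkhs_inner_diff_left[OF assms(2,3,1)] assms by (simp add: rkhs_inner_commute[of g] rkhs_diff_mem)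

lemma rkhs_inner_scale_right:
  assumes "g \<in> H" "h \<in> H"
  shows "ip g (\<lambda>x. t * h x) = t * ip g h"
  using rkhs_inner_scale_left[OF assms(2,1)] assms by (simp add: rkhs_inner_commute[of g] rkhs_scale_mem)

lemma rkhs_inner_add_right:
  assumes "g \<in> H" "h \<in> H" "h' \<in> H"
  shows "ip g (\<lambda>x. h x + h' x) = ip g h + ip g h'"
  using rkhs_inner_add_left[OF assms(2,3,1)] assms by (simp add: rkhs_inner_commute[of g] rkhs_add_mem)

lemma rkhs_inner_self: "g \<in> H \<Longrightarrow> ip g g = (nm g)\<^sup>2"
  using rkhs_norm_scale[of g 2] unfolding rkhs_inner_def by (simp add: rkhs_norm_zero power_mult_distrib)

lemma rkhs_Cauchy_Schwarz:
  assumes "g \<in> H" "h \<in> H" shows "\<bar>ip g h\<bar> \<le> nm g * nm h"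
proof -
  obtain S a where S: "\<And>n::nat. finite (S n)" and lim: "(\<lambda>n. nm (\<lambda>x. h x - kcomb k (S n) (a n) x)) \<longlonglongrightarrow> 0"
    using kcomb_approx[OF assms(2)] by blast
  have "(\<lambda>n. \<bar>ip g (kcomb k (S n) (a n))\<bar>) \<longlonglongrightarrow> \<bar>ip g h\<bar>"
    by (intro tendsto_rabs rkhs_inner_tendsto_right assms rkhs_kcomb_mem S lim)
  moreover have "(\<lambda>n. nm g * nm (kcomb k (S n) (a n))) \<longlonglongrightarrow> nm g * nm h"
    by (intro tendsto_mult_left rkhs_norm_tendsto assms rkhs_kcomb_mem S lim)
  moreover have le: "\<bar>ip g (kcomb k (S n) (a n))\<bar> \<le> nm g * nm (kcomb k (S n) (a n))" for n
    using rkhs_eval_le[OF assms(1) S[of n], of "a n"] rkhs_norm_nonneg[OF rkhs_kcomb_mem[OF S[of n], of "a n"]]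
    by (simp add: rkhs_inner_kcomb assms S rkhs_norm_kcomb[OF S, symmetric])
  ultimately show ?thesis by (intro LIMSEQ_le) (use le in auto)
qed

lemma rkhs_inner_eq_imp_eq:
  assumes "g \<in> H" "g' \<in> H" "\<And>h. h \<in> H \<Longrightarrow> ip g h = ip g' h"
  shows "g = g'"
proof
  fix x
  have ev: "ip f (kcomb k {x} (\<lambda>_. 1)) = f x" if "f \<in> H" for f
    using rkhs_inner_kcomb[OF that, of "{x}" "\<lambda>_. 1"] by simp
  have "kcomb k {x} (\<lambda>_. 1) \<in> H" by (rule rkhs_kcomb_mem) simp
  from assms(3)[OF this] show "g x = g' x" by (simp only: ev assms(1,2))
qed

end

section \<open>Kernel embeddings of measures on a compact space\<close>

lemma continuous_bounded_UNIV:
  fixes f :: "'a::metric_space \<Rightarrow> real"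
  assumes "compact (UNIV :: 'a set)" "continuous_on UNIV f"
  obtains B where "B > 0" "\<And>x. \<bar>f x\<bar> \<le> B"
proof -
  have "bounded (range f)"
    using compact_imp_bounded[OF compact_continuous_image[OF assms(2,1)]] .
  then obtain B where "B > 0" "\<forall>x\<in>range f. norm x \<le> B"
    by (meson bounded_pos)
  then show ?thesis using that by auto
qed

lemma continuous_integrable_radon:
  fixes f :: "'a::metric_space \<Rightarrow> real"
  assumes "compact (UNIV :: 'a set)" "pos_radon M" "continuous_on UNIV f"
  shows "integrable M f"
proof -
  interpret finite_measure M using assms(2) by (simp add: pos_radon_def)
  obtain B where "\<And>x. \<bar>f x\<bar> \<le> B" using continuous_bounded_UNIV[OF assms(1,3)] by blast
  moreover have "f \<in> borel_measurable M"
    using borel_measurable_continuous_onI[OF assms(3)] assms(2)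
    by (simp add: pos_radon_def cong: measurable_cong_sets)
  ultimately show ?thesis by (intro integrable_const_bound[of _ B]) auto
qed

text \<open>Each point goes to the first centre of a finite net that lies within \<delta>. Taking
  the least index makes the level sets differences of balls, hence Borel.\<close>

lemma finite_range_retraction:
  assumes "compact (UNIV :: 'a::metric_space set)" "\<delta> > 0"
  obtains r :: "'a::metric_space \<Rightarrow> 'a" where "simple_function borel r" "\<And>x. dist x (r x) < \<delta>"
proof -
  obtain D where D: "finite D" "(UNIV::'a set) \<subseteq> (\<Union>x\<in>D. ball x \<delta>)"
    using assms unfolding compact_eq_totally_bounded by blast
  obtain xs where xs: "set xs = D" using finite_list[OF D(1)] by blast
  let ?P = "\<lambda>x i. i < length xs \<and> dist (xs ! i) x < \<delta>"
  define L where "L x = (LEAST i. ?P x i)" for x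
  have ex: "\<exists>i. ?P x i" for x
  proof -
    obtain d where "d \<in> D" "dist d x < \<delta>" using D(2) by (auto simp: subset_iff)
    then show ?thesis using xs by (metis in_set_conv_nth)
  qed
  have L: "?P x (L x)" for x unfolding L_def by (rule LeastI_ex[OF ex])
  have Lle: "L x \<le> i" if "?P x i" for x i unfolding L_def by (rule Least_le) (use that in simp)
  have pre: "L -` {i} \<in> sets borel" for i
  proof (cases "i < length xs")
    case True
    have "L -` {i} = ball (xs ! i) \<delta> - (\<Union>j<i. ball (xs ! j) \<delta>)"
    proof (intro set_eqI iffI)
      fix x assume "x \<in> L -` {i}"
      then have i: "L x = i" by simp
      have "\<not> dist (xs ! j) x < \<delta>" if "j < i" for j
        using Lle[of j x] i that True by auto
      then show "x \<in> ball (xs ! i) \<delta> - (\<Union>j<i. ball (xs ! j) \<delta>)" using L[of x] i by auto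
    next
      fix x assume x: "x \<in> ball (xs ! i) \<delta> - (\<Union>j<i. ball (xs ! j) \<delta>)"
      have "L x \<le> i" using Lle[of i x] x True by auto
      moreover have "\<not> L x < i" using L[of x] x by auto
      ultimately show "x \<in> L -` {i}" by auto
    qed
    then show ?thesis by simp
  next
    case False
    then have "L -` {i} = {}" using L by fastforce
    then show ?thesis by simp
  qed
  have "simple_function borel L"
    unfolding simple_function_def
  proof (intro conjI ballI)
    have "range L \<subseteq> {..<length xs}" using L by auto
    then show "finite (L ` space borel)" using finite_subset by auto
  qed (simp add: pre)
  then have "simple_function borel (\<lambda>x. xs ! L x)"
    using simple_function_compose[of borel L "\<lambda>i. xs ! i"] by (simp add: comp_def)
  moreover have "dist x (xs ! L x) < \<delta>" for x using L[of x] by (simp add: dist_commute)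
  ultimately show ?thesis using that by blast
qed

lemma simple_function_cong_sets: "sets M = sets N \<Longrightarrow> simple_function M r = simple_function N r"
  unfolding simple_function_def using sets_eq_imp_space_eq[of M N] by simp

text \<open>The weights on the right do not depend on \<open>F\<close>. With \<open>F\<close> a
  kernel section they become the coefficients of a kernel combination that approximates the
  embedding.\<close>

lemma integral_simple_function_compose:
  fixes r :: "'a \<Rightarrow> 'a" and F \<phi> :: "'a \<Rightarrow> real"
  assumes r: "simple_function M r" and \<phi>: "integrable M \<phi>"
  shows "(\<integral>x. F (r x) * \<phi> x \<partial>M)
    = (\<Sum>s\<in>r ` space M. (\<integral>x. indicator (r -` {s} \<inter> space M) x * \<phi> x \<partial>M) * F s)"
proof -
  have meas: "r -` {s} \<inter> space M \<in> sets M" if "s \<in> r ` space M" for s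
    using r that unfolding simple_function_def by auto
  have fin: "finite (r ` space M)" using r unfolding simple_function_def by auto
  have "(\<integral>x. F (r x) * \<phi> x \<partial>M)
    = (\<integral>x. (\<Sum>s\<in>r ` space M. (indicator (r -` {s} \<inter> space M) x * \<phi> x) * F s) \<partial>M)"
  proof (rule Bochner_Integration.integral_cong[OF refl])
    fix x assume x: "x \<in> space M"
    have "(\<Sum>s\<in>r ` space M. (indicator (r -` {s} \<inter> space M) x * \<phi> x) * F s)
      = (\<Sum>s\<in>r ` space M. if r x = s then \<phi> x * F s else 0)"
      using x by (intro sum.cong) (auto simp: indicator_def)
    also have "\<dots> = \<phi> x * F (r x)" using x fin by (simp add: sum.delta)
    finally show "F (r x) * \<phi> x = (\<Sum>s\<in>r ` space M. (indicator (r -` {s} \<inter> space M) x * \<phi> x) * F s)"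
      by simp
  qed
  also have "\<dots> = (\<Sum>s\<in>r ` space M. (\<integral>x. (indicator (r -` {s} \<inter> space M) x * \<phi> x) * F s \<partial>M))"
    using integrable_mult_indicator[OF meas \<phi>]
    by (intro Bochner_Integration.integral_sum integrable_mult_left) simp
  finally show ?thesis by simp
qed

locale cpt_kernel = pd_kernel k for k :: "'a::metric_space \<Rightarrow> 'a \<Rightarrow> real" +
  assumes cpt: "compact (UNIV :: 'a set)"
    and kcont: "continuous_on UNIV (\<lambda>(x, y). k x y)"
begin

lemma kcont': "continuous_on UNIV (\<lambda>p. k (fst p) (snd p))"
  using kcont by (simp add: case_prod_unfold)

lemma kcont_comp:
  "continuous_on S f \<Longrightarrow> continuous_on S g \<Longrightarrow> continuous_on S (\<lambda>x. k (f x) (g x))"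
  using continuous_on_compose2[OF kcont', of S "\<lambda>x. (f x, g x)"] by (simp add: continuous_on_Pair)

lemma ktendsto:
  "(f \<longlongrightarrow> x) F \<Longrightarrow> (g \<longlongrightarrow> y) F \<Longrightarrow> ((\<lambda>n. k (f n) (g n)) \<longlongrightarrow> k x y) F"
  using continuous_on_tendsto_compose[OF kcont', of "\<lambda>n. (f n, g n)" "(x, y)" F]
  by (simp add: tendsto_Pair)

lemma kbounded: obtains K where "K > 0" "\<And>x y. \<bar>k x y\<bar> \<le> K"
proof -
  have c: "compact (UNIV :: ('a \<times> 'a) set)"
    using compact_Times[OF cpt cpt] by simp
  obtain K where "K > 0" "\<And>p. \<bar>k (fst p) (snd p)\<bar> \<le> K"
    using continuous_bounded_UNIV[OF c kcont'] by blast
  then show ?thesis using that[of K] by (metis fst_conv snd_conv)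
qed

lemma kunif:
  assumes "e > 0"
  shows "\<exists>d>0. \<forall>x y x' y'. dist x x' < d \<longrightarrow> dist y y' < d \<longrightarrow> \<bar>k x y - k x' y'\<bar> < e"
proof -
  have "uniformly_continuous_on UNIV (\<lambda>p. k (fst p) (snd p))"
    using compact_uniformly_continuous[OF kcont'] compact_Times[OF cpt cpt] by simp
  then obtain d where d: "d > 0" "\<And>p p'. dist p p' < d \<Longrightarrow> dist (k (fst p) (snd p)) (k (fst p') (snd p')) < e"
    unfolding uniformly_continuous_on_def using assms by (metis UNIV_I dist_commute)
  show ?thesis
  proof (intro exI[of _ "d / 2"] conjI allI impI)
    fix x y x' y' :: 'a assume "dist x x' < d / 2" "dist y y' < d / 2"
    moreover have "dist (x, y) (x', y') \<le> dist x x' + dist y y'"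
      unfolding dist_Pair_Pair by (rule sqrt_sum_squares_le_sum) auto
    ultimately have "dist (x, y) (x', y') < d" by linarith
    from d(2)[OF this] show "\<bar>k x y - k x' y'\<bar> < e" by (simp add: dist_real_def)
  qed (use d in simp)
qed

text \<open>Tests \<open>g\<close> on the difference of two point masses, whose quadratic form is
  the squared kernel distance of \<open>x\<close> and \<open>y\<close>.\<close>

lemma rkhs_diff_bound:
  assumes "g \<in> H" shows "\<bar>g x - g y\<bar> \<le> nm g * sqrt (k x x - 2 * k x y + k y y)"
proof (cases "x = y")
  case False
  have "kquad k {x, y} (\<lambda>z. if z = x then 1 else - 1) = k x x - 2 * k x y + k y y"
    using False by (simp add: kquad_def ksym[of y x])
  then show ?thesis
    using rkhs_eval_le[OF assms, of "{x, y}" "\<lambda>z. if z = x then 1 else - 1"] False by simp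
qed simp

text \<open>The kernel distance is uniformly small near the diagonal, so one modulus serves a whole
  norm ball. Besides continuity of the members of \<open>H\<close>, this gives the Arzela-Ascoli
  argument for difference quotients.\<close>

lemma rkhs_equicontinuous:
  assumes "e > 0"
  shows "\<exists>d>0. \<forall>g x y. g \<in> H \<longrightarrow> nm g \<le> R \<longrightarrow> dist x y < d \<longrightarrow> \<bar>g x - g y\<bar> < e"
proof -
  let ?R = "\<bar>R\<bar> + 1"
  have "(e / ?R)\<^sup>2 / 2 > 0" using assms by simp
  from kunif[OF this] obtain d where d: "d > 0"
    "\<forall>x y x' y'. dist x x' < d \<longrightarrow> dist y y' < d \<longrightarrow> \<bar>k x y - k x' y'\<bar> < (e / ?R)\<^sup>2 / 2"
    by (elim exE conjE)
  show ?thesis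
  proof (intro exI[of _ d] conjI allI impI d(1))
    fix g and x y :: 'a assume g: "g \<in> H" "nm g \<le> R" and xy: "dist x y < d"
    have "\<bar>k x x - k x y\<bar> < (e / ?R)\<^sup>2 / 2" "\<bar>k y y - k x y\<bar> < (e / ?R)\<^sup>2 / 2"
      using d(2)[rule_format, of x x x y] d(2)[rule_format, of y x y y] xy d(1) by (simp_all add: dist_commute)
    then have "k x x - 2 * k x y + k y y < (e / ?R)\<^sup>2" by linarith
    then have "sqrt (k x x - 2 * k x y + k y y) < sqrt ((e / ?R)\<^sup>2)" by (rule real_sqrt_less_mono)
    also have "\<dots> = e / ?R" using assms by simp
    finally have s: "sqrt (k x x - 2 * k x y + k y y) < e / ?R" .
    have "k x x - 2 * k x y + k y y = kquad k {x, y} (\<lambda>z. if z = x then 1 else - 1)" if "x \<noteq> y"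
      using that by (simp add: kquad_def ksym[of y x])
    then have q0: "0 \<le> k x x - 2 * k x y + k y y"
      using kquad_nonneg[of "{x, y}"] by (cases "x = y") auto
    have "\<bar>g x - g y\<bar> \<le> nm g * sqrt (k x x - 2 * k x y + k y y)" by (rule rkhs_diff_bound[OF g(1)])
    also have "\<dots> \<le> ?R * sqrt (k x x - 2 * k x y + k y y)"
      using g q0 by (intro mult_right_mono) auto
    also have "\<dots> < ?R * (e / ?R)" using s by (intro mult_strict_left_mono) auto
    also have "\<dots> = e" by simp
    finally show "\<bar>g x - g y\<bar> < e" .
  qed
qed

lemma rkhs_continuous: assumes "g \<in> H" shows "continuous_on UNIV g"
  unfolding continuous_on_iff
proof (intro ballI allI impI)
  fix x :: 'a and e :: real assume "e > 0"
  from rkhs_equicontinuous[OF this, of "nm g"] obtain d where "d > 0"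
    "\<forall>f x y. f \<in> H \<longrightarrow> nm f \<le> nm g \<longrightarrow> dist x y < d \<longrightarrow> \<bar>f x - f y\<bar> < e"
    by (elim exE conjE)
  with assms have "d > 0" "\<forall>x y. dist x y < d \<longrightarrow> \<bar>g x - g y\<bar> < e" by simp_all
  then show "\<exists>d>0. \<forall>x'\<in>UNIV. dist x' x < d \<longrightarrow> dist (g x') (g x) < e"
    by (auto simp: dist_real_def)
qed

lemma integrable_radon: "pos_radon M \<Longrightarrow> continuous_on UNIV f \<Longrightarrow> integrable M (f :: 'a \<Rightarrow> real)"
  by (rule continuous_integrable_radon[OF cpt])

text \<open>Embedding of the signed measure with density \<phi> with respect to \<open>M\<close>;
  every signed measure that occurs has this form.\<close>

definition kemb :: "('a \<Rightarrow> real) \<Rightarrow> 'a measure \<Rightarrow> 'a \<Rightarrow> real" where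
  "kemb \<phi> M y = (\<integral>x. k x y * \<phi> x \<partial>M)"

lemma kemb_one: "kemb (\<lambda>_. 1) M = kembed k M"
  by (simp add: fun_eq_iff kemb_def kembed_def)

text \<open>The measure is discretised along maps of finite range converging to the identity; dominated
  convergence then gives norm convergence of kernel combinations to the embedding.  This avoids product
  measures, for which the type \<open>'a\<close> would have to be second countable as a type class.\<close>

lemma
  assumes M: "pos_radon M" and \<phi>: "continuous_on UNIV \<phi>"
  shows kemb_mem: "kemb \<phi> M \<in> H"
    and kemb_inner: "g \<in> H \<Longrightarrow> ip g (kemb \<phi> M) = (\<integral>x. g x * \<phi> x \<partial>M)"
proof -
  let ?h = "kemb \<phi> M"
  have sM: "sets M = sets borel" using M by (simp add: pos_radon_def)
  have spM: "space M = UNIV" using sets_eq_imp_space_eq[OF sM] by simp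
  have int\<phi>: "integrable M \<phi>" by (rule integrable_radon[OF M \<phi>])
  have "\<exists>r. simple_function M r \<and> (\<forall>x::'a. dist x (r x) < inverse (real (Suc n)))" for n
    using finite_range_retraction[OF cpt, of "inverse (real (Suc n))"]
    by (metis simple_function_cong_sets[OF sM] inverse_positive_iff_positive of_nat_0_less_iff zero_less_Suc)
  then obtain r where r: "\<And>n. simple_function M (r n)" "\<And>n x. dist x (r n x) < inverse (real (Suc n))"
    by metis
  have rlim: "(\<lambda>n. r n x) \<longlonglongrightarrow> x" for x
  proof (rule metric_LIMSEQ_I)
    fix e :: real assume "e > 0"
    then obtain N where N: "inverse (real (Suc N)) < e" using reals_Archimedean by blast
    have "dist (r n x) x < e" if "n \<ge> N" for n
    proof -
      have "inverse (real (Suc n)) \<le> inverse (real (Suc N))" using that by simp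
      then have "dist x (r n x) < e" using r(2)[of x n] N by linarith
      then show ?thesis by (simp add: dist_commute)
    qed
    then show "\<exists>no. \<forall>n\<ge>no. dist (r n x) x < e" by blast
  qed
  have meas: "(\<lambda>x. F (r n x)) \<in> borel_measurable M" for n and F :: "'a \<Rightarrow> real"
    using borel_measurable_simple_function[OF simple_function_compose[OF r(1), of F n]]
    by (simp add: comp_def)
  have dct: "(\<lambda>n. \<integral>x. G n (r n x) * \<phi> x \<partial>M) \<longlonglongrightarrow> (\<integral>x. g x * \<phi> x \<partial>M)"
    if "\<And>x. (\<lambda>n. G n (r n x)) \<longlonglongrightarrow> g x" "\<And>n x. \<bar>G n x\<bar> \<le> B" "continuous_on UNIV g"
    for G :: "nat \<Rightarrow> 'a \<Rightarrow> real" and g B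
  proof (rule integral_dominated_convergence[where w = "\<lambda>x. B * \<bar>\<phi> x\<bar>"])
    show "integrable M (\<lambda>x. B * \<bar>\<phi> x\<bar>)" using int\<phi> by simp
    show "(\<lambda>x. g x * \<phi> x) \<in> borel_measurable M"
      using integrable_radon[OF M continuous_on_mult[OF that(3) \<phi>]] by simp
    show "(\<lambda>x. G n (r n x) * \<phi> x) \<in> borel_measurable M" for n
      using meas[of "G n" n] int\<phi> by simp
    show "AE x in M. (\<lambda>n. G n (r n x) * \<phi> x) \<longlonglongrightarrow> g x * \<phi> x"
      using that(1) by (intro AE_I2 tendsto_mult) auto
    show "AE x in M. norm (G n (r n x) * \<phi> x) \<le> B * \<bar>\<phi> x\<bar>" for n
      using that(2) by (intro AE_I2) (simp add: abs_mult mult_right_mono)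
  qed
  define S where "S n = range (r n)" for n
  define a where "a n s = (\<integral>x. indicator (r n -` {s}) x * \<phi> x \<partial>M)" for n s
  have fin: "finite (S n)" for n using r(1)[of n] spM by (simp add: S_def simple_function_def)
  have ev: "(\<Sum>s\<in>S n. a n s * F s) = (\<integral>x. F (r n x) * \<phi> x \<partial>M)" for n F
    using integral_simple_function_compose[OF r(1) int\<phi>, of F n] spM by (simp add: S_def a_def)
  have evlim: "(\<lambda>n. \<Sum>s\<in>S n. a n s * g s) \<longlonglongrightarrow> (\<integral>x. g x * \<phi> x \<partial>M)" if g: "continuous_on UNIV g" for g
  proof -
    obtain B where B: "\<And>x. \<bar>g x\<bar> \<le> B" using continuous_bounded_UNIV[OF cpt g] by blast
    have "(\<lambda>n. g (r n x)) \<longlonglongrightarrow> g x" for x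
      using continuous_on_tendsto_compose[OF g rlim] by simp
    from dct[OF this B g] show ?thesis by (simp add: ev)
  qed
  let ?c = "\<lambda>n. kcomb k (S n) (a n)"
  have c: "?c n y = (\<integral>x. k (r n x) y * \<phi> x \<partial>M)" for n y
    unfolding kcomb_def by (rule ev)
  obtain K where K: "K > 0" "\<And>x y. \<bar>k x y\<bar> \<le> K" using kbounded by blast
  have clim: "(\<lambda>n. ?c n y) \<longlonglongrightarrow> ?h y" for y
    unfolding c kemb_def
    by (rule dct[where B = K]) (auto intro: ktendsto rlim K kcont_comp continuous_intros)
  \<comment> \<open>Convergence along the moving points \<open>r n y\<close> is needed as well: the
    quadratic form of a combination integrates the combination itself along
    \<open>r n\<close>.\<close>
  have clim2: "(\<lambda>n. ?c n (r n y)) \<longlonglongrightarrow> ?h y" for y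
    unfolding c kemb_def
    by (rule dct[where B = K and G = "\<lambda>n x. k x (r n y)"])
       (auto intro: ktendsto rlim K kcont_comp continuous_intros)
  have cbound: "\<bar>?c n y\<bar> \<le> K * (\<integral>x. \<bar>\<phi> x\<bar> \<partial>M)" for n y
  proof -
    have "\<bar>?c n y\<bar> \<le> (\<integral>x. \<bar>k (r n x) y * \<phi> x\<bar> \<partial>M)" unfolding c by (rule integral_abs_bound)
    also have "\<dots> \<le> (\<integral>x. K * \<bar>\<phi> x\<bar> \<partial>M)"
    proof (rule integral_mono)
      show "integrable M (\<lambda>x. \<bar>k (r n x) y * \<phi> x\<bar>)"
        using int\<phi> meas[of "\<lambda>x. k x y" n] K
        by (intro integrable_abs Bochner_Integration.integrable_bound[OF integrable_mult_right[OF integrable_abs[OF int\<phi>], of K]])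
           (auto simp: abs_mult intro!: mult_right_mono)
    qed (use int\<phi> K in \<open>auto simp: abs_mult mult_right_mono\<close>)
    finally show ?thesis by simp
  qed
  have hcont: "continuous_on UNIV ?h"
  proof -
    have "uniformly_continuous_on UNIV ?h"
      unfolding uniformly_continuous_on_def
    proof (intro allI impI)
      fix e :: real assume e: "e > 0"
      let ?I = "(\<integral>x. \<bar>\<phi> x\<bar> \<partial>M) + 1"
      have I: "?I > 0" by (simp add: add_nonneg_pos)
      from kunif[OF divide_pos_pos[OF e I]] obtain d where d: "d > 0"
        "\<forall>x y x' y'. dist x x' < d \<longrightarrow> dist y y' < d \<longrightarrow> \<bar>k x y - k x' y'\<bar> < e / ?I"
        by (elim exE conjE)
      have "dist (?h y') (?h y) < e" if "dist y' y < d" for y y'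
      proof -
        have i: "integrable M (\<lambda>x. k x z * \<phi> x)" for z
          by (intro integrable_radon M continuous_on_mult kcont_comp \<phi> continuous_intros)
        have "?h y' - ?h y = (\<integral>x. (k x y' - k x y) * \<phi> x \<partial>M)"
          unfolding kemb_def using i by (simp add: left_diff_distrib)
        also have "\<bar>\<dots>\<bar> \<le> (\<integral>x. \<bar>(k x y' - k x y) * \<phi> x\<bar> \<partial>M)" by (rule integral_abs_bound)
        also have "\<dots> \<le> (\<integral>x. e / ?I * \<bar>\<phi> x\<bar> \<partial>M)"
        proof (rule integral_mono)
          show "integrable M (\<lambda>x. \<bar>(k x y' - k x y) * \<phi> x\<bar>)"
            by (intro integrable_radon M continuous_on_mult kcont_comp \<phi> continuous_intros)
          show "integrable M (\<lambda>x. e / ?I * \<bar>\<phi> x\<bar>)"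
            using int\<phi> by (intro integrable_mult_right integrable_abs)
          show "\<bar>(k x y' - k x y) * \<phi> x\<bar> \<le> e / ?I * \<bar>\<phi> x\<bar>" for x
            using d(2)[rule_format, of x x y' y] d(1) that by (simp only: abs_mult, intro mult_right_mono) auto
        qed
        also have "\<dots> = e * ((\<integral>x. \<bar>\<phi> x\<bar> \<partial>M) / ?I)" by simp
        also have "\<dots> < e * 1"
          using e I by (intro mult_strict_left_mono) (auto simp: divide_less_eq)
        finally show ?thesis by (simp add: dist_real_def)
      qed
      then show "\<exists>d>0. \<forall>x\<in>UNIV. \<forall>x'\<in>UNIV. dist x' x < d \<longrightarrow> dist (?h x') (?h x) < e"
        using d(1) by blast
    qed
    then show ?thesis by (rule uniformly_continuous_imp_continuous)
  qed
  let ?I = "\<integral>x. ?h x * \<phi> x \<partial>M"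
  have qlim: "(\<lambda>n. kquad k (S n) (a n)) \<longlonglongrightarrow> ?I"
    unfolding kquad_kcomb ev by (rule dct[OF clim2 cbound hcont])
  have h: "?h \<in> H \<and> (nm ?h)\<^sup>2 \<le> ?I"
  proof (rule rkhs_norm_leI)
    fix T :: "'a set" and b assume T: "finite T"
    have le: "2 * (\<Sum>x\<in>T. b x * ?c n x) - kquad k T b \<le> kquad k (S n) (a n)" for n
      using rkhs_norm_bound[OF rkhs_kcomb_mem[OF fin] T] by (simp add: rkhs_norm_kcomb fin)
    have "(\<lambda>n. 2 * (\<Sum>x\<in>T. b x * ?c n x) - kquad k T b) \<longlonglongrightarrow> 2 * (\<Sum>x\<in>T. b x * ?h x) - kquad k T b"
      by (intro tendsto_intros clim)
    then show "2 * (\<Sum>x\<in>T. b x * ?h x) - kquad k T b \<le> ?I"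
      by (rule LIMSEQ_le[OF _ qlim]) (use le in auto)
  qed
  then show mem: "kemb \<phi> M \<in> H" by blast
  \<comment> \<open>The squared distances converge to \<open>(nm ?h)\<^sup>2 - ?I\<close>. This is
    nonpositive by \<open>h\<close> and nonnegative as a limit of squares, which yields the missing
    half of the norm identity together with norm convergence.\<close>
  have "(\<lambda>n. (nm (\<lambda>x. ?h x - ?c n x))\<^sup>2) \<longlonglongrightarrow> (nm ?h)\<^sup>2 - 2 * ?I + ?I"
    unfolding rkhs_norm_diff_kcomb[OF mem fin] by (intro tendsto_intros evlim hcont qlim)
  then have l: "(\<lambda>n. (nm (\<lambda>x. ?h x - ?c n x))\<^sup>2) \<longlonglongrightarrow> (nm ?h)\<^sup>2 - ?I" by simp
  moreover have "(nm ?h)\<^sup>2 - ?I \<ge> 0" by (rule LIMSEQ_le_const[OF l]) auto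
  ultimately have "(\<lambda>n. (nm (\<lambda>x. ?h x - ?c n x))\<^sup>2) \<longlonglongrightarrow> 0" using h by simp
  then have "(\<lambda>n. sqrt ((nm (\<lambda>x. ?h x - ?c n x))\<^sup>2)) \<longlonglongrightarrow> sqrt 0" by (rule tendsto_real_sqrt)
  then have nlim: "(\<lambda>n. nm (\<lambda>x. ?h x - ?c n x)) \<longlonglongrightarrow> 0"
    using rkhs_norm_nonneg[OF rkhs_diff_mem[OF mem rkhs_kcomb_mem[OF fin]]] by simp
  show "ip g (kemb \<phi> M) = (\<integral>x. g x * \<phi> x \<partial>M)" if g: "g \<in> H"
  proof (rule LIMSEQ_unique)
    show "(\<lambda>n. ip g (?c n)) \<longlonglongrightarrow> ip g ?h"
      by (rule rkhs_inner_tendsto_right[OF g mem rkhs_kcomb_mem[OF fin] nlim])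
    show "(\<lambda>n. ip g (?c n)) \<longlonglongrightarrow> (\<integral>x. g x * \<phi> x \<partial>M)"
      using evlim[OF rkhs_continuous[OF g]] by (simp add: rkhs_inner_kcomb[OF g fin])
  qed
qed

lemma kemb_continuous: "pos_radon M \<Longrightarrow> continuous_on UNIV \<phi> \<Longrightarrow> continuous_on UNIV (kemb \<phi> M)"
  by (rule rkhs_continuous[OF kemb_mem])

text \<open>A Fubini identity: both sides are the inner product of the two embeddings.\<close>

lemma kemb_swap:
  assumes "pos_radon M" "continuous_on UNIV \<phi>" "pos_radon N" "continuous_on UNIV \<psi>"
  shows "(\<integral>x. kemb \<phi> M x * \<psi> x \<partial>N) = (\<integral>x. kemb \<psi> N x * \<phi> x \<partial>M)"
  using kemb_inner[OF assms(3,4) kemb_mem[OF assms(1,2)]] kemb_inner[OF assms(1,2) kemb_mem[OF assms(3,4)]]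
    rkhs_inner_commute[OF kemb_mem[OF assms(1,2)] kemb_mem[OF assms(3,4)]] by simp

text \<open>The energy is the squared norm of the embedding.\<close>

lemma kemb_energy_nonneg:
  assumes "pos_radon M" "continuous_on UNIV \<phi>"
  shows "0 \<le> (\<integral>x. kemb \<phi> M x * \<phi> x \<partial>M)"
  using kemb_inner[OF assms kemb_mem[OF assms]] rkhs_inner_self[OF kemb_mem[OF assms]]
  by (metis zero_le_power2)

end

section \<open>Radon measures, Schrodinger potentials and rescaled kernels\<close>

text \<open>Continuous functions determine the measure of closed sets, and these form an
  intersection-stable generator of the Borel sets.\<close>

lemma radon_measure_eqI:
  fixes M N :: "'a::metric_space measure"
  assumes cpt: "compact (UNIV :: 'a set)" and M: "pos_radon M" and N: "pos_radon N"
    and eq: "\<And>f :: 'a \<Rightarrow> real. continuous_on UNIV f \<Longrightarrow> (\<integral>x. f x \<partial>M) = (\<integral>x. f x \<partial>N)"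
  shows "M = N"
proof -
  have closed: "measure M C = measure N C" if C: "closed C" for C
  proof (cases "C = {}")
    case False
    \<comment> \<open>Lipschitz functions decreasing to the indicator of \<open>C\<close>. The empty
      set is excluded because \<open>infdist\<close> to it is 0 by convention, which would make
      every \<open>F n\<close> constantly 1.\<close>
    define F where "F n x = max 0 (1 - real n * infdist x C)" for n x
    have Fc: "continuous_on UNIV (F n)" for n
      unfolding F_def by (intro continuous_intros)
    have lim: "(\<lambda>n. F n x) \<longlonglongrightarrow> indicator C x" for x
    proof (cases "x \<in> C")
      case True then show ?thesis by (simp add: F_def)
    next
      case nC: False
      then have d: "infdist x C > 0"
        using in_closed_iff_infdist_zero[OF C False] infdist_nonneg[of x C] by (metis less_eq_real_def)
      obtain n0 :: nat where n0: "1 / infdist x C < real n0" using reals_Archimedean2 by blast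
      have "F n x = 0" if "n \<ge> n0" for n
      proof -
        have "1 / infdist x C < real n" using n0 that by linarith
        then show ?thesis using d by (simp add: F_def field_simps)
      qed
      then show ?thesis using nC
        by (intro tendsto_eventually eventually_sequentiallyI[of n0]) simp
    qed
    have conv: "(\<lambda>n. \<integral>x. F n x \<partial>L) \<longlonglongrightarrow> measure L C" if L: "pos_radon L" for L
    proof -
      interpret finite_measure L using L by (simp add: pos_radon_def)
      have sL: "sets L = sets borel" using L by (simp add: pos_radon_def)
      have CL: "C \<in> sets L" using C by (simp add: sL)
      have "(\<lambda>n. \<integral>x. F n x \<partial>L) \<longlonglongrightarrow> (\<integral>x. indicator C x \<partial>L)"
      proof (rule integral_dominated_convergence[where w = "\<lambda>_. 1"])
        show "F n \<in> borel_measurable L" for n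
          using continuous_integrable_radon[OF cpt L Fc] by simp
        show "AE x in L. norm (F n x) \<le> 1" for n
          by (intro AE_I2) (simp add: F_def infdist_nonneg)
      qed (use lim CL in auto)
      then show ?thesis using CL sets_eq_imp_space_eq[OF sL] by simp
    qed
    show ?thesis
      using LIMSEQ_unique[OF conv[OF M]] conv[OF N] eq[OF Fc] by simp
  qed simp
  have fin: "emeasure L A = ennreal (measure L A)" if "pos_radon L" for L :: "'a measure" and A
    using that by (simp add: pos_radon_def finite_measure.emeasure_eq_measure)
  show ?thesis
  proof (rule measure_eqI_generator_eq[where E = "Collect closed" and \<Omega> = UNIV and A = "\<lambda>_. UNIV"])
    show "Int_stable (Collect closed :: 'a set set)" by (auto simp: Int_stable_def)
    show "sets M = sigma_sets UNIV (Collect closed)" "sets N = sigma_sets UNIV (Collect closed)"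
      using M N by (simp_all add: pos_radon_def borel_eq_closed)
    show "emeasure M X = emeasure N X" if "X \<in> Collect closed" for X
      using closed that by (simp add: fin M N)
    show "emeasure M UNIV \<noteq> \<infinity>" by (simp add: fin M)
  qed auto
qed

text \<open>Points off the support have null neighbourhoods, but uncountably many of them. The set
  where \<open>p\<close> is nonzero is therefore exhausted by the compact sets where its modulus is
  at least \<open>1 / (n + 1)\<close>, each covered by finitely many null neighbourhoods.\<close>

lemma AE_zero_off_msupp:
  fixes p :: "'a::metric_space \<Rightarrow> real"
  assumes cpt: "compact (UNIV :: 'a set)" and M: "pos_radon M"
    and p: "continuous_on UNIV p" "\<And>x. x \<in> msupp M \<Longrightarrow> p x = 0"
  shows "AE x in M. p x = 0"
proof -
  have sM: "sets M = sets borel" using M by (simp add: pos_radon_def)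
  have null: "{x. \<bar>p x\<bar> \<ge> inverse (real (Suc n))} \<in> null_sets M" for n
  proof -
    let ?K = "{x. inverse (real (Suc n)) \<le> \<bar>p x\<bar>}"
    have cl: "closed ?K"
      by (intro closed_Collect_le continuous_intros p(1))
    have "compact ?K" using compact_Int_closed[OF cpt cl] by simp
    moreover have "\<exists>U. open U \<and> x \<in> U \<and> emeasure M U = 0" if "x \<in> ?K" for x
    proof -
      have "0 < inverse (real (Suc n))" by simp
      then have "p x \<noteq> 0" using that by force
      then have "x \<notin> msupp M" using p(2) by blast
      then show ?thesis unfolding msupp_def by (auto simp: not_gr_zero)
    qed
    then obtain U where U: "\<And>x. x \<in> ?K \<Longrightarrow> open (U x) \<and> x \<in> U x \<and> emeasure M (U x) = 0" by metis
    ultimately obtain D where D: "D \<subseteq> ?K" "finite D" "?K \<subseteq> (\<Union>x\<in>D. U x)"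
      using compactE_image[of ?K ?K U] by (metis (no_types, lifting) UN_I subsetI)
    have "(\<Union>x\<in>D. U x) \<in> null_sets M"
    proof (rule null_sets.finite_UN[OF D(2)])
      fix x assume "x \<in> D"
      then have "x \<in> ?K" using D(1) by blast
      from U[OF this] show "U x \<in> null_sets M" by (auto simp: null_sets_def sM)
    qed
    moreover have "?K \<in> sets M" using cl by (simp add: sM)
    ultimately show ?thesis using D(3) by (rule null_sets_subset)
  qed
  have "{x. p x \<noteq> 0} \<subseteq> (\<Union>n. {x. \<bar>p x\<bar> \<ge> inverse (real (Suc n))})"
  proof
    fix x assume "x \<in> {x. p x \<noteq> 0}"
    then obtain n where "inverse (real (Suc n)) < \<bar>p x\<bar>" using reals_Archimedean[of "\<bar>p x\<bar>"] by auto
    then show "x \<in> (\<Union>n. {x. \<bar>p x\<bar> \<ge> inverse (real (Suc n))})" by (auto intro: less_imp_le)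
  qed
  moreover have "(\<Union>n. {x. \<bar>p x\<bar> \<ge> inverse (real (Suc n))}) \<in> null_sets M"
    using null by (intro null_sets_UN)
  ultimately show ?thesis by (intro AE_I'[of "\<Union>n. {x. \<bar>p x\<bar> \<ge> inverse (real (Suc n))}"]) auto
qed

text \<open>Maximum principle: for two solutions, the ratios \<open>u\<close>, \<open>v\<close> of the exponentiated potentials satisfy
  \<open>1 / u = \<integral> v d\<pi>\<close> and \<open>1 / v = \<integral> u d\<pi>\<close> for a positive Markov kernel \<open>\<pi>\<close>; evaluate at a maximum of \<open>v\<close>.\<close>

lemma schrodinger_unique:
  fixes c :: "'a::metric_space \<Rightarrow> 'a \<Rightarrow> real"
  assumes cpt: "compact (UNIV :: 'a set)" and \<epsilon>: "\<epsilon> > 0"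
    and cc: "\<And>y. continuous_on UNIV (\<lambda>x. c x y)"
    and \<mu>: "prob_radon \<mu>"
    and cont: "continuous_on UNIV f" "continuous_on UNIV g" "continuous_on UNIV f'" "continuous_on UNIV g'"
    and eqs: "\<And>y. f y = T_eps \<epsilon> c g \<mu> y" "\<And>y. g y = T_eps \<epsilon> c f \<mu> y"
      "\<And>y. f' y = T_eps \<epsilon> c g' \<mu> y" "\<And>y. g' y = T_eps \<epsilon> c f' \<mu> y"
    and nrm: "(\<integral>x. f x \<partial>\<mu>) = (\<integral>x. g x \<partial>\<mu>)" "(\<integral>x. f' x \<partial>\<mu>) = (\<integral>x. g' x \<partial>\<mu>)"
  shows "f' = f \<and> g' = g"
proof -
  interpret prob_space \<mu> using \<mu> by (simp add: prob_radon_def)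
  have rad: "pos_radon \<mu>" using \<mu> finite_measure_axioms by (simp add: prob_radon_def pos_radon_def)
  have cE: "continuous_on UNIV (\<lambda>x. exp ((h x - c x y) / \<epsilon>))" if "continuous_on UNIV h" for h y
    using \<epsilon> by (intro continuous_intros that cc) auto
  have int: "integrable \<mu> h" if "continuous_on UNIV h" for h :: "'a \<Rightarrow> real"
    by (rule continuous_integrable_radon[OF cpt rad that])
  have expT: "exp (- t / \<epsilon>) = (\<integral>x. exp ((w x - c x y) / \<epsilon>) \<partial>\<mu>)"
    if "t = T_eps \<epsilon> c w \<mu> y" "continuous_on UNIV w" for t w y
  proof -
    have "(\<integral>x. exp ((w x - c x y) / \<epsilon>) \<partial>\<mu>) \<noteq> 0"
      using integral_nonneg_eq_0_iff_AE[OF int[OF cE[OF that(2)], of y]] by simp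
    moreover have "0 \<le> (\<integral>x. exp ((w x - c x y) / \<epsilon>) \<partial>\<mu>)" by simp
    ultimately have "0 < (\<integral>x. exp ((w x - c x y) / \<epsilon>) \<partial>\<mu>)" by linarith
    then show ?thesis using that(1) \<epsilon> by (simp add: T_eps_def)
  qed
  define u where "u x = exp ((f' x - f x) / \<epsilon>)" for x
  define v where "v x = exp ((g' x - g x) / \<epsilon>)" for x
  have uc: "continuous_on UNIV u" and vc: "continuous_on UNIV v"
    unfolding u_def v_def using \<epsilon> by (auto intro!: continuous_intros cont)
  have ueq: "exp (- f' y / \<epsilon>) * u y = exp (- f y / \<epsilon>)" for y
    by (simp add: u_def diff_divide_distrib flip: exp_add)
  have veq: "exp (- g' y / \<epsilon>) * v y = exp (- g y / \<epsilon>)" for y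
    by (simp add: v_def diff_divide_distrib flip: exp_add)
  have up: "u y > 0" and vp: "v y > 0" for y by (simp_all add: u_def v_def)
  have f'I: "exp (- f' y / \<epsilon>) = (\<integral>x. v x * exp ((g x - c x y) / \<epsilon>) \<partial>\<mu>)" for y
  proof -
    have "v x * exp ((g x - c x y) / \<epsilon>) = exp ((g' x - c x y) / \<epsilon>)" for x
      by (simp add: v_def diff_divide_distrib flip: exp_add)
    then show ?thesis using expT[OF eqs(3)[of y] cont(4)] by simp
  qed
  have g'I: "exp (- g' y / \<epsilon>) = (\<integral>x. u x * exp ((f x - c x y) / \<epsilon>) \<partial>\<mu>)" for y
  proof -
    have "u x * exp ((f x - c x y) / \<epsilon>) = exp ((f' x - c x y) / \<epsilon>)" for x
      by (simp add: u_def diff_divide_distrib flip: exp_add)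
    then show ?thesis using expT[OF eqs(4)[of y] cont(3)] by simp
  qed
  obtain z where z: "\<And>x. v x \<le> v z"
    using continuous_attains_sup[OF cpt _ vc] by auto
  have uge: "1 / v z \<le> u y" for y
  proof -
    have "exp (- f' y / \<epsilon>) \<le> (\<integral>x. v z * exp ((g x - c x y) / \<epsilon>) \<partial>\<mu>)"
      unfolding f'I
      by (intro integral_mono int continuous_on_mult vc cE cont continuous_on_const mult_right_mono z) auto
    also have "\<dots> = v z * exp (- f y / \<epsilon>)" using expT[OF eqs(1)[of y] cont(2)] by simp
    also have "\<dots> = exp (- f' y / \<epsilon>) * (v z * u y)" unfolding ueq[symmetric] by simp
    finally have "1 \<le> v z * u y" by simp
    then show ?thesis using vp[of z] by (simp add: field_simps)
  qed
  \<comment> \<open>Equality case at the maximum point \<open>z\<close>: by \<open>uge\<close> the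
    integrand is nonnegative, and the two equations for the potentials at \<open>z\<close> make its
    integral vanish.\<close>
  have "AE x in \<mu>. (u x - 1 / v z) * exp ((f x - c x z) / \<epsilon>) = 0"
  proof -
    have i: "integrable \<mu> (\<lambda>x. u x * exp ((f x - c x z) / \<epsilon>))" "integrable \<mu> (\<lambda>x. exp ((f x - c x z) / \<epsilon>))"
      by (intro int continuous_on_mult uc cE cont)+
    have "(\<integral>x. (u x - 1 / v z) * exp ((f x - c x z) / \<epsilon>) \<partial>\<mu>)
      = exp (- g' z / \<epsilon>) - 1 / v z * exp (- g z / \<epsilon>)"
      unfolding g'I expT[OF eqs(2)[of z] cont(1)] using i by (simp add: left_diff_distrib)
    also have "\<dots> = 0" using vp[of z] unfolding veq[symmetric] by simp
    finally have z0: "(\<integral>x. (u x - 1 / v z) * exp ((f x - c x z) / \<epsilon>) \<partial>\<mu>) = 0" .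
    show ?thesis
    proof (rule integral_nonneg_eq_0_iff_AE[THEN iffD1, OF _ _ z0])
      show "integrable \<mu> (\<lambda>x. (u x - 1 / v z) * exp ((f x - c x z) / \<epsilon>))"
        by (intro int continuous_on_mult continuous_on_diff continuous_on_const uc cE cont)
      show "AE x in \<mu>. 0 \<le> (u x - 1 / v z) * exp ((f x - c x z) / \<epsilon>)"
        using uge by (intro AE_I2 mult_nonneg_nonneg) auto
    qed
  qed
  then have uae: "AE x in \<mu>. u x = 1 / v z" by simp
  \<comment> \<open>The integral formula for \<open>g'\<close> holds at every point and sees
    \<open>u\<close> only almost everywhere, so constancy passes from \<mu>-almost all points to all
    points.\<close>
  have vconst: "v x = v z" for x
  proof -
    have "exp (- g' x / \<epsilon>) = (\<integral>y. 1 / v z * exp ((f y - c y x) / \<epsilon>) \<partial>\<mu>)"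
      unfolding g'I
    proof (rule integral_cong_AE)
      show "(\<lambda>y. u y * exp ((f y - c y x) / \<epsilon>)) \<in> borel_measurable \<mu>"
        "(\<lambda>y. 1 / v z * exp ((f y - c y x) / \<epsilon>)) \<in> borel_measurable \<mu>"
        by (intro borel_measurable_integrable int continuous_on_mult uc cE cont continuous_on_const)+
    qed (use uae in auto)
    also have "\<dots> = 1 / v z * exp (- g x / \<epsilon>)" using expT[OF eqs(2)[of x] cont(1)] by simp
    also have "\<dots> = exp (- g' x / \<epsilon>) * (v x / v z)" unfolding veq[symmetric] by simp
    finally show ?thesis using vp[of z] by (simp add: field_simps)
  qed
  have uconst: "u y = 1 / v z" for y
  proof -
    have "exp (- f' y / \<epsilon>) = (\<integral>x. v z * exp ((g x - c x y) / \<epsilon>) \<partial>\<mu>)"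
      unfolding f'I by (intro Bochner_Integration.integral_cong refl arg_cong2[where f = "(*)"] vconst)
    also have "\<dots> = v z * exp (- f y / \<epsilon>)" using expT[OF eqs(1)[of y] cont(2)] by simp
    also have "\<dots> = exp (- f' y / \<epsilon>) * (v z * u y)" unfolding ueq[symmetric] by simp
    finally show ?thesis using vp[of z] by (simp add: field_simps)
  qed
  \<comment> \<open>The only freedom left is a constant moved from one potential to the other; the
    two normalisations force it to be 0.\<close>
  define s where "s = \<epsilon> * ln (v z)"
  have gs: "g' x = g x + s" for x
    using arg_cong[OF vconst[of x], of ln] \<epsilon> unfolding s_def v_def[of x] by (simp add: field_simps)
  have fs: "f' x = f x - s" for x
    using arg_cong[OF uconst[of x], of ln] \<epsilon> vp[of z] unfolding s_def u_def
    by (simp add: ln_div field_simps)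
  have "(\<integral>x. f' x \<partial>\<mu>) = (\<integral>x. f x \<partial>\<mu>) - s" "(\<integral>x. g' x \<partial>\<mu>) = (\<integral>x. g x \<partial>\<mu>) + s"
    using int[OF cont(1)] int[OF cont(2)] by (simp_all add: fs gs prob_space)
  with nrm have "s = 0" by simp
  with fs gs show ?thesis by auto
qed

text \<open>Substituting \<open>a x / w x\<close> for the coefficients identifies the unit balls of
  the two quadratic forms. This makes multiplication by \<open>w\<close> an isometry, to be used
  with the kernel \<open>k_mu\<close> and \<open>w = b\<close>.\<close>

lemma rkhs_evals_rescale:
  assumes "\<And>x. (w x :: real) > 0"
  shows "rkhs_evals (\<lambda>x y. k x y / (w x * w y)) g = rkhs_evals k (\<lambda>x. w x * g x)"
proof -
  have q: "kquad (\<lambda>x y. k x y / (w x * w y)) S a = kquad k S (\<lambda>x. a x / w x)" for S a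
    unfolding kquad_def by simp
  have s: "(\<Sum>x\<in>S. a x / w x * (w x * g x)) = (\<Sum>x\<in>S. a x * g x)" for S a
    using assms by (intro sum.cong) (auto simp: less_imp_neq[THEN not_sym])
  have r: "(\<lambda>x. a x * w x / w x) = a" for a using assms by (auto simp: less_imp_neq[THEN not_sym])
  show ?thesis
  proof (intro set_eqI iffI)
    fix t assume "t \<in> rkhs_evals (\<lambda>x y. k x y / (w x * w y)) g"
    then have "\<exists>S a. t = \<bar>\<Sum>x\<in>S. a x * g x\<bar> \<and> finite S \<and> kquad k S (\<lambda>x. a x / w x) \<le> 1"
      unfolding rkhs_evals_def by (simp add: q)
    then obtain S a where "t = \<bar>\<Sum>x\<in>S. a x * g x\<bar>" and "finite S" "kquad k S (\<lambda>x. a x / w x) \<le> 1"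
      by (elim exE conjE)
    then show "t \<in> rkhs_evals k (\<lambda>x. w x * g x)"
      using rkhs_evalsI[of S k "\<lambda>x. a x / w x" "\<lambda>x. w x * g x"] by (simp only: s)
  next
    fix t assume "t \<in> rkhs_evals k (\<lambda>x. w x * g x)"
    then have "\<exists>S a. t = \<bar>\<Sum>x\<in>S. a x * (w x * g x)\<bar> \<and> finite S \<and> kquad k S a \<le> 1"
      unfolding rkhs_evals_def by simp
    then obtain S a where t: "t = \<bar>\<Sum>x\<in>S. a x * (w x * g x)\<bar>" and "finite S" "kquad k S a \<le> 1"
      by (elim exE conjE)
    then have "\<bar>\<Sum>x\<in>S. (a x * w x) * g x\<bar> \<in> rkhs_evals (\<lambda>x y. k x y / (w x * w y)) g"
      by (intro rkhs_evalsI) (simp_all only: q r)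
    then show "t \<in> rkhs_evals (\<lambda>x y. k x y / (w x * w y)) g" by (simp add: t mult.assoc)
  qed
qed

lemma rkhs_rescale:
  assumes "\<And>x. (w x :: real) > 0"
  shows "g \<in> rkhs (\<lambda>x y. k x y / (w x * w y)) \<longleftrightarrow> (\<lambda>x. w x * g x) \<in> rkhs k"
    and "rkhs_inner (\<lambda>x y. k x y / (w x * w y)) g h = rkhs_inner k (\<lambda>x. w x * g x) (\<lambda>x. w x * h x)"
  unfolding rkhs_def rkhs_inner_def rkhs_norm_def rkhs_evals_rescale[OF assms]
  by (simp_all add: distrib_left right_diff_distrib)

section \<open>Lebesgue differentiation on the real line\<close>

text \<open>On a Vitali cover of the exceptional set by intervals with a bad difference quotient, Henstock's
  lemma bounds the total length of any finite disjoint subfamily.\<close>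

lemma negligible_not_derivative_integral_aux:
  fixes f :: "real \<Rightarrow> real"
  assumes f: "f integrable_on {a..b}" and F: "\<And>x. F x = integral {a..x} f"
  shows "negligible {x \<in> {a..b}. \<forall>\<delta>>0. \<exists>y\<in>{a..b}. y \<noteq> x \<and> \<bar>y - x\<bar> < \<delta> \<and>
           \<bar>F y - F x - f x * (y - x)\<bar> > \<bar>y - x\<bar> / real (Suc n)}" (is "negligible ?S")
proof -
  have Fd: "integral {u..v} f = F v - F u" if "a \<le> u" "u \<le> v" "v \<le> b" for u v
  proof -
    have "f integrable_on {a..v}" by (rule integrable_on_subinterval[OF f]) (use that in auto)
    from Henstock_Kurzweil_Integration.integral_combine[OF that(1,2) this] show ?thesis by (simp add: F)
  qed
  define S where "S = ?S"
  have Sab: "x \<in> {a..b}" if "x \<in> S" for x using that unfolding S_def by blast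
  have "negligible S"
    unfolding negligible_outer_le
  proof (intro allI impI)
    fix e :: real assume e: "e > 0"
    \<comment> \<open>The 5 is the enlargement factor of the Vitali covering lemma, and
      \<open>Suc n\<close> is the factor between the length of a bad interval and its Henstock
      error.\<close>
    define e' where "e' = e / (5 * real (Suc n))"
    have e': "e' > 0" using e by (simp add: e'_def del: of_nat_Suc)
    have f': "f integrable_on cbox a b" using f by simp
    obtain \<gamma> where \<gamma>: "gauge \<gamma>" and hen: "\<And>p. p tagged_partial_division_of (cbox a b) \<Longrightarrow> \<gamma> fine p \<Longrightarrow>
             (\<Sum>(x,k)\<in>p. norm (measure lborel k *\<^sub>R f x - integral k f)) < e'"
      using Henstock_lemma[OF f' e'] by blast
    \<comment> \<open>The closed ball is the interval with end points \<open>x\<close> and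
      \<open>y\<close>. It is tagged at the end point \<open>x\<close>, so its inclusion in
      \<open>\<gamma> x\<close> is exactly fineness.\<close>
    define Q where "Q x y \<longleftrightarrow> y \<in> {a..b} \<and> y \<noteq> x \<and> cball ((x + y) / 2) (\<bar>y - x\<bar> / 2) \<subseteq> \<gamma> x \<and>
        \<bar>F y - F x - f x * (y - x)\<bar> > \<bar>y - x\<bar> / real (Suc n)" for x y
    have "\<exists>y. Q x y" if xS: "x \<in> S" for x
    proof -
      obtain \<delta> where \<delta>: "\<delta> > 0" "ball x \<delta> \<subseteq> \<gamma> x"
        using \<gamma> unfolding gauge_def by (meson openE)
      obtain y where y: "y \<in> {a..b}" "y \<noteq> x" "\<bar>y - x\<bar> < \<delta>"
        "\<bar>F y - F x - f x * (y - x)\<bar> > \<bar>y - x\<bar> / real (Suc n)"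
        using xS \<delta>(1) unfolding S_def by blast
      have "cball ((x + y) / 2) (\<bar>y - x\<bar> / 2) \<subseteq> ball x \<delta>"
      proof
        fix z assume "z \<in> cball ((x + y) / 2) (\<bar>y - x\<bar> / 2)"
        then have "\<bar>(x + y) / 2 - z\<bar> \<le> \<bar>y - x\<bar> / 2" by (simp add: dist_real_def)
        then show "z \<in> ball x \<delta>" using y(3) by (simp add: dist_real_def field_simps)
      qed
      with y \<delta> show ?thesis unfolding Q_def by blast
    qed
    then obtain Y where Y: "\<And>x. x \<in> S \<Longrightarrow> Q x (Y x)" by metis
    note Y = Y[unfolded Q_def]
    let ?m = "\<lambda>x. (x + Y x) / 2" and ?r = "\<lambda>x. \<bar>Y x - x\<bar> / 2"
    have mem: "x \<in> cball (?m x) (?r x)" for x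
      by (simp add: dist_real_def field_simps)
    have bnd: "0 < ?r x \<and> ?r x \<le> b - a" if "x \<in> S" for x
      using Y[OF that] Sab[OF that] by auto
    have cov: "S \<subseteq> (\<Union>i\<in>S. cball (?m i) (?r i))" using mem by blast
    obtain C where C: "countable C" "C \<subseteq> S"
      "pairwise (\<lambda>i j. disjnt (cball (?m i) (?r i)) (cball (?m j) (?r j))) C"
      "S \<subseteq> (\<Union>i\<in>C. cball (?m i) (5 * ?r i))"
      using Vitali_covering_lemma_cballs[where S = S and K = S and a = ?m and r = ?r and B = "b - a", OF cov bnd]
      by blast
    have fin: "measure lebesgue (\<Union>i\<in>D. cball (?m i) (5 * ?r i)) \<le> e" if D: "D \<subseteq> C" "finite D" for D
    proof -
      let ?K = "\<lambda>x. cball (?m x) (?r x)"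
      let ?p = "(\<lambda>x. (x, ?K x)) ` D"
      have DS: "x \<in> S" if "x \<in> D" for x using that D C by blast
      have Kint: "?K x = {min x (Y x)..max x (Y x)}" for x
        by (auto simp: cball_eq_atLeastAtMost min_def max_def field_simps abs_if)
      have part: "?p tagged_partial_division_of (cbox a b)"
        unfolding tagged_partial_division_of_def
      proof (intro conjI allI impI)
        show "finite ?p" using D by simp
        fix x K assume xK: "(x, K) \<in> ?p"
        then have x: "x \<in> D" "K = ?K x" by auto
        show "x \<in> K" using mem x by simp
        show "K \<subseteq> cbox a b" using Sab[OF DS[OF x(1)]] Y[OF DS[OF x(1)]] unfolding x(2) Kint by auto
        show "\<exists>a b. K = cbox a b" unfolding x(2) Kint by (metis interval_cbox)
      next
        fix x1 K1 x2 K2 assume "(x1, K1) \<in> ?p \<and> (x2, K2) \<in> ?p \<and> (x1, K1) \<noteq> (x2, K2)"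
        then have "x1 \<in> D" "x2 \<in> D" "x1 \<noteq> x2" and K: "K1 = ?K x1" "K2 = ?K x2" by auto
        then have "disjnt (?K x1) (?K x2)" using C(3) D by (auto simp: pairwise_def)
        then show "interior K1 \<inter> interior K2 = {}" unfolding K disjnt_def
          using interior_subset by blast
      qed
      have fine: "\<gamma> fine ?p"
        unfolding fine_def using Y DS by auto
      \<comment> \<open>The Henstock error of such an interval is the deviation of its increment
        from linearity, which badness bounds below in terms of the length.\<close>
      have tm: "2 * ?r x / real (Suc n) \<le> norm (measure lborel (?K x) *\<^sub>R f x - integral (?K x) f)" if "x \<in> D" for x
      proof -
        have xy: "x \<in> {a..b}" "Y x \<in> {a..b}" and gt: "\<bar>F (Y x) - F x - f x * (Y x - x)\<bar> > \<bar>Y x - x\<bar> / real (Suc n)"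
          using Sab[OF DS[OF that]] Y[OF DS[OF that]] by auto
        have "norm (measure lborel (?K x) *\<^sub>R f x - integral (?K x) f) = \<bar>F (Y x) - F x - f x * (Y x - x)\<bar>"
        proof (cases "x \<le> Y x")
          case True
          then have i: "integral (?K x) f = F (Y x) - F x" unfolding Kint using Fd[of x "Y x"] xy by (simp add: min_def max_def)
          have c: "measure lborel (?K x) = Y x - x" unfolding Kint using True by (simp add: min_def max_def)
          have "(Y x - x) *\<^sub>R f x - (F (Y x) - F x) = - (F (Y x) - F x - f x * (Y x - x))"
            by (simp add: algebra_simps)
          then show ?thesis unfolding i c by (simp only: norm_minus_cancel real_norm_def)
        next
          case False
          then have i: "integral (?K x) f = F x - F (Y x)" unfolding Kint using Fd[of "Y x" x] xy by (simp add: min_def max_def)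
          have c: "measure lborel (?K x) = x - Y x" unfolding Kint using False by (simp add: min_def max_def)
          show ?thesis unfolding i c by (simp add: algebra_simps)
        qed
        then show ?thesis using gt by simp
      qed
      have "(\<Sum>x\<in>D. 2 * ?r x / real (Suc n)) \<le> (\<Sum>x\<in>D. norm (measure lborel (?K x) *\<^sub>R f x - integral (?K x) f))"
        by (rule sum_mono[OF tm])
      also have "\<dots> = (\<Sum>(x,k)\<in>?p. norm (measure lborel k *\<^sub>R f x - integral k f))"
        by (subst sum.reindex) (auto simp: inj_on_def)
      also have "\<dots> < e'" by (rule hen[OF part fine])
      finally have "(\<Sum>x\<in>D. 2 * ?r x) / real (Suc n) < e'" by (simp only: sum_divide_distrib)
      then have s: "(\<Sum>x\<in>D. 2 * ?r x) < e' * real (Suc n)" by (simp add: field_simps)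
      have "measure lebesgue (\<Union>i\<in>D. cball (?m i) (5 * ?r i)) \<le> (\<Sum>i\<in>D. measure lebesgue (cball (?m i) (5 * ?r i)))"
        using D(2) by (intro measure_UNION_le) auto
      also have "\<dots> = (\<Sum>i\<in>D. 5 * (2 * ?r i))"
        by (intro sum.cong refl) (simp add: cball_eq_atLeastAtMost)
      also have "\<dots> = 5 * (\<Sum>i\<in>D. 2 * ?r i)" by (simp only: sum_distrib_left)
      also have "\<dots> \<le> 5 * (e' * real (Suc n))" using s by linarith
      also have "\<dots> = e" by (simp add: e'_def del: of_nat_Suc)
      finally show ?thesis .
    qed
    have meas: "cball (?m i) (5 * ?r i) \<in> lmeasurable" for i by simp
    show "\<exists>T. S \<subseteq> T \<and> T \<in> lmeasurable \<and> measure lebesgue T \<le> e"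
      using C(4) fmeasurable_UN_bound[OF C(1) meas fin] measure_UN_bound[OF C(1) meas fin] by blast
  qed
  then show ?thesis by (simp only: S_def)
qed

lemma negligible_not_derivative_integral:
  fixes f :: "real \<Rightarrow> real"
  assumes f: "f integrable_on {a..b}"
  shows "negligible {x \<in> {a..b}.
    \<not> ((\<lambda>y. (integral {a..y} f - integral {a..x} f) / (y - x)) \<longlongrightarrow> f x) (at x within {a..b})}" (is "negligible ?N")
proof -
  define F where "F x = integral {a..x} f" for x
  define S where "S n = {x \<in> {a..b}. \<forall>\<delta>>0. \<exists>y\<in>{a..b}. y \<noteq> x \<and> \<bar>y - x\<bar> < \<delta> \<and>
           \<bar>F y - F x - f x * (y - x)\<bar> > \<bar>y - x\<bar> / real (Suc n)}" for n
  have "negligible (S n)" for n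
    unfolding S_def by (rule negligible_not_derivative_integral_aux[OF f F_def])
  then have "negligible (\<Union>n. S n)"
    by (intro negligible_countable_Union) auto
  moreover have "?N \<subseteq> (\<Union>n. S n)"
  proof
    fix x assume x: "x \<in> ?N"
    show "x \<in> (\<Union>n. S n)"
    proof (rule ccontr)
      assume nS: "x \<notin> (\<Union>n. S n)"
      have "((\<lambda>y. (F y - F x) / (y - x)) \<longlongrightarrow> f x) (at x within {a..b})"
        unfolding Lim_within
      proof (intro allI impI)
        fix e :: real assume "e > 0"
        then obtain n where n: "inverse (real (Suc n)) < e" using reals_Archimedean by blast
        have "x \<notin> S n" using nS by blast
        then have "\<exists>\<delta>>0. \<forall>y\<in>{a..b}. y = x \<or> \<delta> \<le> \<bar>y - x\<bar> \<or>
            \<bar>F y - F x - f x * (y - x)\<bar> \<le> \<bar>y - x\<bar> / real (Suc n)"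
          using x unfolding S_def by (simp add: not_less)
        then obtain \<delta> where \<delta>: "\<delta> > 0" "\<forall>y\<in>{a..b}. y = x \<or> \<delta> \<le> \<bar>y - x\<bar> \<or>
            \<bar>F y - F x - f x * (y - x)\<bar> \<le> \<bar>y - x\<bar> / real (Suc n)"
          by blast
        have "dist ((F y - F x) / (y - x)) (f x) < e" if y: "y \<in> {a..b}" "0 < dist y x" "dist y x < \<delta>" for y
        proof -
          have ne: "y \<noteq> x" using y by auto
          have "\<bar>(F y - F x) / (y - x) - f x\<bar> = \<bar>F y - F x - f x * (y - x)\<bar> / \<bar>y - x\<bar>"
            using ne by (simp add: diff_divide_distrib flip: abs_divide)
          also have "\<dots> \<le> (\<bar>y - x\<bar> / real (Suc n)) / \<bar>y - x\<bar>"
            using \<delta>(2)[rule_format, OF y(1)] ne y by (intro divide_right_mono) (auto simp: dist_real_def)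
          also have "\<dots> = inverse (real (Suc n))" using ne by (simp add: divide_inverse)
          finally show ?thesis using n by (simp add: dist_real_def)
        qed
        then show "\<exists>d>0. \<forall>xa\<in>{a..b}. 0 < dist xa x \<and> dist xa x < d \<longrightarrow> dist ((F xa - F x) / (xa - x)) (f x) < e"
          using \<delta>(1) by blast
      qed
      then show False using x by (simp add: F_def)
    qed
  qed
  ultimately show ?thesis by (rule negligible_subset)
qed

lemma AE_derivative_integral:
  fixes f :: "real \<Rightarrow> real"
  assumes f: "\<And>T. T \<ge> 0 \<Longrightarrow> set_integrable lborel {0..T} f"
  shows "AE t in lborel. t \<ge> 0 \<longrightarrow>
    ((\<lambda>s. ((\<integral>r\<in>{0..s}. f r \<partial>lborel) - (\<integral>r\<in>{0..t}. f r \<partial>lborel)) / (s - t)) \<longlongrightarrow> f t) (at t within {0..})"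
proof -
  let ?N = "\<lambda>n. {x \<in> {0..real n}.
    \<not> ((\<lambda>y. (integral {0..y} f - integral {0..x} f) / (y - x)) \<longlongrightarrow> f x) (at x within {0..real n})}"
  have eq: "(\<integral>r\<in>{0..s}. f r \<partial>lborel) = integral {0..s} f" if "s \<ge> 0" for s
    by (rule set_borel_integral_eq_integral(2)[OF f[OF that]])
  have "negligible (?N n)" for n
    by (intro negligible_not_derivative_integral set_borel_integral_eq_integral(1) f) simp
  then have "negligible (\<Union>n. ?N n)"
    by (intro negligible_countable_Union) blast+
  then have "AE t in lebesgue. t \<notin> (\<Union>n. ?N n)"
    unfolding negligible_iff_null_sets by (rule AE_not_in)
  then have "AE t in lborel. t \<notin> (\<Union>n. ?N n)" by (simp only: AE_completion_iff)
  then show ?thesis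
  proof (eventually_elim, intro impI)
    fix t :: real assume t: "t \<notin> (\<Union>n. ?N n)" and t0: "0 \<le> t"
    \<comment> \<open>The strict inequality keeps \<open>t\<close> away from the right end point, so
      the limit within \<open>{0..real n}\<close> is the limit within \<open>{0..}\<close>.\<close>
    obtain n where n: "t < real n" using reals_Archimedean2 by blast
    have lim: "((\<lambda>y. (integral {0..y} f - integral {0..t} f) / (y - t)) \<longlongrightarrow> f t) (at t within {0..real n})"
      using t t0 n by auto
    have at: "at t within {0..real n} = at t within {0..}"
      by (rule at_within_nhd[of t "{..<real n}"]) (use n in auto)
    have "((\<lambda>s. (integral {0..s} f - integral {0..t} f) / (s - t)) \<longlongrightarrow> f t) (at t within {0..})"
      using lim unfolding at .
    then show "((\<lambda>s. ((\<integral>r\<in>{0..s}. f r \<partial>lborel) - (\<integral>r\<in>{0..t}. f r \<partial>lborel)) / (s - t)) \<longlongrightarrow> f t) (at t within {0..})"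
      by (rule Lim_transform_eventually) (auto simp: eventually_at_filter eq t0 intro!: always_eventually)
  qed
qed

section \<open>The homeomorphism between probability measures and their exponentiated potentials\<close>

locale sinkhorn =
  fixes \<epsilon> :: real and c :: "'a::metric_space \<Rightarrow> 'a \<Rightarrow> real"
  assumes compact_UNIV: "compact (UNIV :: 'a set)"
    and eps: "\<epsilon> > 0"
    and ccont: "continuous_on UNIV (\<lambda>(x, y). c x y)"
    and kc_pd: "pos_def_kernel (kc \<epsilon> c)"
    and kc_univ: "universal_kernel (kc \<epsilon> c)"
begin

sublocale cpt_kernel "kc \<epsilon> c"
proof
  show "continuous_on UNIV (\<lambda>(x, y). kc \<epsilon> c x y)"
    using ccont eps unfolding kc_def case_prod_unfold by (intro continuous_intros) auto
qed (use kc_pd compact_UNIV in auto)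

abbreviation k where "k \<equiv> kc \<epsilon> c"
abbreviation meas_of where "meas_of \<equiv> Hc_inv \<epsilon> c"

lemma kpos: "k x y > 0" by (simp add: kc_def)

text \<open>The embedding determines the integrals of all functions in \<open>H\<close>, and
  universality makes these uniformly dense among continuous functions. The summand 1 in
  \<open>?m\<close> only keeps the denominator positive.\<close>

lemma kembed_inj:
  assumes M: "pos_radon M" and N: "pos_radon N" and eq: "kembed k M = kembed k N"
  shows "M = N"
proof (rule radon_measure_eqI[OF cpt M N])
  fix f :: "'a \<Rightarrow> real" assume f: "continuous_on UNIV f"
  let ?m = "measure M UNIV + measure N UNIV + 1"
  have "\<bar>(\<integral>x. f x \<partial>M) - (\<integral>x. f x \<partial>N)\<bar> \<le> 0 + e" if e: "e > 0" for e
  proof -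
    have d: "e / ?m > 0" using e by (simp add: add_nonneg_pos)
    obtain g where g: "g \<in> H" "\<And>x. \<bar>f x - g x\<bar> < e / ?m"
      using kc_univ f d unfolding universal_kernel_def by blast
    have gc: "continuous_on UNIV g" by (rule rkhs_continuous[OF g(1)])
    have near: "\<bar>(\<integral>x. f x \<partial>L) - (\<integral>x. g x \<partial>L)\<bar> \<le> e / ?m * measure L UNIV" if L: "pos_radon L" for L
    proof -
      interpret finite_measure L using L by (simp add: pos_radon_def)
      have sp: "space L = UNIV" using L sets_eq_imp_space_eq[of L borel] by (simp add: pos_radon_def)
      have i: "integrable L f" "integrable L g" using integrable_radon[OF L] f gc by auto
      have "\<bar>(\<integral>x. f x \<partial>L) - (\<integral>x. g x \<partial>L)\<bar> = \<bar>\<integral>x. f x - g x \<partial>L\<bar>" using i by simp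
      also have "\<dots> \<le> (\<integral>x. \<bar>f x - g x\<bar> \<partial>L)" by (rule integral_abs_bound)
      also have "\<dots> \<le> (\<integral>x. e / ?m \<partial>L)"
        using i g(2) by (intro integral_mono) (auto intro: less_imp_le)
      finally show ?thesis by (simp add: sp mult.commute)
    qed
    have "(\<integral>x. g x \<partial>M) = ip g (kembed k M)" "(\<integral>x. g x \<partial>N) = ip g (kembed k N)"
      using kemb_inner[OF M, of "\<lambda>_. 1"] kemb_inner[OF N, of "\<lambda>_. 1"] g(1) by (simp_all add: kemb_one)
    then have "(\<integral>x. g x \<partial>M) = (\<integral>x. g x \<partial>N)" using eq by simp
    then have "\<bar>(\<integral>x. f x \<partial>M) - (\<integral>x. f x \<partial>N)\<bar> \<le> e / ?m * measure M UNIV + e / ?m * measure N UNIV"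
      using near[OF M] near[OF N] by linarith
    also have "\<dots> = e * ((measure M UNIV + measure N UNIV) / ?m)"
      by (simp add: distrib_left add_divide_distrib)
    also have "\<dots> \<le> e * 1"
      using e by (intro mult_left_mono) (auto simp: divide_le_eq add_nonneg_pos)
    finally show ?thesis by simp
  qed
  then have "\<bar>(\<integral>x. f x \<partial>M) - (\<integral>x. f x \<partial>N)\<bar> \<le> 0" by (rule field_le_epsilon)
  then show "(\<integral>x. f x \<partial>M) = (\<integral>x. f x \<partial>N)" by simp
qed

lemma meas_of_eq: "pos_radon M \<Longrightarrow> meas_of (kembed k M) = M"
  unfolding Hc_inv_def by (rule the_equality) (auto intro: kembed_inj)

lemma calB_meas:
  assumes "b \<in> calB \<epsilon> c"
  shows "pos_radon (meas_of b)" "kembed k (meas_of b) = b"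
proof -
  obtain M where M: "pos_radon M" "b = kembed k M" using assms unfolding calB_def by blast
  show "pos_radon (meas_of b)" "kembed k (meas_of b) = b" using M meas_of_eq by auto
qed

lemma calB_norm: "b \<in> calB \<epsilon> c \<Longrightarrow> nm b = 1"
  unfolding calB_def by blast

lemma calB_kemb: "b \<in> calB \<epsilon> c \<Longrightarrow> kemb (\<lambda>_. 1) (meas_of b) = b"
  by (simp add: kemb_one calB_meas)

lemma calB_mem: assumes "b \<in> calB \<epsilon> c" shows "b \<in> H"
  using kemb_mem[OF calB_meas(1)[OF assms], of "\<lambda>_. 1"] by (simp add: calB_kemb assms)

lemma calB_cont: "b \<in> calB \<epsilon> c \<Longrightarrow> continuous_on UNIV b"
  by (rule rkhs_continuous[OF calB_mem])

lemma calB_inner: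
  assumes "b \<in> calB \<epsilon> c" "g \<in> H" shows "ip g b = (\<integral>x. g x \<partial>meas_of b)"
  using kemb_inner[OF calB_meas(1)[OF assms(1)], of "\<lambda>_. 1" g] assms by (simp add: calB_kemb)

text \<open>The unit norm constraint becomes the statement that \<open>Binv\<close> has total mass
  1.\<close>

lemma calB_energy: "b \<in> calB \<epsilon> c \<Longrightarrow> (\<integral>x. b x \<partial>meas_of b) = 1"
  using calB_inner[of b b] rkhs_inner_self[of b] calB_norm[of b] by (simp add: calB_mem)

section \<open>Positivity and uniform mass bounds on \<open>calB\<close>\<close>

lemma kmin: obtains m where "m > 0" "\<And>x y. m \<le> k x y"
proof -
  have c: "compact (UNIV :: ('a \<times> 'a) set)" using compact_Times[OF cpt cpt] by simp
  obtain p where p: "\<forall>q\<in>UNIV. k (fst p) (snd p) \<le> k (fst q) (snd q)"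
    using continuous_attains_inf[OF c UNIV_not_empty kcont'] by blast
  have "k (fst p) (snd p) \<le> k x y" for x y using p[rule_format, of "(x, y)"] by simp
  then show ?thesis using that[of "k (fst p) (snd p)"] kpos by blast
qed

lemma calB_ge_mass:
  assumes "b \<in> calB \<epsilon> c" "\<And>x y. m \<le> k x y"
  shows "m * measure (meas_of b) UNIV \<le> b y"
proof -
  let ?M = "meas_of b"
  note M = calB_meas(1)[OF assms(1)]
  interpret finite_measure ?M using M by (simp add: pos_radon_def)
  have sp: "space ?M = UNIV" using M sets_eq_imp_space_eq[of ?M borel] by (simp add: pos_radon_def)
  have "(\<integral>x. m \<partial>?M) \<le> (\<integral>x. k x y \<partial>?M)"
    by (intro integral_mono integrable_radon[OF M] kcont_comp continuous_intros assms(2))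
  also have "\<dots> = b y" using calB_meas(2)[OF assms(1)] by (simp add: kembed_def fun_eq_iff)
  finally show ?thesis by (simp add: sp mult.commute)
qed

lemma calB_mass_pos: assumes "b \<in> calB \<epsilon> c" shows "measure (meas_of b) UNIV > 0"
proof (rule ccontr)
  let ?M = "meas_of b"
  note M = calB_meas(1)[OF assms]
  interpret finite_measure ?M using M by (simp add: pos_radon_def)
  have sp: "space ?M = UNIV" using M sets_eq_imp_space_eq[of ?M borel] by (simp add: pos_radon_def)
  assume "\<not> 0 < measure ?M UNIV"
  then have "measure ?M UNIV = 0" using zero_less_measure_iff by blast
  then have "emeasure ?M (space ?M) = 0" by (simp add: emeasure_eq_measure sp)
  then have "AE x in ?M. b x = 0" by (intro AE_I[of _ _ "space ?M"]) auto
  then have "(\<integral>x. b x \<partial>?M) = 0" by (rule integral_eq_zero_AE)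
  then show False using calB_energy[OF assms] by simp
qed

lemma calB_pos: assumes "b \<in> calB \<epsilon> c" shows "b x > 0"
proof -
  obtain m where m: "m > 0" "\<And>x y. m \<le> k x y" using kmin by blast
  have "0 < m * measure (meas_of b) UNIV" using m(1) calB_mass_pos[OF assms] by simp
  then show ?thesis using calB_ge_mass[OF assms m(2), of x] by linarith
qed

text \<open>The energy equals 1 and is at least \<open>m\<close> times the squared mass. The
  uniformity in \<open>b\<close> is what allows weak convergence of the measures to be tested on a
  dense class.\<close>

lemma calB_mass_bound: obtains C where "C > 0" "\<And>b. b \<in> calB \<epsilon> c \<Longrightarrow> measure (meas_of b) UNIV \<le> C"
proof -
  obtain m where m: "m > 0" "\<And>x y. m \<le> k x y" using kmin by blast
  have "measure (meas_of b) UNIV \<le> 1 / sqrt m" if b: "b \<in> calB \<epsilon> c" for b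
  proof -
    let ?M = "meas_of b" and ?t = "measure (meas_of b) UNIV"
    note M = calB_meas(1)[OF b]
    interpret finite_measure ?M using M by (simp add: pos_radon_def)
    have sp: "space ?M = UNIV" using M sets_eq_imp_space_eq[of ?M borel] by (simp add: pos_radon_def)
    have "(\<integral>x. m * ?t \<partial>?M) \<le> (\<integral>x. b x \<partial>?M)"
      by (intro integral_mono integrable_radon[OF M] calB_cont[OF b] continuous_intros calB_ge_mass[OF b m(2)])
    then have "m * ?t * ?t \<le> 1" by (simp add: sp calB_energy[OF b] mult.commute mult.left_commute)
    moreover have "(?t * sqrt m)\<^sup>2 = m * ?t * ?t"
      using m(1) by (simp add: power_mult_distrib power2_eq_square[of ?t])
    ultimately have "(?t * sqrt m)\<^sup>2 \<le> 1\<^sup>2" by simp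
    then have "?t * sqrt m \<le> 1" by (rule power2_le_imp_le) simp
    then show ?thesis using m(1) by (simp add: field_simps)
  qed
  then show ?thesis using that[of "1 / sqrt m"] m(1) by simp
qed

section \<open>The probability measure of a point of \<open>calB\<close> and its Schrodinger
  potential\<close>

lemma integral_Binv:
  assumes b: "b \<in> calB \<epsilon> c" and f: "continuous_on UNIV (f :: 'a \<Rightarrow> real)"
  shows "(\<integral>x. f x \<partial>Binv \<epsilon> c b) = (\<integral>x. b x * f x \<partial>meas_of b)"
  unfolding Binv_def
  using integrable_radon[OF calB_meas(1)[OF b] f] integrable_radon[OF calB_meas(1)[OF b] calB_cont[OF b]]
  by (subst integral_density) (auto intro: less_imp_le calB_pos[OF b])

lemma prob_radon_Binv:
  assumes b: "b \<in> calB \<epsilon> c" shows "prob_radon (Binv \<epsilon> c b)"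
proof -
  note M = calB_meas(1)[OF b]
  have int: "integrable (meas_of b) b" by (rule integrable_radon[OF M calB_cont[OF b]])
  have "emeasure (Binv \<epsilon> c b) (space (meas_of b)) = (\<integral>\<^sup>+ x. ennreal (b x) \<partial>meas_of b)"
    unfolding Binv_def using int by (subst emeasure_density) (auto intro!: nn_integral_cong simp: indicator_def)
  also have "\<dots> = ennreal (\<integral>x. b x \<partial>meas_of b)"
    by (rule nn_integral_eq_integral[OF int]) (simp add: less_imp_le calB_pos[OF b])
  also have "\<dots> = 1" by (simp add: calB_energy[OF b])
  finally have "prob_space (Binv \<epsilon> c b)" by (intro prob_spaceI) (simp add: Binv_def)
  moreover have "sets (Binv \<epsilon> c b) = sets borel" using M by (simp add: Binv_def pos_radon_def)
  ultimately show ?thesis by (simp add: prob_radon_def)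
qed

lemma msupp_Binv:
  assumes b: "b \<in> calB \<epsilon> c" shows "msupp (Binv \<epsilon> c b) = msupp (meas_of b)"
proof -
  let ?M = "meas_of b"
  have sM: "sets ?M = sets borel" using calB_meas(1)[OF b] by (simp add: pos_radon_def)
  have bm: "b \<in> borel_measurable ?M"
    using integrable_radon[OF calB_meas(1)[OF b] calB_cont[OF b]] by simp
  have nle: "(b x \<le> 0) = False" for x using calB_pos[OF b, of x] by simp
  have "emeasure (Binv \<epsilon> c b) U = 0 \<longleftrightarrow> emeasure ?M U = 0" if "open U" for U
  proof -
    have U: "U \<in> sets ?M" using that by (simp add: sM)
    have "emeasure (Binv \<epsilon> c b) U = 0 \<longleftrightarrow> U \<in> null_sets (density ?M b)"
      unfolding Binv_def using U by (auto simp: null_sets_def)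
    also have "\<dots> \<longleftrightarrow> (AE x in ?M. x \<notin> U)"
      using bm U nle by (subst null_sets_density_iff) (auto simp: ennreal_eq_0_iff)
    also have "\<dots> \<longleftrightarrow> emeasure ?M U = 0"
      using U by (simp add: AE_iff_null_sets[symmetric] null_sets_def)
    finally show ?thesis .
  qed
  then show ?thesis unfolding msupp_def by (auto simp: zero_less_iff_neq_zero)
qed

text \<open>For this candidate the factor \<open>1 / b x\<close> coming from the exponential cancels
  the density of \<open>Binv\<close>, and the Schrodinger equation reduces to
  \<open>kembed k (meas_of b) = b\<close>. Uniqueness is required to evaluate the definite
  description in \<open>schr_pair\<close>.\<close>

lemma f_self_Binv:
  assumes b: "b \<in> calB \<epsilon> c" shows "f_self \<epsilon> c (Binv \<epsilon> c b) = (\<lambda>x. - \<epsilon> * ln (b x))"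
proof -
  let ?f = "\<lambda>x. - \<epsilon> * ln (b x)" and ?\<mu> = "Binv \<epsilon> c b"
  have fc: "continuous_on UNIV ?f"
    using calB_pos[OF b] by (intro continuous_intros calB_cont[OF b]) (simp add: less_imp_neq[THEN not_sym])
  have cc: "continuous_on UNIV (\<lambda>x. c x y)" for y
    using continuous_on_compose2[OF ccont, of UNIV "\<lambda>x. (x, y)"] by (simp add: continuous_intros)
  have T: "?f y = T_eps \<epsilon> c ?f ?\<mu> y" for y
  proof -
    have e: "exp ((?f x - c x y) / \<epsilon>) = k x y / b x" for x
    proof -
      have "(?f x - c x y) / \<epsilon> = - c x y / \<epsilon> - ln (b x)"
        using eps by (simp add: field_simps)
      then show ?thesis using calB_pos[OF b, of x] by (simp only: kc_def exp_diff exp_ln)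
    qed
    have "(\<integral>x. exp ((?f x - c x y) / \<epsilon>) \<partial>?\<mu>) = (\<integral>x. b x * (k x y / b x) \<partial>meas_of b)"
      unfolding e using calB_pos[OF b]
      by (intro integral_Binv[OF b] continuous_intros kcont_comp calB_cont[OF b])
         (simp add: less_imp_neq[THEN not_sym])
    also have "\<dots> = (\<integral>x. k x y \<partial>meas_of b)"
      using calB_pos[OF b] by (intro Bochner_Integration.integral_cong) (auto simp: less_imp_neq[THEN not_sym])
    also have "\<dots> = b y" using calB_meas(2)[OF b] by (simp add: kembed_def fun_eq_iff)
    finally show ?thesis by (simp add: T_eps_def)
  qed
  have "schr_pair \<epsilon> c ?\<mu> ?\<mu> = (?f, ?f)"
    unfolding schr_pair_def
  proof (rule the_equality)
    show "case (?f, ?f) of (f, g) \<Rightarrow> continuous_on UNIV f \<and> continuous_on UNIV g \<and>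
        (\<forall>y. f y = T_eps \<epsilon> c g ?\<mu> y) \<and> (\<forall>y. g y = T_eps \<epsilon> c f ?\<mu> y) \<and>
        (\<integral>x. f x \<partial>?\<mu>) = (\<integral>x. g x \<partial>?\<mu>)"
      unfolding case_prod_conv by (intro conjI allI fc T refl)
  next
    fix p assume *: "case p of (f, g) \<Rightarrow> continuous_on UNIV f \<and> continuous_on UNIV g \<and>
        (\<forall>y. f y = T_eps \<epsilon> c g ?\<mu> y) \<and> (\<forall>y. g y = T_eps \<epsilon> c f ?\<mu> y) \<and>
        (\<integral>x. f x \<partial>?\<mu>) = (\<integral>x. g x \<partial>?\<mu>)"
    obtain f g where p: "p = (f, g)" by (cases p)
    have h: "continuous_on UNIV f" "continuous_on UNIV g"
        "\<And>y. f y = T_eps \<epsilon> c g ?\<mu> y" "\<And>y. g y = T_eps \<epsilon> c f ?\<mu> y"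
        "(\<integral>x. f x \<partial>?\<mu>) = (\<integral>x. g x \<partial>?\<mu>)"
      using * unfolding p case_prod_conv by blast+
    have "f = ?f \<and> g = ?f"
      by (rule schrodinger_unique[OF cpt eps cc prob_radon_Binv[OF b] fc fc h(1,2) T T h(3,4) refl h(5)])
    then show "p = (?f, ?f)" using p by simp
  qed
  then show ?thesis by (simp add: f_self_def)
qed

lemma Bmap_Binv:
  assumes b: "b \<in> calB \<epsilon> c" shows "Bmap \<epsilon> c (Binv \<epsilon> c b) = b"
  using calB_pos[OF b] eps by (simp add: fun_eq_iff Bmap_def f_self_Binv[OF b])

lemma k_mu_Binv:
  assumes b: "b \<in> calB \<epsilon> c" shows "k_mu \<epsilon> c (Binv \<epsilon> c b) = (\<lambda>x y. k x y / (b x * b y))"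
proof (intro ext)
  fix x y
  have "(- \<epsilon> * ln (b x) + - \<epsilon> * ln (b y) - c x y) / \<epsilon> = - c x y / \<epsilon> - (ln (b x) + ln (b y))"
    using eps by (simp add: field_simps)
  then show "k_mu \<epsilon> c (Binv \<epsilon> c b) x y = k x y / (b x * b y)"
    unfolding k_mu_def f_self_Binv[OF b] kc_def
    using calB_pos[OF b, of x] calB_pos[OF b, of y] by (simp only: exp_diff exp_add exp_ln)
qed

lemma K_mu_Binv:
  assumes b: "b \<in> calB \<epsilon> c" and \<phi>: "continuous_on UNIV \<phi>"
  shows "K_mu \<epsilon> c (Binv \<epsilon> c b) \<phi> = (\<lambda>y. kemb \<phi> (meas_of b) y / b y)"
proof
  fix y
  have nz: "b x \<noteq> 0" for x using calB_pos[OF b, of x] by simp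
  have "K_mu \<epsilon> c (Binv \<epsilon> c b) \<phi> y = (\<integral>x. b x * (k x y / (b x * b y) * \<phi> x) \<partial>meas_of b)"
    unfolding K_mu_def k_mu_Binv[OF b]
    by (intro integral_Binv[OF b] continuous_intros kcont_comp calB_cont[OF b] \<phi>) (simp add: nz)
  also have "\<dots> = (\<integral>x. k x y * \<phi> x / b y \<partial>meas_of b)"
    using nz by (intro Bochner_Integration.integral_cong) (auto simp: field_simps)
  also have "\<dots> = kemb \<phi> (meas_of b) y / b y" by (simp add: kemb_def)
  finally show "K_mu \<epsilon> c (Binv \<epsilon> c b) \<phi> y = kemb \<phi> (meas_of b) y / b y" .
qed

end

section \<open>The flow inclusion at a fixed time\<close>

context cpt_kernel begin

lemma kemb_integrable:
  assumes "pos_radon M" "continuous_on UNIV \<phi>" shows "integrable M (\<lambda>x. k x y * \<phi> x)"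
  by (intro integrable_radon[OF assms(1)] continuous_on_mult kcont_comp assms(2) continuous_intros)

lemma kemb_diff:
  assumes "pos_radon M" "continuous_on UNIV \<phi>" "continuous_on UNIV \<psi>"
  shows "kemb (\<lambda>x. \<phi> x - \<psi> x) M y = kemb \<phi> M y - kemb \<psi> M y"
  unfolding kemb_def right_diff_distrib
  by (rule Bochner_Integration.integral_diff) (intro kemb_integrable assms)+

lemma kemb_scale: "kemb (\<lambda>x. t * \<phi> x) M y = t * kemb \<phi> M y"
  unfolding kemb_def by (simp add: mult.left_commute[of _ t])

lemma kemb_AE_zero:
  assumes "pos_radon M" "continuous_on UNIV \<phi>" "AE x in M. \<phi> x = 0"
  shows "kemb \<phi> M y = 0"
  unfolding kemb_def by (rule integral_eq_zero_AE) (use assms(3) in auto)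

end

context sinkhorn begin

context
  fixes b :: "'a \<Rightarrow> real" assumes b: "b \<in> calB \<epsilon> c"
begin

abbreviation "M \<equiv> meas_of b"
abbreviation "\<mu> \<equiv> Binv \<epsilon> c b"

lemma b_nz: "b x \<noteq> 0" using calB_pos[OF b, of x] by simp

lemma cont_div_b: "continuous_on UNIV f \<Longrightarrow> continuous_on UNIV (\<lambda>x. f x / b x)"
  by (intro continuous_on_divide calB_cont[OF b]) (auto simp: b_nz)

text \<open>Integrating the equation against \<phi> gives a sum of two nonnegative terms, hence
  \<phi> vanishes \<open>M\<close>-almost everywhere. Then \<open>kemb \<phi> M\<close> is zero at
  every point, and the equation itself removes the exceptional set.\<close>

lemma one_plus_K_inj:
  assumes \<phi>: "continuous_on UNIV \<phi>" and eq: "\<And>x. b x * \<phi> x + kemb \<phi> M x = 0"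
  shows "\<phi> x = 0"
proof -
  note M = calB_meas(1)[OF b]
  have i: "integrable M (\<lambda>x. b x * \<phi> x * \<phi> x)" "integrable M (\<lambda>x. kemb \<phi> M x * \<phi> x)"
    by (intro integrable_radon[OF M] continuous_on_mult calB_cont[OF b] \<phi> kemb_continuous[OF M])+
  have "(\<integral>x. b x * \<phi> x * \<phi> x \<partial>M) + (\<integral>x. kemb \<phi> M x * \<phi> x \<partial>M) = (\<integral>x. (b x * \<phi> x + kemb \<phi> M x) * \<phi> x \<partial>M)"
    using i by (simp add: distrib_right)
  then have "(\<integral>x. b x * \<phi> x * \<phi> x \<partial>M) + (\<integral>x. kemb \<phi> M x * \<phi> x \<partial>M) = 0" by (simp add: eq)
  moreover have "0 \<le> (\<integral>x. kemb \<phi> M x * \<phi> x \<partial>M)" by (rule kemb_energy_nonneg[OF M \<phi>])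
  moreover have nn: "0 \<le> b x * \<phi> x * \<phi> x" for x
    using calB_pos[OF b, of x] by (simp add: mult.assoc)
  moreover have "0 \<le> (\<integral>x. b x * \<phi> x * \<phi> x \<partial>M)" by (intro integral_nonneg_AE AE_I2 nn)
  ultimately have "(\<integral>x. b x * \<phi> x * \<phi> x \<partial>M) = 0" by linarith
  then have "AE x in M. b x * \<phi> x * \<phi> x = 0"
    using integral_nonneg_eq_0_iff_AE[OF i(1)] nn by simp
  then have "AE x in M. \<phi> x = 0" by (simp add: b_nz)
  then have "kemb \<phi> M x = 0" by (rule kemb_AE_zero[OF M \<phi>])
  then show ?thesis using eq[of x] b_nz[of x] by simp
qed

text \<open>The constant \<open>a\<close> disappears because
  \<open>kemb (\<lambda>_. 1) M = b\<close>, so the choice of representative modulo constants is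
  invisible. Under the integral \<open>p\<close> disappears too, since it vanishes
  \<open>M\<close>-almost everywhere; only the pointwise term in \<open>p\<close> remains.\<close>

lemma flow_step_algebra:
  assumes V: "continuous_on UNIV V" and p: "continuous_on UNIV p" "\<And>x. x \<in> msupp M \<Longrightarrow> p x = 0"
    and u: "\<And>x. u x = 2 / \<epsilon> * (a - V x - p x)"
  shows "b x * u x - kemb u M x = - Wop \<epsilon> c V b x - 2 / \<epsilon> * (b x * p x)"
proof -
  note M = calB_meas(1)[OF b]
  have "kemb p M x = 0"
    by (rule kemb_AE_zero[OF M p(1) AE_zero_off_msupp[OF cpt M p]])
  moreover have "kemb (\<lambda>_. a) M x = a * b x"
    using kemb_scale[of a "\<lambda>_. 1" M x] calB_kemb[OF b] by simp
  moreover have "kemb u M x = 2 / \<epsilon> * (kemb (\<lambda>_. a) M x - kemb V M x - kemb p M x)"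
    unfolding u[abs_def] kemb_scale
    by (simp add: kemb_diff M V p continuous_intros)
  ultimately have ku: "kemb u M x = 2 / \<epsilon> * (a * b x - kemb V M x)" by simp
  have Vs: "Vstar \<epsilon> c V b x = kemb V M x" by (simp add: Vstar_def kemb_def)
  show ?thesis using eps unfolding Wop_def Vs ku u[of x] by (simp add: field_simps)
qed

lemma static_equivalence:
  assumes V: "continuous_on UNIV V" and d: "continuous_on UNIV d" and d0: "(\<integral>x. d x \<partial>M) = 0"
    and g: "\<And>x. g x = (d x + kemb (\<lambda>x. d x / b x) M x) / b x"
  shows "(\<exists>u p. continuous_on UNIV u \<and> p \<in> Pset \<mu> \<and>
       (\<exists>a. \<forall>x. u x - K_mu \<epsilon> c \<mu> (K_mu \<epsilon> c \<mu> u) x = g x + a) \<and>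
       (\<exists>a. \<forall>x. \<epsilon> / 2 * u x + V x + p x = a)) \<longleftrightarrow>
     (\<exists>p\<in>Ptilde \<epsilon> c b. \<forall>x. d x + Wop \<epsilon> c V b x + p x = 0)" (is "?L \<longleftrightarrow> ?R")
proof -
  note M = calB_meas(1)[OF b]
  have KK: "b x * K_mu \<epsilon> c \<mu> (K_mu \<epsilon> c \<mu> u) x = kemb (\<lambda>x. kemb u M x / b x) M x"
    if "continuous_on UNIV u" for u x
    using b_nz by (simp add: K_mu_Binv[OF b] that cont_div_b kemb_continuous[OF M])
  have ci: "continuous_on UNIV (\<lambda>x. kemb u M x / b x)" if "continuous_on UNIV u" for u
    by (intro cont_div_b kemb_continuous[OF M] that)
  have k1: "kemb (\<lambda>_. t) M x = t * b x" for t x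
    using kemb_scale[of t "\<lambda>_. 1" M x] calB_kemb[OF b] by simp
  show ?thesis
  proof
    assume ?L
    then obtain u p a a' where u: "continuous_on UNIV u" and p: "p \<in> Pset \<mu>"
      and eq: "\<And>x. u x - K_mu \<epsilon> c \<mu> (K_mu \<epsilon> c \<mu> u) x = g x + a"
      and sum: "\<And>x. \<epsilon> / 2 * u x + V x + p x = a'" by blast
    have pc: "continuous_on UNIV p" "\<And>x. p x \<le> 0" "\<And>x. x \<in> msupp M \<Longrightarrow> p x = 0"
      using p unfolding Pset_def msupp_Binv[OF b] by auto
    have u_eq: "u x = 2 / \<epsilon> * (a' - V x - p x)" for x
      using sum[of x] eps by (simp add: field_simps)
    \<comment> \<open>The goal is that \<open>Id + K\<close> annihilates this function. The
      correction is \<open>a / 2\<close> because \<open>Id + K\<close> doubles constants and has to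
      produce \<open>a\<close>.\<close>
    let ?\<phi> = "\<lambda>x. u x - kemb u M x / b x - d x / b x - a / 2"
    have \<phi>c: "continuous_on UNIV ?\<phi>"
      by (intro continuous_intros u ci cont_div_b d)
    have b\<phi>: "b x * ?\<phi> x = b x * u x - kemb u M x - d x - a / 2 * b x" for x
      using b_nz[of x] by (simp add: field_simps)
    have "b x * ?\<phi> x + kemb ?\<phi> M x = 0" for x
    proof -
      have "kemb ?\<phi> M x = kemb u M x - kemb (\<lambda>x. kemb u M x / b x) M x
          - kemb (\<lambda>x. d x / b x) M x - a / 2 * b x"
        by (simp add: kemb_diff[OF M] u ci cont_div_b d continuous_intros k1)
      moreover note b\<phi>[of x]
      moreover have "b x * u x - kemb (\<lambda>x. kemb u M x / b x) M x
          = d x + kemb (\<lambda>x. d x / b x) M x + a * b x"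
      proof -
        have "b x * (u x - K_mu \<epsilon> c \<mu> (K_mu \<epsilon> c \<mu> u) x) = b x * (g x + a)" by (simp only: eq)
        moreover have "b x * g x = d x + kemb (\<lambda>x. d x / b x) M x" using b_nz[of x] by (simp add: g)
        ultimately show ?thesis using KK[OF u, of x] by (simp add: right_diff_distrib distrib_left mult.commute)
      qed
      ultimately show ?thesis by simp
    qed
    from one_plus_K_inj[OF \<phi>c this] have \<phi>0: "?\<phi> x = 0" for x .
    have deq: "d x = b x * u x - kemb u M x - a / 2 * b x" for x
      using b\<phi>[of x] unfolding \<phi>0 by simp
    \<comment> \<open>Integration isolates \<open>a\<close>: the contributions of \<open>u\<close>
      cancel by symmetry of the kernel, and \<open>b\<close> has integral 1.\<close>
    have "(\<integral>x. d x \<partial>M) = (\<integral>x. b x * u x \<partial>M) - (\<integral>x. kemb u M x \<partial>M) - a / 2 * (\<integral>x. b x \<partial>M)"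
      unfolding deq
      using integrable_radon[OF M continuous_on_mult[OF calB_cont[OF b] u]]
        integrable_radon[OF M kemb_continuous[OF M u]] integrable_radon[OF M calB_cont[OF b]]
      by simp
    moreover have "(\<integral>x. b x * u x \<partial>M) = (\<integral>x. kemb u M x \<partial>M)"
      using kemb_swap[OF M _ M u, of "\<lambda>_. 1"] by (simp add: calB_kemb[OF b])
    ultimately have "a = 0" using d0 calB_energy[OF b] by simp
    then have deq': "d x = - Wop \<epsilon> c V b x - 2 / \<epsilon> * (b x * p x)" for x
      using deq[of x] flow_step_algebra[OF V pc(1,3) u_eq, of x] by simp
    have "2 / \<epsilon> * (b x * p x) \<le> 0" for x
      using eps pc(2)[of x] calB_pos[OF b, of x] by (intro mult_nonneg_nonpos) (auto intro: less_imp_le)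
    moreover have "continuous_on UNIV (\<lambda>x. 2 / \<epsilon> * (b x * p x))"
      by (intro continuous_on_mult continuous_on_const pc(1) calB_cont[OF b])
    ultimately have "(\<lambda>x. 2 / \<epsilon> * (b x * p x)) \<in> Ptilde \<epsilon> c b"
      unfolding Ptilde_def using pc(3) by simp
    moreover note deq'
    ultimately show ?R by (intro bexI[of _ "\<lambda>x. 2 / \<epsilon> * (b x * p x)"]) auto
  next
    assume ?R
    then obtain q where q: "q \<in> Ptilde \<epsilon> c b" and eq: "\<And>x. d x + Wop \<epsilon> c V b x + q x = 0" by blast
    have qc: "continuous_on UNIV q" "\<And>x. q x \<le> 0" "\<And>x. x \<in> msupp M \<Longrightarrow> q x = 0"
      using q unfolding Ptilde_def by auto
    \<comment> \<open>Inverse of the passage from \<open>p\<close> to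
      \<open>2 / \<epsilon> * (b x * p x)\<close> in the other direction. The free constant in the
      representative \<open>u\<close> is chosen to be 0.\<close>
    define p where "p x = \<epsilon> / 2 * (q x / b x)" for x
    define u where "u x = 2 / \<epsilon> * (0 - V x - p x)" for x
    have pc: "continuous_on UNIV p" unfolding p_def by (intro continuous_intros cont_div_b qc)
    have uc: "continuous_on UNIV u" unfolding u_def by (intro continuous_intros V pc)
    have p0: "p x = 0" if "x \<in> msupp M" for x using qc(3)[OF that] by (simp add: p_def)
    have pP: "p \<in> Pset \<mu>"
      unfolding Pset_def msupp_Binv[OF b] using pc p0 eps qc(2) calB_pos[OF b]
      by (auto simp: p_def intro!: mult_nonneg_nonpos divide_nonpos_pos)
    have pq: "2 / \<epsilon> * (b x * p x) = q x" for x using eps b_nz[of x] by (simp add: p_def)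
    have deq: "d x = b x * u x - kemb u M x" for x
      using flow_step_algebra[OF V pc p0 u_def, of x] eq[of x] unfolding pq by linarith
    have "u x - K_mu \<epsilon> c \<mu> (K_mu \<epsilon> c \<mu> u) x = g x" for x
    proof -
      have "d y / b y = u y - kemb u M y / b y" for y
        unfolding deq using b_nz[of y] by (simp add: diff_divide_distrib)
      then have "kemb (\<lambda>x. d x / b x) M x = kemb u M x - kemb (\<lambda>x. kemb u M x / b x) M x"
        by (simp add: kemb_diff[OF M uc ci[OF uc]])
      then have "b x * g x = b x * u x - b x * K_mu \<epsilon> c \<mu> (K_mu \<epsilon> c \<mu> u) x"
        unfolding KK[OF uc] g using b_nz[of x] by (simp add: deq[of x])
      then have "b x * g x = b x * (u x - K_mu \<epsilon> c \<mu> (K_mu \<epsilon> c \<mu> u) x)" by (simp add: right_diff_distrib)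
      then show ?thesis using b_nz[of x] by simp
    qed
    moreover have "\<epsilon> / 2 * u x + V x + p x = 0" for x using eps by (simp add: u_def field_simps)
    ultimately show ?L using uc pP
      by (intro exI[of _ u] exI[of _ p] conjI exI[of _ 0]) auto
  qed
qed

end
end

section \<open>Differentiability almost everywhere of Sobolev curves\<close>

lemma (in pd_kernel) rkhs_norm_leI':
  assumes C: "C \<ge> 0" and le: "\<And>S a. finite S \<Longrightarrow> \<bar>\<Sum>x\<in>S. a x * g x\<bar> \<le> C * sqrt (kquad k S a)"
  shows "g \<in> H \<and> nm g \<le> C"
proof -
  have "g \<in> H \<and> (nm g)\<^sup>2 \<le> C\<^sup>2"
  proof (rule rkhs_norm_leI)
    fix S :: "'a set" and a assume S: "finite S"
    have "2 * (\<Sum>x\<in>S. a x * g x) \<le> 2 * (C * sqrt (kquad k S a))" using le[OF S, of a] by linarith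
    also have "\<dots> \<le> C\<^sup>2 + (sqrt (kquad k S a))\<^sup>2"
      using sum_squares_bound[of C "sqrt (kquad k S a)"] by linarith
    also have "\<dots> = C\<^sup>2 + kquad k S a" using kquad_nonneg[OF S] by simp
    finally show "2 * (\<Sum>x\<in>S. a x * g x) - kquad k S a \<le> C\<^sup>2" by simp
  qed
  then show ?thesis using C power2_le_imp_le by blast
qed

lemma compact_countable_dense:
  assumes "compact (UNIV :: 'a::metric_space set)"
  shows "\<exists>D :: 'a set. countable D \<and> (\<forall>x. \<forall>e>0. \<exists>y\<in>D. dist x y < e)"
proof -
  have "\<exists>D. finite D \<and> (UNIV::'a set) \<subseteq> (\<Union>x\<in>D. ball x (inverse (real (Suc n))))" for n
  proof -
    have "inverse (real (Suc n)) > 0" by simp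
    then show ?thesis using assms unfolding compact_eq_totally_bounded by blast
  qed
  then obtain D where D: "\<And>n. finite (D n)" "\<And>n. (UNIV::'a set) \<subseteq> (\<Union>x\<in>D n. ball x (inverse (real (Suc n))))"
    by metis
  show ?thesis
  proof (intro exI[of _ "\<Union>n. D n"] conjI allI impI)
    show "countable (\<Union>n. D n)" using D(1) by (simp add: countable_finite)
    fix x :: 'a and e :: real assume "e > 0"
    then obtain n where n: "inverse (real (Suc n)) < e" using reals_Archimedean by blast
    obtain y where "y \<in> D n" "dist y x < inverse (real (Suc n))" using D(2)[of n] by (auto simp: subset_iff)
    then show "\<exists>y\<in>\<Union>n. D n. dist x y < e" using n by (intro bexI[of _ y]) (auto simp: dist_commute intro: less_trans)
  qed
qed

lemma set_integrable_one: "set_integrable lborel {0..T::real} (\<lambda>_. 1 :: real)"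
  by (auto simp: set_integrable_def integrable_indicator_iff emeasure_lborel_Icc_eq)

lemma H1loc_withD:
  assumes "H1loc_with k b bd" "T \<ge> 0"
  shows "b T \<in> rkhs k" "bd T \<in> rkhs k" "set_integrable lborel {0..T} (\<lambda>s. (rkhs_norm k (bd s))\<^sup>2)"
    "set_integrable lborel {0..T} (\<lambda>s. bd s x)" "b T x = b 0 x + (\<integral>s\<in>{0..T}. bd s x \<partial>lborel)"
  using assms unfolding H1loc_with_def by blast+

context cpt_kernel begin

text \<open>Arzela-Ascoli: the norm bound gives a common modulus of continuity, and by compactness
  finitely many points of \<open>D\<close> control all others.\<close>

lemma bounded_pointwise_imp_uniform:
  assumes D: "\<And>x e. e > 0 \<Longrightarrow> \<exists>y\<in>D. dist x y < e"
    and bd: "eventually (\<lambda>s. d s \<in> H \<and> nm (d s) \<le> R) F"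
    and lim: "\<And>y. y \<in> D \<Longrightarrow> ((\<lambda>s. d s y) \<longlongrightarrow> 0) F"
    and e: "e > 0"
  shows "eventually (\<lambda>s. \<forall>x. \<bar>d s x\<bar> < e) F"
proof -
  have e2: "e / 2 > 0" using e by simp
  from rkhs_equicontinuous[OF e2, of R] obtain \<delta> where \<delta>: "\<delta> > 0"
    "\<forall>g x y. g \<in> H \<longrightarrow> nm g \<le> R \<longrightarrow> dist x y < \<delta> \<longrightarrow> \<bar>g x - g y\<bar> < e / 2"
    by (elim exE conjE)
  have "(UNIV :: 'a set) \<subseteq> (\<Union>y\<in>D. ball y \<delta>)"
  proof
    fix x :: 'a
    show "x \<in> (\<Union>y\<in>D. ball y \<delta>)" using D[OF \<delta>(1), of x] by (auto simp: dist_commute)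
  qed
  then obtain D' where D': "D' \<subseteq> D" "finite D'" "(UNIV :: 'a set) \<subseteq> (\<Union>y\<in>D'. ball y \<delta>)"
    using compactE_image[OF cpt, of D "\<lambda>y. ball y \<delta>"] by (metis open_ball)
  have "eventually (\<lambda>s. \<forall>y\<in>D'. \<bar>d s y\<bar> < e / 2) F"
  proof (rule eventually_ball_finite[OF D'(2)], intro ballI)
    fix y assume "y \<in> D'"
    then have "((\<lambda>s. d s y) \<longlongrightarrow> 0) F" using D'(1) lim by blast
    from tendstoD[OF this e2] show "eventually (\<lambda>s. \<bar>d s y\<bar> < e / 2) F" by (simp add: dist_real_def)
  qed
  with bd show ?thesis
  proof eventually_elim
    case (elim s)
    show ?case
    proof
      fix x
      have "x \<in> (\<Union>y\<in>D'. ball y \<delta>)" using D'(3) by blast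
      then obtain y where y: "y \<in> D'" "dist x y < \<delta>" by (auto simp: dist_commute)
      then have "\<bar>d s x - d s y\<bar> < e / 2" using \<delta>(2) elim by blast
      moreover have "\<bar>d s y\<bar> < e / 2" using elim y by blast
      ultimately show "\<bar>d s x\<bar> < e" by linarith
    qed
  qed
qed

text \<open>Against a kernel combination the inner product is a finite sum of point values; the norm
  bound makes the error of replacing \<psi> by a nearby combination uniform.\<close>

lemma bounded_pointwise_imp_weak:
  assumes bd: "eventually (\<lambda>s. d s \<in> H \<and> nm (d s) \<le> R) F"
    and lim: "\<And>y. ((\<lambda>s. d s y) \<longlongrightarrow> 0) F"
    and \<psi>: "\<psi> \<in> H"
  shows "((\<lambda>s. ip \<psi> (d s)) \<longlongrightarrow> 0) F"
proof (rule tendstoI)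
  fix e :: real assume e: "e > 0"
  define Q where "Q = \<bar>R\<bar> + 1"
  have Q: "Q > 0" "R \<le> Q" by (simp_all add: Q_def)
  then have "e / (2 * Q) > 0" using e by simp
  from kcomb_dense[OF \<psi> this] obtain S a where S: "finite S"
    and near: "nm (\<lambda>x. \<psi> x - kcomb k S a x) < e / (2 * Q)" by blast
  let ?c = "kcomb k S a"
  have c: "?c \<in> H" by (rule rkhs_kcomb_mem[OF S])
  have "((\<lambda>s. \<Sum>x\<in>S. a x * d s x) \<longlongrightarrow> (\<Sum>x\<in>S. a x * 0)) F"
    by (intro tendsto_sum tendsto_mult_left lim)
  then have "((\<lambda>s. \<Sum>x\<in>S. a x * d s x) \<longlongrightarrow> 0) F" by simp
  moreover have "e / 2 > 0" using e by simp
  ultimately have "eventually (\<lambda>s. dist (\<Sum>x\<in>S. a x * d s x) 0 < e / 2) F" by (rule tendstoD)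
  with bd show "eventually (\<lambda>s. dist (ip \<psi> (d s)) 0 < e) F"
  proof eventually_elim
    case (elim s)
    then have ds: "d s \<in> H" "nm (d s) \<le> R" by auto
    have "ip \<psi> (d s) = ip (\<lambda>x. \<psi> x - ?c x) (d s) + ip ?c (d s)"
      by (simp add: rkhs_inner_diff_left \<psi> c ds)
    moreover have "ip ?c (d s) = (\<Sum>x\<in>S. a x * d s x)"
      by (simp add: rkhs_inner_commute[OF c ds(1)] rkhs_inner_kcomb[OF ds(1) S])
    moreover have "\<bar>ip (\<lambda>x. \<psi> x - ?c x) (d s)\<bar> \<le> e / 2"
    proof -
      have "\<bar>ip (\<lambda>x. \<psi> x - ?c x) (d s)\<bar> \<le> nm (\<lambda>x. \<psi> x - ?c x) * nm (d s)"
        by (intro rkhs_Cauchy_Schwarz rkhs_diff_mem \<psi> c ds)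
      also have "\<dots> \<le> e / (2 * Q) * Q"
        using near ds rkhs_norm_nonneg[OF ds(1)] e Q by (intro mult_mono) auto
      also have "\<dots> = e / 2" using Q by simp
      finally show ?thesis .
    qed
    ultimately show ?case using elim by (simp add: dist_real_def)
  qed
qed

text \<open>Replaces the norm estimate for a vector-valued integral: tested on a finite combination,
  the increment is a scalar integral. The hypothesis concerns the squared norm, and
  \<open>1 + (nm (bd r))\<^sup>2\<close> dominates the norm because
  \<open>2 * x \<le> 1 + x\<^sup>2\<close>.\<close>

lemma H1loc_norm_increment:
  assumes H1: "H1loc_with k b bd" and m: "\<And>s. m s = (\<integral>r\<in>{0..s}. (1 + (nm (bd r))\<^sup>2) \<partial>lborel)"
    and s: "0 \<le> s" and t: "0 \<le> t"
  shows "nm (\<lambda>x. b s x - b t x) \<le> \<bar>m s - m t\<bar>"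
proof -
  have bH: "b t \<in> H" "bd t \<in> H" if "t \<ge> 0" for t
    using H1loc_withD[OF H1 that] by blast+
  have sq: "set_integrable lborel {0..T} (\<lambda>r. 1 + (nm (bd r))\<^sup>2)" if "T \<ge> 0" for T
    by (intro set_integral_add set_integrable_one H1loc_withD(3)[OF H1 that])
  have bi: "set_integrable lborel {0..T} (\<lambda>r. bd r x)"
    and beq: "b T x = b 0 x + (\<integral>r\<in>{0..T}. bd r x \<partial>lborel)" if "T \<ge> 0" for T x
    using H1loc_withD(4,5)[OF H1 that] by blast+
  have main: "nm (\<lambda>x. b v x - b u x) \<le> \<bar>m v - m u\<bar>" if u: "0 \<le> u" and uv: "u \<le> v" for u v
  proof -
    have v: "0 \<le> v" using u uv by simp
    let ?N = "\<lambda>r. 1 + (nm (bd r))\<^sup>2"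
    have Ni: "?N integrable_on {0..v}" by (rule set_borel_integral_eq_integral(1)[OF sq[OF v]])
    have Nuv: "?N integrable_on {u..v}" by (rule integrable_on_subinterval[OF Ni]) (use u in auto)
    have xi: "(\<lambda>r. bd r x) integrable_on {0..v}" for x by (rule set_borel_integral_eq_integral(1)[OF bi[OF v]])
    have xuv: "(\<lambda>r. bd r x) integrable_on {u..v}" for x by (rule integrable_on_subinterval[OF xi]) (use u in auto)
    have mI: "m v - m u = integral {u..v} ?N"
      using Henstock_Kurzweil_Integration.integral_combine[OF u uv Ni]
      unfolding m set_borel_integral_eq_integral(2)[OF sq[OF v]] set_borel_integral_eq_integral(2)[OF sq[OF u]]
      by simp
    have bI: "b v x - b u x = integral {u..v} (\<lambda>r. bd r x)" for x
      using Henstock_Kurzweil_Integration.integral_combine[OF u uv xi[of x]]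
      unfolding beq[OF v] beq[OF u] set_borel_integral_eq_integral(2)[OF bi[OF v]] set_borel_integral_eq_integral(2)[OF bi[OF u]]
      by simp
    have m0: "0 \<le> m v - m u" unfolding mI by (rule integral_nonneg[OF Nuv]) auto
    have "(\<lambda>x. b v x - b u x) \<in> H \<and> nm (\<lambda>x. b v x - b u x) \<le> m v - m u"
    proof (rule rkhs_norm_leI'[OF m0])
      fix S :: "'a set" and a assume S: "finite S"
      have i: "(\<lambda>r. \<Sum>x\<in>S. a x * bd r x) integrable_on {u..v}"
        by (intro integrable_sum S integrable_on_mult_right xuv)
      have "(\<Sum>x\<in>S. a x * (b v x - b u x)) = integral {u..v} (\<lambda>r. \<Sum>x\<in>S. a x * bd r x)"
        unfolding bI using S by (subst integral_sum) (auto intro: integrable_on_mult_right xuv)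
      also have "norm \<dots> \<le> integral {u..v} (\<lambda>r. ?N r * sqrt (kquad k S a))"
      proof (rule integral_norm_bound_integral[OF i integrable_on_mult_left[OF Nuv]])
        fix r assume "r \<in> {u..v}"
        then have r: "bd r \<in> H" using bH u by simp
        have "norm (\<Sum>x\<in>S. a x * bd r x) \<le> nm (bd r) * sqrt (kquad k S a)"
          using rkhs_eval_le[OF r S] by simp
        also have "\<dots> \<le> ?N r * sqrt (kquad k S a)"
        proof (rule mult_right_mono)
          show "nm (bd r) \<le> ?N r" using sum_squares_bound[of 1 "nm (bd r)"] rkhs_norm_nonneg[OF r] by simp
        qed (simp add: kquad_nonneg[OF S])
        finally show "norm (\<Sum>x\<in>S. a x * bd r x) \<le> ?N r * sqrt (kquad k S a)" .
      qed
      finally show "\<bar>\<Sum>x\<in>S. a x * (b v x - b u x)\<bar> \<le> (m v - m u) * sqrt (kquad k S a)"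
        by (simp add: mI)
    qed
    then show ?thesis by linarith
  qed
  show ?thesis
  proof (cases "t \<le> s")
    case True then show ?thesis using main[OF t] by blast
  next
    case False
    then have "nm (\<lambda>x. b t x - b s x) \<le> \<bar>m t - m s\<bar>" using main[OF s] by simp
    then show ?thesis using rkhs_norm_minus_commute[OF bH(1)[OF s] bH(1)[OF t]] by (simp add: abs_minus_commute)
  qed
qed

text \<open>The quotients need not converge in norm: bounded norms together with uniform and weak convergence
  suffice below, and follow from convergence on a countable dense set.\<close>

definition kernel_diff :: "(real \<Rightarrow> 'a \<Rightarrow> real) \<Rightarrow> ('a \<Rightarrow> real) \<Rightarrow> real \<Rightarrow> bool" where
  "kernel_diff b d t \<longleftrightarrow> d \<in> H \<and> (\<exists>R. eventually (\<lambda>s. nm (\<lambda>x. (b s x - b t x) / (s - t)) \<le> R) (at t within {0..})) \<and>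
     (\<forall>e>0. eventually (\<lambda>s. \<forall>x. \<bar>(b s x - b t x) / (s - t) - d x\<bar> < e) (at t within {0..})) \<and>
     (\<forall>\<psi>\<in>H. ((\<lambda>s. ip \<psi> (\<lambda>x. (b s x - b t x) / (s - t))) \<longlongrightarrow> ip \<psi> d) (at t within {0..}))"

lemma eventually_nonneg_within: "eventually (\<lambda>s. s \<ge> 0 \<and> s \<noteq> t) (at t within {0::real..})"
  by (auto simp: eventually_at_filter)

lemma H1loc_AE_kernel_diff:
  assumes H1: "H1loc_with k b bd"
  shows "AE t in lborel. t \<ge> 0 \<longrightarrow> kernel_diff b (bd t) t"
proof -
  obtain D :: "'a set" where D: "countable D" "\<And>x e. e > 0 \<Longrightarrow> \<exists>y\<in>D. dist x y < e"
    using compact_countable_dense[OF cpt] by blast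
  have bH: "b t \<in> H" "bd t \<in> H" if "t \<ge> 0" for t
    using H1loc_withD[OF H1 that] by blast+
  define m where "m s = (\<integral>r\<in>{0..s}. (1 + (nm (bd r))\<^sup>2) \<partial>lborel)" for s
  have sq: "set_integrable lborel {0..T} (\<lambda>r. 1 + (nm (bd r))\<^sup>2)" if "T \<ge> 0" for T
    by (intro set_integral_add set_integrable_one H1loc_withD(3)[OF H1 that])
  have AEm: "AE t in lborel. t \<ge> 0 \<longrightarrow> ((\<lambda>s. (m s - m t) / (s - t)) \<longlongrightarrow> 1 + (nm (bd t))\<^sup>2) (at t within {0..})"
    unfolding m_def by (rule AE_derivative_integral) (rule sq)
  have "AE t in lborel. t \<ge> 0 \<longrightarrow> ((\<lambda>s. (b s x - b t x) / (s - t)) \<longlongrightarrow> bd t x) (at t within {0..})" for x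
  proof -
    have bi: "set_integrable lborel {0..T} (\<lambda>r. bd r x)"
      and beq: "b T x = b 0 x + (\<integral>r\<in>{0..T}. bd r x \<partial>lborel)" if "T \<ge> 0" for T
      using H1loc_withD(4,5)[OF H1 that] by blast+
    have "AE t in lborel. t \<ge> 0 \<longrightarrow> ((\<lambda>s. ((\<integral>r\<in>{0..s}. bd r x \<partial>lborel) - (\<integral>r\<in>{0..t}. bd r x \<partial>lborel)) / (s - t)) \<longlongrightarrow> bd t x) (at t within {0..})"
      by (rule AE_derivative_integral) (rule bi)
    then show ?thesis
    proof eventually_elim
      case (elim t)
      show ?case
      proof
        assume t: "t \<ge> 0"
        with elim have l: "((\<lambda>s. ((\<integral>r\<in>{0..s}. bd r x \<partial>lborel) - (\<integral>r\<in>{0..t}. bd r x \<partial>lborel)) / (s - t)) \<longlongrightarrow> bd t x) (at t within {0..})" by blast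
        have "eventually (\<lambda>s. ((\<integral>r\<in>{0..s}. bd r x \<partial>lborel) - (\<integral>r\<in>{0..t}. bd r x \<partial>lborel)) / (s - t)
            = (b s x - b t x) / (s - t)) (at t within {0..})"
          using eventually_nonneg_within
        proof eventually_elim
          case (elim s)
          then show ?case using beq[of s] beq[OF t] by simp
        qed
        from Lim_transform_eventually[OF l this]
        show "((\<lambda>s. (b s x - b t x) / (s - t)) \<longlongrightarrow> bd t x) (at t within {0..})" .
      qed
    qed
  qed
  \<comment> \<open>The exceptional times depend on the point, and only countably many null sets can
    be discarded together. The remaining points are recovered by equicontinuity.\<close>
  then have "AE t in lborel. \<forall>x\<in>D. t \<ge> 0 \<longrightarrow> ((\<lambda>s. (b s x - b t x) / (s - t)) \<longlongrightarrow> bd t x) (at t within {0..})"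
    by (subst AE_ball_countable[OF D(1)]) blast
  with AEm show ?thesis
  proof eventually_elim
    case (elim t)
    show ?case
    proof
      assume t: "0 \<le> t"
      let ?F = "at t within {0..}"
      let ?q = "\<lambda>s x. (b s x - b t x) / (s - t)"
      let ?d = "\<lambda>s x. ?q s x - bd t x"
      \<comment> \<open>Any number above \<open>1 + (nm (bd t))\<^sup>2\<close>, the limit of the
        quotients of \<open>m\<close>, would do.\<close>
      let ?R = "2 + (nm (bd t))\<^sup>2"
      have mem: "?q s \<in> H" if "s \<ge> 0" for s
        using rkhs_scale_mem[OF rkhs_diff_mem[OF bH(1)[OF that] bH(1)[OF t]], of "1 / (s - t)"] by simp
      have lim: "((\<lambda>s. \<bar>(m s - m t) / (s - t)\<bar>) \<longlongrightarrow> \<bar>1 + (nm (bd t))\<^sup>2\<bar>) ?F"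
        using elim t by (intro tendsto_rabs) blast
      have "eventually (\<lambda>s. \<bar>(m s - m t) / (s - t)\<bar> < ?R) ?F"
        by (rule order_tendstoD(2)[OF lim]) simp
      then have qR: "eventually (\<lambda>s. nm (?q s) \<le> ?R) ?F"
        using eventually_nonneg_within
      proof eventually_elim
        case (elim s)
        then have s: "s \<ge> 0" "s \<noteq> t" by auto
        have "nm (?q s) = nm (\<lambda>x. b s x - b t x) / \<bar>s - t\<bar>"
          using rkhs_norm_scale[OF rkhs_diff_mem[OF bH(1)[OF s(1)] bH(1)[OF t]], of "1 / (s - t)"] by simp
        also have "\<dots> \<le> \<bar>m s - m t\<bar> / \<bar>s - t\<bar>"
          by (intro divide_right_mono H1loc_norm_increment[OF H1 m_def s(1) t]) simp
        also have "\<dots> = \<bar>(m s - m t) / (s - t)\<bar>" by simp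
        finally show ?case using elim by linarith
      qed
      have dR: "eventually (\<lambda>s. ?d s \<in> H \<and> nm (?d s) \<le> ?R + nm (bd t)) ?F"
        using qR eventually_nonneg_within
      proof eventually_elim
        case (elim s)
        have q: "?q s \<in> H" using mem elim by blast
        have "nm (?d s) \<le> nm (?q s) + nm (bd t)"
          using rkhs_norm_triangle[OF q rkhs_scale_mem[OF bH(2)[OF t], of "-1"]] rkhs_norm_scale[OF bH(2)[OF t], of "-1"] by simp
        then show ?case using elim rkhs_diff_mem[OF q bH(2)[OF t]] by simp
      qed
      have ptD: "((\<lambda>s. ?d s y) \<longlongrightarrow> 0) ?F" if "y \<in> D" for y
        using elim t that by (intro LIM_zero) blast
      have uni: "eventually (\<lambda>s. \<forall>x. \<bar>?d s x\<bar> < e) ?F" if "e > 0" for e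
        by (rule bounded_pointwise_imp_uniform[OF _ dR _ that]) (fact D(2), fact ptD)
      have pt: "((\<lambda>s. ?d s y) \<longlongrightarrow> 0) ?F" for y
      proof (rule tendstoI)
        fix e :: real assume "e > 0"
        from uni[OF this] show "eventually (\<lambda>s. dist (?d s y) 0 < e) ?F"
          by eventually_elim (simp add: dist_real_def)
      qed
      have weak: "((\<lambda>s. ip \<psi> (?q s)) \<longlongrightarrow> ip \<psi> (bd t)) ?F" if \<psi>: "\<psi> \<in> H" for \<psi>
      proof (rule LIM_zero_cancel, rule Lim_transform_eventually[OF bounded_pointwise_imp_weak[OF dR pt \<psi>]])
        show "eventually (\<lambda>s. ip \<psi> (?d s) = ip \<psi> (?q s) - ip \<psi> (bd t)) ?F"
          using eventually_nonneg_within by eventually_elim (simp add: rkhs_inner_diff_right \<psi> mem bH t)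
      qed
      show "kernel_diff b (bd t) t"
        unfolding kernel_diff_def using bH(2)[OF t] qR uni weak by blast
    qed
  qed
qed

end

section \<open>The weak-* derivative of the curve of measures\<close>

context sinkhorn begin

context
  fixes b :: "real \<Rightarrow> 'a \<Rightarrow> real" and t :: real and d :: "'a \<Rightarrow> real"
  assumes bB: "\<And>s. s \<ge> 0 \<Longrightarrow> b s \<in> calB \<epsilon> c" and t: "t \<ge> 0" and sd: "kernel_diff b d t"
begin

abbreviation "Ft \<equiv> at t within {0..}"

lemma d_mem: "d \<in> H" using sd unfolding kernel_diff_def by blast

lemma Ft_nontrivial: "Ft \<noteq> bot"
proof -
  have "at_right t \<le> Ft" using t by (intro at_le) auto
  then show ?thesis using trivial_limit_at_right_real[of t] by (metis bot.extremum_uniqueI)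
qed

lemma quot_mem: "s \<ge> 0 \<Longrightarrow> (\<lambda>x. (b s x - b t x) / (s - t)) \<in> H"
  using rkhs_scale_mem[OF rkhs_diff_mem[OF calB_mem[OF bB] calB_mem[OF bB[OF t]]], of s "1 / (s - t)"] by simp

lemma increment_bound:
  obtains R where "R \<ge> 0"
    "eventually (\<lambda>s. s \<ge> 0 \<and> s \<noteq> t \<and> nm (\<lambda>x. b s x - b t x) \<le> R * \<bar>s - t\<bar>) Ft"
proof -
  obtain R where "eventually (\<lambda>s. nm (\<lambda>x. (b s x - b t x) / (s - t)) \<le> R) Ft"
    using sd unfolding kernel_diff_def by blast
  then have "eventually (\<lambda>s. s \<ge> 0 \<and> s \<noteq> t \<and> nm (\<lambda>x. b s x - b t x) \<le> \<bar>R\<bar> * \<bar>s - t\<bar>) Ft"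
    using eventually_nonneg_within
  proof eventually_elim
    case (elim s)
    have "nm (\<lambda>x. b s x - b t x) = \<bar>s - t\<bar> * nm (\<lambda>x. (b s x - b t x) / (s - t))"
      using rkhs_norm_scale[OF quot_mem, of s "s - t"] elim by simp
    also have "\<dots> \<le> \<bar>s - t\<bar> * \<bar>R\<bar>" using elim by (intro mult_left_mono) auto
    finally show ?case using elim by (simp add: mult.commute)
  qed
  then show ?thesis using that[of "\<bar>R\<bar>"] by simp
qed

lemma abs_diff_tendsto_0: "((\<lambda>s. C * \<bar>s - t\<bar>) \<longlongrightarrow> 0) Ft"
proof -
  have "((\<lambda>s. C * \<bar>s - t\<bar>) \<longlongrightarrow> C * \<bar>t - t\<bar>) Ft" by (intro tendsto_intros)
  then show ?thesis by simp
qed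

text \<open>On the unit sphere the component of an increment along \<open>b t\<close> is minus half
  the squared norm of the increment. With bounded quotients this is of second order in
  \<open>s - t\<close>.\<close>

lemma inner_d_b: "ip d (b t) = 0"
proof -
  have bt: "b t \<in> H" by (rule calB_mem[OF bB[OF t]])
  obtain R where R: "R \<ge> 0"
    "eventually (\<lambda>s. s \<ge> 0 \<and> s \<noteq> t \<and> nm (\<lambda>x. b s x - b t x) \<le> R * \<bar>s - t\<bar>) Ft"
    using increment_bound by blast
  have "((\<lambda>s. ip (b t) (\<lambda>x. (b s x - b t x) / (s - t))) \<longlongrightarrow> 0) Ft"
  proof (rule Lim_null_comparison[OF _ abs_diff_tendsto_0])
    show "eventually (\<lambda>s. norm (ip (b t) (\<lambda>x. (b s x - b t x) / (s - t))) \<le> (R\<^sup>2 / 2) * \<bar>s - t\<bar>) Ft"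
      using R(2)
    proof eventually_elim
      case (elim s)
      then have s: "s \<ge> 0" "s \<noteq> t" by auto
      have bs: "b s \<in> H" by (rule calB_mem[OF bB[OF s(1)]])
      let ?i = "\<lambda>x. b s x - b t x"
      have i: "?i \<in> H" by (rule rkhs_diff_mem[OF bs bt])
      have n1: "ip (b s) (b s) = 1" "ip (b t) (b t) = 1"
        using rkhs_inner_self[OF bs] rkhs_inner_self[OF bt] calB_norm[OF bB[OF s(1)]] calB_norm[OF bB[OF t]] by simp_all
      have "(nm ?i)\<^sup>2 = ip (b s) (b s) - 2 * ip (b t) (b s) + ip (b t) (b t)"
        unfolding rkhs_inner_self[OF i, symmetric]
        by (simp add: rkhs_inner_diff_left[OF bs bt i] rkhs_inner_diff_right bs bt rkhs_inner_commute[OF bs bt])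
      moreover have "ip (b t) ?i = ip (b t) (b s) - ip (b t) (b t)"
        by (rule rkhs_inner_diff_right[OF bt bs bt])
      ultimately have ii: "ip (b t) ?i = - (nm ?i)\<^sup>2 / 2" using n1 by simp
      have "ip (b t) (\<lambda>x. (b s x - b t x) / (s - t)) = ip (b t) ?i / (s - t)"
        using rkhs_inner_scale_right[OF bt i, of "1 / (s - t)"] by simp
      then have "norm (ip (b t) (\<lambda>x. (b s x - b t x) / (s - t))) = \<bar>ip (b t) ?i\<bar> / \<bar>s - t\<bar>" by simp
      also have "\<dots> = (nm ?i)\<^sup>2 / 2 / \<bar>s - t\<bar>" unfolding ii by simp
      also have "\<dots> \<le> (R * \<bar>s - t\<bar>)\<^sup>2 / 2 / \<bar>s - t\<bar>"
        using elim rkhs_norm_nonneg[OF i] by (intro divide_right_mono power_mono) auto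
      also have "\<dots> = (R\<^sup>2 / 2) * \<bar>s - t\<bar>"
        using s(2) by (simp add: power2_eq_square field_simps)
      finally show ?case .
    qed
  qed
  moreover have "((\<lambda>s. ip (b t) (\<lambda>x. (b s x - b t x) / (s - t))) \<longlongrightarrow> ip (b t) d) Ft"
    using sd bt unfolding kernel_diff_def by blast
  ultimately have "ip (b t) d = 0" using tendsto_unique[OF Ft_nontrivial] by blast
  then show ?thesis using rkhs_inner_commute[OF d_mem bt] by simp
qed

lemma integral_d: "(\<integral>x. d x \<partial>meas_of (b t)) = 0"
  using calB_inner[OF bB[OF t] d_mem] inner_d_b by simp

lemma calB_integral_bound:
  assumes "a \<in> calB \<epsilon> c" "measure (meas_of a) UNIV \<le> C" "continuous_on UNIV f" "\<And>x. \<bar>f x\<bar> \<le> B"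
  shows "\<bar>\<integral>x. f x \<partial>meas_of a\<bar> \<le> B * C"
proof -
  note M = calB_meas(1)[OF assms(1)]
  interpret finite_measure "meas_of a" using M by (simp add: pos_radon_def)
  have sp: "space (meas_of a) = UNIV" using M sets_eq_imp_space_eq[of "meas_of a" borel] by (simp add: pos_radon_def)
  have B: "0 \<le> B" using assms(4) abs_ge_zero order_trans by blast
  have "\<bar>\<integral>x. f x \<partial>meas_of a\<bar> \<le> (\<integral>x. \<bar>f x\<bar> \<partial>meas_of a)" by (rule integral_abs_bound)
  also have "\<dots> \<le> (\<integral>x. B \<partial>meas_of a)"
    using integrable_radon[OF M assms(3)] assms(4) by (intro integral_mono) auto
  also have "\<dots> = B * measure (meas_of a) UNIV" by (simp add: sp)
  also have "\<dots> \<le> B * C" by (rule mult_left_mono[OF assms(2) B])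
  finally show ?thesis .
qed

text \<open>For test functions in \<open>H\<close> the integral is an inner product with
  \<open>b s\<close>, hence continuous in \<open>s\<close>. Universality together with the uniform
  mass bound extends this to all continuous functions.\<close>

lemma meas_of_weak_tendsto:
  assumes f: "continuous_on UNIV (f :: 'a \<Rightarrow> real)"
  shows "((\<lambda>s. \<integral>x. f x \<partial>meas_of (b s)) \<longlongrightarrow> (\<integral>x. f x \<partial>meas_of (b t))) Ft"
proof (rule tendstoI)
  fix e :: real assume e: "e > 0"
  obtain C where C: "C > 0" "\<And>a. a \<in> calB \<epsilon> c \<Longrightarrow> measure (meas_of a) UNIV \<le> C"
    using calB_mass_bound by blast
  have "e / (3 * C) > 0" using e C by simp
  then obtain g where g: "g \<in> H" "\<And>x. \<bar>f x - g x\<bar> < e / (3 * C)"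
    using kc_univ f unfolding universal_kernel_def by blast
  have gc: "continuous_on UNIV g" by (rule rkhs_continuous[OF g(1)])
  have near: "\<bar>(\<integral>x. f x \<partial>meas_of a) - (\<integral>x. g x \<partial>meas_of a)\<bar> \<le> e / 3" if a: "a \<in> calB \<epsilon> c" for a
  proof -
    note M = calB_meas(1)[OF a]
    have "\<bar>\<integral>x. f x - g x \<partial>meas_of a\<bar> \<le> e / (3 * C) * C"
      by (rule calB_integral_bound[OF a C(2)[OF a]]) (use g f gc in \<open>auto intro!: continuous_intros less_imp_le\<close>)
    then show ?thesis
      using integrable_radon[OF M f] integrable_radon[OF M gc] C(1) by simp
  qed
  obtain R where R: "R \<ge> 0"
    "eventually (\<lambda>s. s \<ge> 0 \<and> s \<noteq> t \<and> nm (\<lambda>x. b s x - b t x) \<le> R * \<bar>s - t\<bar>) Ft"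
    using increment_bound by blast
  have "e / 3 > 0" using e by simp
  from tendstoD[OF abs_diff_tendsto_0[of "nm g * R"] this] R(2)
  show "eventually (\<lambda>s. dist (\<integral>x. f x \<partial>meas_of (b s)) (\<integral>x. f x \<partial>meas_of (b t)) < e) Ft"
  proof eventually_elim
    case (elim s)
    then have s: "b s \<in> calB \<epsilon> c" using bB by blast
    note bt = bB[OF t]
    let ?i = "\<lambda>x. b s x - b t x"
    have i: "?i \<in> H" by (rule rkhs_diff_mem[OF calB_mem[OF s] calB_mem[OF bt]])
    have "(\<integral>x. g x \<partial>meas_of (b s)) - (\<integral>x. g x \<partial>meas_of (b t)) = ip g ?i"
      using rkhs_inner_diff_right[OF g(1) calB_mem[OF s] calB_mem[OF bt]]
      by (simp add: calB_inner[OF s g(1)] calB_inner[OF bt g(1)])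
    also have "\<bar>\<dots>\<bar> \<le> nm g * nm ?i" by (rule rkhs_Cauchy_Schwarz[OF g(1) i])
    also have "\<dots> \<le> nm g * (R * \<bar>s - t\<bar>)"
      using elim by (intro mult_left_mono rkhs_norm_nonneg[OF g(1)]) auto
    also have "\<dots> \<le> dist (nm g * R * \<bar>s - t\<bar>) 0" unfolding dist_real_def mult.assoc by linarith
    also have "\<dots> < e / 3" using elim by blast
    finally show ?case using near[OF s] near[OF bt] unfolding dist_real_def abs_less_iff abs_le_iff by auto
  qed
qed

text \<open>A product rule for \<open>b s\<close> times \<open>meas_of (b s)\<close>. The increment
  of the density is integrated against the measure at time \<open>s\<close>, so that the increment
  of the measure meets only \<psi> and becomes an inner product, where weak convergence applies. The
  other term needs uniform convergence of the quotients and weak convergence of the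
  measures.\<close>

lemma dmu_tendsto:
  assumes \<psi>: "\<psi> \<in> H" and h: "\<And>x. h x = \<psi> x / b t x"
  shows "((\<lambda>s. ((\<integral>x. h x \<partial>Binv \<epsilon> c (b s)) - (\<integral>x. h x \<partial>Binv \<epsilon> c (b t))) / (s - t))
     \<longlongrightarrow> ip \<psi> d + (\<integral>x. d x * h x \<partial>meas_of (b t))) Ft"
proof -
  note bt = bB[OF t]
  have \<psi>c: "continuous_on UNIV \<psi>" by (rule rkhs_continuous[OF \<psi>])
  have dc: "continuous_on UNIV d" by (rule rkhs_continuous[OF d_mem])
  have hc: "continuous_on UNIV h" unfolding h[abs_def] by (rule cont_div_b[OF bt \<psi>c])
  have bh: "b t x * h x = \<psi> x" for x using b_nz[OF bt, of x] by (simp add: h)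
  obtain C where C: "C > 0" "\<And>a. a \<in> calB \<epsilon> c \<Longrightarrow> measure (meas_of a) UNIV \<le> C"
    using calB_mass_bound by blast
  obtain B where B: "B > 0" "\<And>x. \<bar>h x\<bar> \<le> B" using continuous_bounded_UNIV[OF cpt hc] by blast
  let ?q = "\<lambda>s x. (b s x - b t x) / (s - t)"
  have split: "eventually (\<lambda>s. ip \<psi> (?q s) + ((\<integral>x. (?q s x - d x) * h x \<partial>meas_of (b s)) + (\<integral>x. d x * h x \<partial>meas_of (b s)))
     = ((\<integral>x. h x \<partial>Binv \<epsilon> c (b s)) - (\<integral>x. h x \<partial>Binv \<epsilon> c (b t))) / (s - t)) Ft"
    using eventually_nonneg_within
  proof eventually_elim
    case (elim s)
    then have s: "b s \<in> calB \<epsilon> c" "s \<noteq> t" using bB by auto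
    note M = calB_meas(1)[OF s(1)]
    have bsc: "continuous_on UNIV (b s)" by (rule calB_cont[OF s(1)])
    have qc: "continuous_on UNIV (?q s)" by (rule rkhs_continuous[OF quot_mem]) (use elim in simp)
    have i: "integrable (meas_of (b s)) (\<lambda>x. ?q s x * h x)" "integrable (meas_of (b s)) (\<lambda>x. d x * h x)"
      "integrable (meas_of (b s)) (\<lambda>x. (b s x - b t x) * h x)" "integrable (meas_of (b s)) \<psi>"
      by (intro integrable_radon[OF M] continuous_on_mult continuous_on_diff qc dc hc bsc calB_cont[OF bt] \<psi>c)+
    have "(\<integral>x. h x \<partial>Binv \<epsilon> c (b s)) = (\<integral>x. (b s x - b t x) * h x + \<psi> x \<partial>meas_of (b s))"
      unfolding integral_Binv[OF s(1) hc] bh[symmetric] by (simp add: left_diff_distrib)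
    also have "\<dots> = (\<integral>x. (b s x - b t x) * h x \<partial>meas_of (b s)) + (\<integral>x. \<psi> x \<partial>meas_of (b s))"
      using i by simp
    also have "(\<integral>x. (b s x - b t x) * h x \<partial>meas_of (b s)) = (\<integral>x. (s - t) * (?q s x * h x) \<partial>meas_of (b s))"
      using s(2) by simp
    also have "\<dots> = (s - t) * (\<integral>x. ?q s x * h x \<partial>meas_of (b s))" using i by simp
    finally have 1: "(\<integral>x. h x \<partial>Binv \<epsilon> c (b s)) = (s - t) * (\<integral>x. ?q s x * h x \<partial>meas_of (b s)) + ip \<psi> (b s)"
      by (simp add: calB_inner[OF s(1) \<psi>])
    have 2: "(\<integral>x. h x \<partial>Binv \<epsilon> c (b t)) = ip \<psi> (b t)"
      unfolding integral_Binv[OF bt hc] bh by (simp add: calB_inner[OF bt \<psi>])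
    have 3: "ip \<psi> (?q s) = (ip \<psi> (b s) - ip \<psi> (b t)) / (s - t)"
      using rkhs_inner_scale_right[OF \<psi> rkhs_diff_mem[OF calB_mem[OF s(1)] calB_mem[OF bt]], of "1 / (s - t)"]
      by (simp add: rkhs_inner_diff_right[OF \<psi> calB_mem[OF s(1)] calB_mem[OF bt]])
    have 4: "(\<integral>x. (?q s x - d x) * h x \<partial>meas_of (b s)) + (\<integral>x. d x * h x \<partial>meas_of (b s)) = (\<integral>x. ?q s x * h x \<partial>meas_of (b s))"
      using i by (simp only: left_diff_distrib Bochner_Integration.integral_diff)
    have alg: "(v - w) / (s - t) + u = ((s - t) * u + v - w) / (s - t)" for u v w :: real
      using s(2) by (simp add: field_simps)
    show ?case unfolding 1 2 3 4 by (rule alg)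
  qed
  have small: "((\<lambda>s. \<integral>x. (?q s x - d x) * h x \<partial>meas_of (b s)) \<longlongrightarrow> 0) Ft"
  proof (rule tendstoI)
    fix e :: real assume e: "e > 0"
    let ?e = "e / (2 * (B * C))"
    have "?e > 0" using e B C by simp
    then have "eventually (\<lambda>s. \<forall>x. \<bar>?q s x - d x\<bar> < ?e) Ft" using sd unfolding kernel_diff_def by blast
    then show "eventually (\<lambda>s. dist (\<integral>x. (?q s x - d x) * h x \<partial>meas_of (b s)) 0 < e) Ft"
      using eventually_nonneg_within
    proof eventually_elim
      case (elim s)
      then have s: "b s \<in> calB \<epsilon> c" using bB by auto
      have qc: "continuous_on UNIV (?q s)" by (rule rkhs_continuous[OF quot_mem]) (use elim in simp)
      have "\<bar>(?q s x - d x) * h x\<bar> \<le> ?e * B" for x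
        unfolding abs_mult using elim B by (intro mult_mono) (auto intro: less_imp_le)
      then have "\<bar>\<integral>x. (?q s x - d x) * h x \<partial>meas_of (b s)\<bar> \<le> ?e * B * C"
        by (intro calB_integral_bound[OF s C(2)[OF s]] continuous_on_mult continuous_on_diff qc dc hc)
      also have "\<dots> = e / 2" using B C by simp
      finally show ?case using e by (simp add: dist_real_def)
    qed
  qed
  have ipl: "((\<lambda>s. ip \<psi> (?q s)) \<longlongrightarrow> ip \<psi> d) Ft" using sd \<psi> unfolding kernel_diff_def by blast
  have "((\<lambda>s. ip \<psi> (?q s) + ((\<integral>x. (?q s x - d x) * h x \<partial>meas_of (b s)) + (\<integral>x. d x * h x \<partial>meas_of (b s))))
     \<longlongrightarrow> ip \<psi> d + (0 + (\<integral>x. d x * h x \<partial>meas_of (b t)))) Ft"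
    by (intro tendsto_add ipl small meas_of_weak_tendsto continuous_on_mult dc hc)
  from Lim_transform_eventually[OF this split] show ?thesis by simp
qed

text \<open>Multiplication by \<open>b t\<close> moves the definition into \<open>H\<close>, where
  the constant function 1 becomes \<open>b t\<close>. Tangency is then automatic from the unit norm
  constraint, and limits against all of \<open>H\<close> determine \<open>g\<close>.\<close>

lemma weak_star_deriv_iff:
  "weak_star_deriv \<epsilon> c (\<lambda>s. Binv \<epsilon> c (b s)) t g
     \<longleftrightarrow> (\<forall>x. g x = (d x + kemb (\<lambda>x. d x / b t x) (meas_of (b t)) x) / b t x)"
proof -
  note bt = bB[OF t]
  note M = calB_meas(1)[OF bt]
  let ?G = "\<lambda>x. d x + kemb (\<lambda>x. d x / b t x) (meas_of (b t)) x"
  have dc: "continuous_on UNIV (\<lambda>x. d x / b t x)" by (intro cont_div_b[OF bt] rkhs_continuous[OF d_mem])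
  have kH: "kemb (\<lambda>x. d x / b t x) (meas_of (b t)) \<in> H" by (rule kemb_mem[OF M dc])
  have G: "?G \<in> H" by (rule rkhs_add_mem[OF d_mem kH])
  have Gip: "ip ?G \<psi> = ip \<psi> d + (\<integral>x. \<psi> x * (d x / b t x) \<partial>meas_of (b t))" if \<psi>: "\<psi> \<in> H" for \<psi>
    using rkhs_inner_add_right[OF \<psi> d_mem kH] kemb_inner[OF M dc \<psi>] rkhs_inner_commute[OF \<psi> G] by simp
  have nz: "b t x \<noteq> 0" for x by (rule b_nz[OF bt])
  note resc = rkhs_rescale[where w = "b t" and k = k, OF calB_pos[OF bt]]
  have wiff: "weak_star_deriv \<epsilon> c (\<lambda>s. Binv \<epsilon> c (b s)) t g \<longleftrightarrow>
      (\<lambda>x. b t x * g x) \<in> H \<and> ip (\<lambda>x. b t x * g x) (b t) = 0 \<and>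
      (\<forall>h. (\<lambda>x. b t x * h x) \<in> H \<longrightarrow> ((\<lambda>s. ((\<integral>x. h x \<partial>Binv \<epsilon> c (b s)) - (\<integral>x. h x \<partial>Binv \<epsilon> c (b t))) / (s - t))
           \<longlongrightarrow> ip (\<lambda>x. b t x * g x) (\<lambda>x. b t x * h x)) Ft)" for g
    unfolding weak_star_deriv_def k_mu_Binv[OF bt] Ball_def resc by simp
  have lim: "((\<lambda>s. ((\<integral>x. h x \<partial>Binv \<epsilon> c (b s)) - (\<integral>x. h x \<partial>Binv \<epsilon> c (b t))) / (s - t))
           \<longlongrightarrow> ip ?G (\<lambda>x. b t x * h x)) Ft" if "(\<lambda>x. b t x * h x) \<in> H" for h
  proof -
    have "h x = b t x * h x / b t x" for x using nz by simp
    from dmu_tendsto[OF that this]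
    have "((\<lambda>s. ((\<integral>x. h x \<partial>Binv \<epsilon> c (b s)) - (\<integral>x. h x \<partial>Binv \<epsilon> c (b t))) / (s - t))
      \<longlongrightarrow> ip (\<lambda>x. b t x * h x) d + (\<integral>x. d x * h x \<partial>meas_of (b t))) Ft" .
    moreover have "(\<integral>x. b t x * h x * (d x / b t x) \<partial>meas_of (b t)) = (\<integral>x. d x * h x \<partial>meas_of (b t))"
      using nz by (intro Bochner_Integration.integral_cong) auto
    ultimately show ?thesis using Gip[OF that] by simp
  qed
  have Gb: "ip ?G (b t) = 0"
  proof -
    have "(\<integral>x. b t x * (d x / b t x) \<partial>meas_of (b t)) = (\<integral>x. d x \<partial>meas_of (b t))"
      using nz by (intro Bochner_Integration.integral_cong) auto
    then show ?thesis
      using Gip[OF calB_mem[OF bt]] integral_d inner_d_b rkhs_inner_commute[OF d_mem calB_mem[OF bt]] by simp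
  qed
  show ?thesis
  proof
    assume w: "weak_star_deriv \<epsilon> c (\<lambda>s. Binv \<epsilon> c (b s)) t g"
    then have gH: "(\<lambda>x. b t x * g x) \<in> H" unfolding wiff by blast
    have "(\<lambda>x. b t x * g x) = ?G"
    proof (rule rkhs_inner_eq_imp_eq[OF gH G])
      fix \<psi> assume \<psi>: "\<psi> \<in> H"
      let ?h = "\<lambda>x. \<psi> x / b t x"
      have e: "(\<lambda>x. b t x * ?h x) = \<psi>" using nz by auto
      have hH: "(\<lambda>x. b t x * ?h x) \<in> H" using \<psi> unfolding e .
      have "((\<lambda>s. ((\<integral>x. ?h x \<partial>Binv \<epsilon> c (b s)) - (\<integral>x. ?h x \<partial>Binv \<epsilon> c (b t))) / (s - t))
           \<longlongrightarrow> ip (\<lambda>x. b t x * g x) (\<lambda>x. b t x * ?h x)) Ft"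
        by (rule w[unfolded wiff, THEN conjunct2, THEN conjunct2, rule_format, of ?h, OF hH])
      from tendsto_unique[OF Ft_nontrivial this lim[OF hH]]
      show "ip (\<lambda>x. b t x * g x) \<psi> = ip ?G \<psi>" unfolding e .
    qed
    then show "\<forall>x. g x = ?G x / b t x" using nz by (simp add: fun_eq_iff field_simps)
  next
    assume "\<forall>x. g x = ?G x / b t x"
    then have "(\<lambda>x. b t x * g x) = ?G" using nz by (simp add: fun_eq_iff)
    then show "weak_star_deriv \<epsilon> c (\<lambda>s. Binv \<epsilon> c (b s)) t g"
      unfolding wiff using G Gb lim by simp
  qed
qed

lemma flow_inclusion_iff:
  assumes V: "continuous_on UNIV V"
  shows "(\<exists>g u p. weak_star_deriv \<epsilon> c (\<lambda>s. Binv \<epsilon> c (b s)) t g \<and> continuous_on UNIV u \<and> p \<in> Pset (Binv \<epsilon> c (b t)) \<and>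
       (\<exists>a. \<forall>x. u x - K_mu \<epsilon> c (Binv \<epsilon> c (b t)) (K_mu \<epsilon> c (Binv \<epsilon> c (b t)) u) x = g x + a) \<and>
       (\<exists>a. \<forall>x. \<epsilon> / 2 * u x + V x + p x = a)) \<longleftrightarrow>
     (\<exists>p\<in>Ptilde \<epsilon> c (b t). \<forall>x. d x + Wop \<epsilon> c V (b t) x + p x = 0)"
proof -
  let ?g = "\<lambda>x. (d x + kemb (\<lambda>x. d x / b t x) (meas_of (b t)) x) / b t x"
  have "weak_star_deriv \<epsilon> c (\<lambda>s. Binv \<epsilon> c (b s)) t g \<longleftrightarrow> g = ?g" for g
    unfolding weak_star_deriv_iff by auto
  then show ?thesis
    using static_equivalence[OF bB[OF t] V rkhs_continuous[OF d_mem] integral_d, of ?g] by simp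
qed

end

lemma Binv_inj: "a \<in> calB \<epsilon> c \<Longrightarrow> b \<in> calB \<epsilon> c \<Longrightarrow> Binv \<epsilon> c a = Binv \<epsilon> c b \<Longrightarrow> a = b"
  using Bmap_Binv by metis

lemma flow_characterization:
  assumes V: "continuous_on UNIV V" and bB: "\<And>t. t \<ge> 0 \<Longrightarrow> b t \<in> calB \<epsilon> c" and b0: "b0 \<in> calB \<epsilon> c"
  shows "sinkhorn_flow_B \<epsilon> c V b b0 \<longleftrightarrow>
    (\<exists>bd. H1loc_with k b bd \<and> b 0 = b0 \<and>
       (AE t in lborel. t \<ge> 0 \<longrightarrow>
          (\<exists>p\<in>Ptilde \<epsilon> c (b t). \<forall>x. bd t x + Wop \<epsilon> c V (b t) x + p x = 0)))"
proof -
  have H1eq: "H1loc_with k (\<lambda>t. Bmap \<epsilon> c (Binv \<epsilon> c (b t))) bd \<longleftrightarrow> H1loc_with k b bd" for bd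
    unfolding H1loc_with_def by (simp add: Bmap_Binv bB)
  have adm: "admissible \<epsilon> c (\<lambda>t. Binv \<epsilon> c (b t)) \<longleftrightarrow> (\<exists>bd. H1loc_with k b bd)"
    unfolding admissible_def H1loc_def H1eq by (simp add: prob_radon_Binv bB)
  have init: "Binv \<epsilon> c (b 0) = Binv \<epsilon> c b0 \<longleftrightarrow> b 0 = b0"
    using Binv_inj[OF bB b0, of 0] by auto
  let ?P = "\<lambda>t. \<exists>g u p. weak_star_deriv \<epsilon> c (\<lambda>s. Binv \<epsilon> c (b s)) t g \<and> continuous_on UNIV u \<and> p \<in> Pset (Binv \<epsilon> c (b t)) \<and>
       (\<exists>a. \<forall>x. u x - K_mu \<epsilon> c (Binv \<epsilon> c (b t)) (K_mu \<epsilon> c (Binv \<epsilon> c (b t)) u) x = g x + a) \<and>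
       (\<exists>a. \<forall>x. \<epsilon> / 2 * u x + V x + p x = a)"
  let ?Q = "\<lambda>d t. \<exists>p\<in>Ptilde \<epsilon> c (b t). \<forall>x. d x + Wop \<epsilon> c V (b t) x + p x = 0"
  \<comment> \<open>Stated for an arbitrary derivative \<open>bd\<close>: the left side does not
    mention it, so any witness of admissibility serves in the existential on the right.\<close>
  have equiv: "(AE t in lborel. t \<ge> 0 \<longrightarrow> ?P t) \<longleftrightarrow> (AE t in lborel. t \<ge> 0 \<longrightarrow> ?Q (bd t) t)"
    if H1: "H1loc_with k b bd" for bd
  proof -
    have "AE t in lborel. (t \<ge> 0 \<longrightarrow> ?P t) \<longleftrightarrow> (t \<ge> 0 \<longrightarrow> ?Q (bd t) t)"
      using H1loc_AE_kernel_diff[OF H1]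
    proof eventually_elim
      case (elim t)
      show ?case
      proof (cases "t \<ge> 0")
        case True
        with elim have "kernel_diff b (bd t) t" by blast
        from flow_inclusion_iff[OF bB True this V] show ?thesis by blast
      qed simp
    qed
    then show ?thesis by (rule eventually_subst)
  qed
  have "sinkhorn_flow_B \<epsilon> c V b b0 \<longleftrightarrow>
      (\<exists>bd. H1loc_with k b bd) \<and> b 0 = b0 \<and> (AE t in lborel. t \<ge> 0 \<longrightarrow> ?P t)"
    unfolding sinkhorn_flow_B_def sinkhorn_flow_def adm init using bB by simp
  also have "\<dots> \<longleftrightarrow> (\<exists>bd. H1loc_with k b bd \<and> b 0 = b0 \<and> (AE t in lborel. t \<ge> 0 \<longrightarrow> ?Q (bd t) t))"
    using equiv by blast
  finally show ?thesis .
qed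

end

theorem mainTheorem2:
  fixes \<epsilon> :: real and c :: "'a::metric_space \<Rightarrow> 'a \<Rightarrow> real" and V :: "'a \<Rightarrow> real"
    and b :: "real \<Rightarrow> 'a \<Rightarrow> real" and b0 :: "'a \<Rightarrow> real"
  assumes "compact (UNIV :: 'a set)"
    and "\<epsilon> > 0"
    and "continuous_on UNIV (\<lambda>(x, y). c x y)"
    and "\<forall>x y. c x y = c y x"
    and "\<forall>x y. c x y \<ge> 0"
    and "pos_def_kernel (kc \<epsilon> c)"
    and "universal_kernel (kc \<epsilon> c)"
    and "continuous_on UNIV V"
    and "\<forall>t\<ge>0. b t \<in> calB \<epsilon> c"
    and "b0 \<in> calB \<epsilon> c"
  shows "sinkhorn_flow_B \<epsilon> c V b b0 \<longleftrightarrow>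
    (\<exists>bd. H1loc_with (kc \<epsilon> c) b bd \<and> b 0 = b0 \<and>
       (AE t in lborel. t \<ge> 0 \<longrightarrow>
          (\<exists>p\<in>Ptilde \<epsilon> c (b t). \<forall>x. bd t x + Wop \<epsilon> c V (b t) x + p x = 0)))"
proof -
  interpret sinkhorn \<epsilon> c
    by unfold_locales (fact assms)+
  show ?thesis
    by (rule flow_characterization) (use assms in auto)
qed

end
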